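(* Let $I\subset\mathbb{R}$ be an interval containing $0$, $\ell>0$, and let $\gamma:I\times(\mathbb{R}/\ell\mathbb{Z})\to\mathbb{R}^3$ be a smooth classical solution of $\partial_t\gamma=\partial_s\gamma\times\partial_{ss}\gamma$ with $|\partial_s\gamma|=1$, such that each $\gamma_t:=\gamma(t,\cdot)$ has no self-intersection. Let $J\subset I$ be a compact subinterval containing $0$, and let $r=r(\gamma,J)$ and $X_{\gamma,r}$ be as defined in the context. Let $T_0\in\mathcal{T}$ and let $(T_t)_{t\in J}$ be a weak binormal curvature flow on $J$ with initial datum $T_0$, with $(V_t)_{t\in J}$ a generalized binormal curvature flow such that $T_{V_t}=T_t$ and $\|V_t\|\le\|T_0\|$ for all $t\in J$. Define on $J$ $$G(t):=\|T_0\|-\int X_{\gamma,r}(x,t)\cdot\xi\,dV_t(x,\xi),\qquad F(t):=\int\big(1-X_{\gamma,r}(x,t)\cdot\xi\big)\,dV_t(x,\xi),$$ which satisfy $G\ge F\ge0$. Then $G$ is Lipschitz on $J$ and $$\Big|\frac{d}{dt}G(t)\Big|\le K F(t)\le K G(t)$$ for almost every $t\in J$, where $K$ is a constant depending only on $r(\gamma,J)$ and $\|\partial_{sss}\gamma\|_{L^\infty(J\times\mathbb{T}^1)}$.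
   Context: Here $\mathbb{T}^1=\mathbb{R}/\ell\mathbb{Z}$. Security radius: for $t\in J$, $r_s(t)$ is the largest positive number such that every $x$ with $d(x,\gamma_t)<r_s(t)$ has a unique closest point $P_t(x)$ on $\gamma_t$. Set $r(\gamma,J):=\frac12\min_{t\in J}\min\big(\|\partial_{ss}\gamma(t,\cdot)\|_\infty^{-1},r_s(t)\big)>0$. Let $\tau_t$ be the oriented unit tangent along $\gamma_t$, and define $X_{\gamma,r}(x,t):=f(d^2(x,\gamma_t))\,\tau_t(P_t(x))$ on $\mathbb{R}^3\times J$, where $f(d^2)=(1-d^2/r^2)^3$ for $0\le d^2\le r^2$ and $f(d^2)=0$ for $d^2\ge r^2$ (so $X_{\gamma,r}=0$ where $P_t$ is undefined). A simple closed oriented curve is a distribution $T\in\mathcal{D}'(\mathbb{R}^3,\mathbb{R}^3)$ of the form $T(X)=\int_{\mathbb{T}^1}X(\gamma(s))\cdot\gamma'(s)\,ds$ for a Lipschitz one-to-one $\gamma$ from a circle to $\mathbb{R}^3$; its length is $L(T)=\int|\gamma'|$. The set $\mathcal{T}$ of integral 1-currents in $\mathbb{R}^3$ without boundary consists of all $T=\sum_{j\in\mathbb{N}}T_j$ with $T_j$ simple closed oriented curves and $\sum_j L(T_j)<\infty$. The mass is $\|T\|:=\sup\{T(X):\|X\|_\infty\le1\}$. An oriented integral 1-varifold without boundary is a finite nonnegative Radon measure $V$ on $\mathbb{R}^3\times S^2$ whose first moment $T_V(X):=\int X(x)\cdot\xi\,dV(x,\xi)$ belongs to $\mathcal{T}$;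 $\|V\|$ is its total mass. A family $(V_t)$ is measurable if $t\mapsto V_t(\mathcal{O})$ is measurable for every Borel $\mathcal{O}$. A generalized binormal curvature flow on $J$ is a measurable family $(V_t)_{t\in J}$ of oriented integral 1-varifolds without boundary such that for every $X\in\mathcal{D}(\mathbb{R}^3,\mathbb{R}^3)$, $t\mapsto\int X\cdot\xi\,dV_t$ is Lipschitz and $\frac{d}{dt}\int X\cdot\xi\,dV_t=-\int D(\mathrm{curl}X):\xi\otimes\xi\,dV_t$ a.e., where $D(\mathrm{curl}X):\xi\otimes\xi=\sum_{k,l}\partial_l(\mathrm{curl}X)^k\xi^k\xi^l$. A weak binormal curvature flow on $J$ with initial datum $T_0$ is a family $(T_t)_{t\in J}$ in $\mathcal{T}$, continuous into $\mathcal{D}'(\mathbb{R}^3,\mathbb{R}^3)$, for which such a generalized flow $(V_t)$ exists with $T_{V_t}=T_t$ and $\|V_t\|\le\|T_0\|$. *)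

theory Defs
  imports "HOL-Analysis.Analysis"
begin

definition pdv :: "'a::euclidean_space \<Rightarrow> ('a \<Rightarrow> 'b::real_normed_vector) \<Rightarrow> 'a set \<Rightarrow> 'a \<Rightarrow> 'b" where
  "pdv b f S x = vector_derivative (\<lambda>h. f (x + h *\<^sub>R b)) (at 0 within {h. x + h *\<^sub>R b \<in> S})"

definition iter_pdv :: "'a::euclidean_space list \<Rightarrow> ('a \<Rightarrow> 'b::real_normed_vector) \<Rightarrow> 'a set \<Rightarrow> 'a \<Rightarrow> 'b" where
  "iter_pdv ds f S = foldr (\<lambda>b g. pdv b g S) ds f"

definition smooth_on :: "'a::euclidean_space set \<Rightarrow> ('a \<Rightarrow> 'b::real_normed_vector) \<Rightarrow> bool" where
  "smooth_on S f \<longleftrightarrow>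
     (\<forall>ds. set ds \<subseteq> Basis \<longrightarrow>
        continuous_on S (iter_pdv ds f S) \<and>
        (\<forall>b\<in>Basis. \<forall>x\<in>S.
           ((\<lambda>h. iter_pdv ds f S (x + h *\<^sub>R b)) has_vector_derivative pdv b (iter_pdv ds f S) S x)
             (at 0 within {h. x + h *\<^sub>R b \<in> S})))"

definition test_field :: "(real^3 \<Rightarrow> real^3) \<Rightarrow> bool" where
  "test_field X \<longleftrightarrow> smooth_on UNIV X \<and> (\<exists>R. \<forall>x. norm x > R \<longrightarrow> X x = 0)"

definition pd3 :: "3 \<Rightarrow> (real^3 \<Rightarrow> 'b::real_normed_vector) \<Rightarrow> real^3 \<Rightarrow> 'b" where
  "pd3 i F = pdv (axis i 1) F UNIV"

definition curl :: "(real^3 \<Rightarrow> real^3) \<Rightarrow> real^3 \<Rightarrow> real^3" where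
  "curl X x = vector [pd3 2 (\<lambda>y. X y $ 3) x - pd3 3 (\<lambda>y. X y $ 2) x,
                      pd3 3 (\<lambda>y. X y $ 1) x - pd3 1 (\<lambda>y. X y $ 3) x,
                      pd3 1 (\<lambda>y. X y $ 2) x - pd3 2 (\<lambda>y. X y $ 1) x]"

definition Dcurl_xixi :: "(real^3 \<Rightarrow> real^3) \<Rightarrow> real^3 \<Rightarrow> real^3 \<Rightarrow> real" where
  "Dcurl_xixi X x \<xi> = (\<Sum>k\<in>UNIV. \<Sum>l\<in>UNIV. pd3 l (\<lambda>y. curl X y $ k) x * \<xi> $ k * \<xi> $ l)"

type_synonym current = "(real^3 \<Rightarrow> real^3) \<Rightarrow> real"

definition simple_closed_param :: "(real \<Rightarrow> real^3) \<Rightarrow> real \<Rightarrow> bool" where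
  "simple_closed_param c L \<longleftrightarrow> L > 0 \<and> (\<exists>C. C-lipschitz_on UNIV c)
      \<and> (\<forall>s. c (s + L) = c s) \<and> inj_on c {0..<L}"

definition curve_current :: "(real \<Rightarrow> real^3) \<Rightarrow> real \<Rightarrow> current" where
  "curve_current c L X = integral {0..L} (\<lambda>s. X (c s) \<bullet> vector_derivative c (at s))"

definition curve_length :: "(real \<Rightarrow> real^3) \<Rightarrow> real \<Rightarrow> real" where
  "curve_length c L = integral {0..L} (\<lambda>s. norm (vector_derivative c (at s)))"

text \<open>Currents are identified when they agree on all test fields.\<close>
definition in_calT :: "current \<Rightarrow> bool" where
  "in_calT T \<longleftrightarrow> (\<exists>(A::nat set) c L.
      (\<forall>j\<in>A. simple_closed_param (c j) (L j))
      \<and> (\<lambda>j. curve_length (c j) (L j)) summable_on A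
      \<and> (\<forall>X. test_field X \<longrightarrow> ((\<lambda>j. curve_current (c j) (L j) X) has_sum T X) A))"

definition mass :: "current \<Rightarrow> real" where
  "mass T = Sup {T X | X. test_field X \<and> (\<forall>x. norm (X x) \<le> 1)}"

type_synonym varifold = "((real^3) \<times> (real^3)) measure"

definition first_moment :: "varifold \<Rightarrow> current" where
  "first_moment V X = (\<integral>p. X (fst p) \<bullet> snd p \<partial>V)"

definition oriented_integral_varifold :: "varifold \<Rightarrow> bool" where
  "oriented_integral_varifold V \<longleftrightarrow>
     sets V = sets borel \<and> finite_measure V
     \<and> emeasure V (- (UNIV \<times> sphere 0 1)) = 0
     \<and> in_calT (first_moment V)"

definition vmass :: "varifold \<Rightarrow> real" where
  "vmass V = measure V (space V)"

definition generalized_BCF :: "real set \<Rightarrow> (real \<Rightarrow> varifold) \<Rightarrow> bool" where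
  "generalized_BCF J V \<longleftrightarrow>
     (\<forall>t\<in>J. oriented_integral_varifold (V t))
     \<and> (\<forall>B\<in>sets borel. (\<lambda>t. measure (V t) B) \<in> borel_measurable (lebesgue_on J))
     \<and> (\<forall>X. test_field X \<longrightarrow>
          (\<exists>C. C-lipschitz_on J (\<lambda>t. first_moment (V t) X))
          \<and> (AE t in lebesgue_on J.
               ((\<lambda>\<tau>. first_moment (V \<tau>) X) has_real_derivative
                  - (\<integral>p. Dcurl_xixi X (fst p) (snd p) \<partial>V t)) (at t within J)))"

definition weak_BCF_with :: "real set \<Rightarrow> current \<Rightarrow> (real \<Rightarrow> current) \<Rightarrow> (real \<Rightarrow> varifold) \<Rightarrow> bool" where
  "weak_BCF_with J T0 T V \<longleftrightarrow>
     (\<forall>t\<in>J. in_calT (T t))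
     \<and> (\<forall>X. test_field X \<longrightarrow> continuous_on J (\<lambda>t. T t X))
     \<and> generalized_BCF J V
     \<and> (\<forall>t\<in>J. \<forall>X. test_field X \<longrightarrow> first_moment (V t) X = T t X)
     \<and> (\<forall>t\<in>J. vmass (V t) \<le> mass T0)"

text \<open>gamma is given as a map on I x R, l-periodic in s. Time direction (1,0), arclength direction (0,1).\<close>
definition d_t :: "real set \<Rightarrow> (real \<times> real \<Rightarrow> real^3) \<Rightarrow> real \<times> real \<Rightarrow> real^3" where
  "d_t I g = pdv (1,0) g (I \<times> UNIV)"

definition d_s :: "real set \<Rightarrow> (real \<times> real \<Rightarrow> real^3) \<Rightarrow> real \<times> real \<Rightarrow> real^3" where
  "d_s I g = pdv (0,1) g (I \<times> UNIV)"

definition closest_unique :: "(real^3) set \<Rightarrow> real^3 \<Rightarrow> bool" where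
  "closest_unique C x \<longleftrightarrow> (\<exists>!p. p \<in> C \<and> dist x p = infdist x C)"

definition closest_point :: "(real^3) set \<Rightarrow> real^3 \<Rightarrow> real^3" where
  "closest_point C x = (THE p. p \<in> C \<and> dist x p = infdist x C)"

definition security_radius :: "(real \<times> real \<Rightarrow> real^3) \<Rightarrow> real \<Rightarrow> real" where
  "security_radius \<gamma> t = Sup {\<rho>. \<rho> > 0 \<and>
      (\<forall>x. infdist x (range (\<lambda>s. \<gamma> (t, s))) < \<rho> \<longrightarrow> closest_unique (range (\<lambda>s. \<gamma> (t, s))) x)}"

definition r_gamma :: "real set \<Rightarrow> (real \<times> real \<Rightarrow> real^3) \<Rightarrow> real set \<Rightarrow> real" where
  "r_gamma I \<gamma> J = (1/2) * (INF t\<in>J. min (inverse (SUP s. norm (d_s I (d_s I \<gamma>) (t, s))))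
                                        (security_radius \<gamma> t))"

definition tangent_at :: "real set \<Rightarrow> (real \<times> real \<Rightarrow> real^3) \<Rightarrow> real \<Rightarrow> real^3 \<Rightarrow> real^3" where
  "tangent_at I \<gamma> t p = d_s I \<gamma> (t, SOME s. \<gamma> (t, s) = p)"

definition cutoff :: "real \<Rightarrow> real \<Rightarrow> real" where
  "cutoff r d2 = (if d2 \<le> r\<^sup>2 then (1 - d2 / r\<^sup>2) ^ 3 else 0)"

definition X_field :: "real set \<Rightarrow> (real \<times> real \<Rightarrow> real^3) \<Rightarrow> real \<Rightarrow> real^3 \<Rightarrow> real \<Rightarrow> real^3" where
  "X_field I \<gamma> r x t =
     (let C = range (\<lambda>s. \<gamma> (t, s)) in
      if closest_unique C x
      then cutoff r ((infdist x C)\<^sup>2) *\<^sub>R tangent_at I \<gamma> t (closest_point C x)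
      else 0)"

end

theory Submission
  imports Defs
begin

text \<open>Inside the tube of radius \<^term>\<open>r\<close> around the curve, the field is
  \<open>X = f(d\<^sup>2) \<tau>(P(x))\<close>. An explicit computation of its time derivative and of \<open>D(curl X)\<close>
  shows that the first-order terms of \<open>\<partial>\<^sub>t X \<cdot> \<xi> - D(curl X) : \<xi> \<otimes> \<xi>\<close> cancel because the curve moves by
  the binormal flow. What remains is quadratic in the distance to the curve and in the part of \<open>\<xi>\<close>
  orthogonal to \<open>\<tau>\<close>, hence bounded by a multiple of \<open>1 - X \<cdot> \<xi>\<close>; integrating against the varifold gives
  the differential inequality.

  The flow equation is only available for smooth, time-independent test fields, whereas \<open>X\<close> is
  just \<open>C\<^sup>2\<close> in space and depends on time. The countably many mollified slices of \<open>X\<close> at rational times are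
  admissible, and they are dense enough in \<open>C\<^sup>2\<close> to identify the derivative of the pairing with \<open>X\<close> outside
  one common null set.\<close>

section \<open>Mollification by product kernels\<close>

text \<open>The difficulty in passing from test fields to X is that each smooth field has its own
  exceptional null set of times. Differentiability is transferred by a quantitative fact: if two
  fields have close D(curl), the difference of their pairings has a small a.e. derivative and, being
  Lipschitz, a small Lipschitz constant in time. The difference quotients of the two pairings then
  stay close at every time. The constant depends on r and the bound \<open>M\<close> of the third
  arclength derivative alone for two reasons. The definition of r bounds the curvature by 1/(2r),
  which keeps the tubular Jacobian at least 1/2 on the support; and the unit tangent moves with
  velocity \<open>cross3 g1 g3\<close>, so no further derivative of the curve enters. A separate
  obstacle is r itself. It is formed with \<open>INF\<close>, \<open>Sup\<close> and
  \<open>inverse\<close>, which are total functions, so it has its intended meaning only once the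
  curvature is known to be bounded and not identically zero, and the security radii to be finite and
  bounded below uniformly in time. Finiteness is a topological fact about circles.\<close>

definition flat_exp :: "nat \<Rightarrow> real \<Rightarrow> real" where
  "flat_exp n x = (if x > 0 then (1 / x) ^ n * exp (- (1 / x)) else 0)"

text \<open>Carrying the power of 1/x as an index makes the family closed under differentiation up
  to linear combinations. At 0 the right difference quotient is the next member of the family, which
  tends to 0 because the exponential beats every power.\<close>

lemma flat_exp_derivative:
  "(flat_exp n has_real_derivative flat_exp (n + 2) x - real n * flat_exp (n + 1) x) (at x)"
proof -
  consider "x > 0" | "x < 0" | "x = 0" by linarith
  then show ?thesis
  proof cases
    case 1
    have "((\<lambda>x. (1 / x) ^ n * exp (- (1 / x))) has_real_derivative
        flat_exp (n + 2) x - real n * flat_exp (n + 1) x) (at x)"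
    proof (cases n)
      case 0
      then show ?thesis using 1
        by (auto intro!: derivative_eq_intros simp: flat_exp_def field_simps power2_eq_square)
    next
      case (Suc m)
      then show ?thesis using 1
        by (auto intro!: derivative_eq_intros simp: flat_exp_def divide_simps power2_eq_square)
           (cases m; simp add: algebra_simps)
    qed
    then show ?thesis
      by (rule has_field_derivative_transform_within_open[where S="{0<..}"])
        (use 1 in \<open>auto simp: flat_exp_def\<close>)
  next
    case 2
    have "((\<lambda>x. 0) has_real_derivative 0) (at x)" by simp
    then have "(flat_exp n has_real_derivative 0) (at x)"
      by (rule has_field_derivative_transform_within_open[where S="{..<0}"])
        (use 2 in \<open>auto simp: flat_exp_def\<close>)
    then show ?thesis using 2 by (simp add: flat_exp_def)
  next
    case 3
    have lim: "((\<lambda>y::real. y ^ (n + 1) / exp y) \<longlongrightarrow> 0) at_top"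
      by (rule tendsto_power_div_exp_0)
    have "((\<lambda>h. flat_exp n h / h) \<longlongrightarrow> 0) (at_right 0)"
    proof -
      have "((\<lambda>h::real. (1/h) ^ (n + 1) / exp (1/h)) \<longlongrightarrow> 0) (at_right 0)"
        using filterlim_compose[OF lim filterlim_inverse_at_top_right]
        by (simp add: inverse_eq_divide)
      then show ?thesis
        by (rule Lim_transform_eventually)
          (auto simp: eventually_at_filter flat_exp_def exp_minus field_simps)
    qed
    moreover have "((\<lambda>h. flat_exp n h / h) \<longlongrightarrow> 0) (at_left 0)"
      by (rule tendsto_eventually) (auto simp: eventually_at_filter flat_exp_def)
    ultimately have "((\<lambda>h. flat_exp n h / h) \<longlongrightarrow> 0) (at 0)"
      by (simp add: filterlim_at_split)
    then have "(flat_exp n has_real_derivative 0) (at 0)"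
      by (simp add: has_field_derivative_iff flat_exp_def)
    then show ?thesis using 3 by (simp add: flat_exp_def)
  qed
qed

text \<open>A class of bumps supported in \<open>[-e, e]\<close> that is closed under differentiation, so that iterated partial
  derivatives of a mollified field are again mollifications of that field.\<close>

inductive_set bump1 :: "real \<Rightarrow> (real \<Rightarrow> real) set" for e where
  base: "(\<lambda>x. flat_exp m (e + x) * flat_exp n (e - x)) \<in> bump1 e"
| lin: "f \<in> bump1 e \<Longrightarrow> g \<in> bump1 e \<Longrightarrow> (\<lambda>x. a * f x + b * g x) \<in> bump1 e"

lemma bump1_derivative:
  assumes "f \<in> bump1 e"
  shows "\<exists>f'\<in>bump1 e. \<forall>x. (f has_real_derivative f' x) (at x)"
  using assms
proof induction
  case (base m n)
  let ?b = "\<lambda>m n x. flat_exp m (e + x) * flat_exp n (e - x)"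
  let ?f' = "\<lambda>x. 1 * (1 * ?b (m + 2) n x + - real m * ?b (m + 1) n x)
      + 1 * (- 1 * ?b m (n + 2) x + real n * ?b m (n + 1) x)"
  have "?f' \<in> bump1 e"
    by (intro bump1.lin bump1.base)
  moreover have "(?b m n has_real_derivative ?f' x) (at x)" for x
    by (auto intro!: derivative_eq_intros DERIV_chain2[OF flat_exp_derivative] simp: algebra_simps)
  ultimately show ?case by (intro bexI[of _ ?f'] allI)
next
  case (lin f g a b)
  then obtain f' g' where "f' \<in> bump1 e" "g' \<in> bump1 e"
    "\<forall>x. (f has_real_derivative f' x) (at x)" "\<forall>x. (g has_real_derivative g' x) (at x)"
    by blast
  then show ?case
    by (intro bexI[where x="\<lambda>x. a * f' x + b * g' x"])
      (auto intro!: derivative_eq_intros bump1.lin)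
qed

lemma bump1_continuous: "f \<in> bump1 e \<Longrightarrow> continuous_on S f"
  using bump1_derivative by (meson DERIV_continuous_on has_field_derivative_at_within)

lemma bump1_support: "f \<in> bump1 e \<Longrightarrow> \<bar>x\<bar> \<ge> e \<Longrightarrow> f x = 0"
  by (induction rule: bump1.induct) (auto simp: flat_exp_def)

text \<open>Products of one-variable bumps suffice because a partial derivative touches a single
  factor and \<open>bump1\<close> absorbs the resulting linear combinations. A partial derivative is
  therefore again a single product, not a sum of products.\<close>

definition bump3 :: "real \<Rightarrow> (real^3 \<Rightarrow> real) set" where
  "bump3 e = {\<lambda>x. f (x $ 1) * g (x $ 2) * h (x $ 3) | f g h. f \<in> bump1 e \<and> g \<in> bump1 e \<and> h \<in> bump1 e}"

lemma bump3I:
  "f \<in> bump1 e \<Longrightarrow> g \<in> bump1 e \<Longrightarrow> h \<in> bump1 e \<Longrightarrow>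
    (\<lambda>x. f (x $ 1) * g (x $ 2) * h (x $ 3)) \<in> bump3 e"
  unfolding bump3_def by blast

lemma bump3_continuous: "k \<in> bump3 e \<Longrightarrow> continuous_on S k"
  unfolding bump3_def
  by (auto intro!: continuous_intros intro: continuous_on_compose2[OF bump1_continuous[of _ e UNIV]])

lemma bump3_support:
  assumes "k \<in> bump3 e" "x \<notin> cbox (- vec e) (vec e)"
  shows "k x = 0"
proof -
  obtain i where "\<bar>x $ i\<bar> \<ge> e"
    using assms(2) by (auto simp: mem_box_cart) (metis abs_ge_minus_self abs_ge_self linorder_linear minus_le_iff order_trans)+
  then have "\<bar>x $ 1\<bar> \<ge> e \<or> \<bar>x $ 2\<bar> \<ge> e \<or> \<bar>x $ 3\<bar> \<ge> e"
    using exhaust_3 by metis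
  then show ?thesis
    using assms(1) by (auto simp: bump3_def bump1_support)
qed

lemma Basis_real3: "(b::real^3) \<in> Basis \<longleftrightarrow> b = axis 1 1 \<or> b = axis 2 1 \<or> b = axis 3 1"
  by (auto simp: Basis_vec_def) (metis exhaust_3)

lemma bump3_derivative:
  assumes "k \<in> bump3 e" "b \<in> Basis"
  shows "\<exists>k'\<in>bump3 e. \<forall>x h. ((\<lambda>h. k (x + h *\<^sub>R b)) has_vector_derivative k' (x + h *\<^sub>R b)) (at h)"
proof -
  obtain f g h where fgh: "f \<in> bump1 e" "g \<in> bump1 e" "h \<in> bump1 e"
    and k: "k = (\<lambda>x. f (x $ 1) * g (x $ 2) * h (x $ 3))"
    using assms by (auto simp: bump3_def)
  obtain f' g' h' where fgh': "f' \<in> bump1 e" "g' \<in> bump1 e" "h' \<in> bump1 e"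
    and D: "\<And>x. (f has_real_derivative f' x) (at x)" "\<And>x. (g has_real_derivative g' x) (at x)"
      "\<And>x. (h has_real_derivative h' x) (at x)"
    using fgh bump1_derivative by metis
  have shift: "((\<lambda>h. \<phi> (z + h)) has_real_derivative \<phi>' (z + h)) (at h)"
    if "\<And>x. (\<phi> has_real_derivative \<phi>' x) (at x)" for \<phi> \<phi>' z and h :: real
    using that[of "h + z"] DERIV_shift[of \<phi> "\<phi>' (h + z)" h z] by (simp add: add.commute)
  consider "b = axis 1 1" | "b = axis 2 1" | "b = axis 3 1"
    using assms(2) Basis_real3 by blast
  then show ?thesis
  proof cases
    case 1
    have "((\<lambda>h. k (x + h *\<^sub>R b)) has_vector_derivative
        (f' ((x + t *\<^sub>R b) $ 1) * g ((x + t *\<^sub>R b) $ 2) * h ((x + t *\<^sub>R b) $ 3))) (at t)" for x t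
      using DERIV_cmult_right[OF DERIV_cmult_right[OF shift[OF D(1), of "x $ 1" t], of "g (x $ 2)"], of "h (x $ 3)"]
      by (simp add: 1 k axis_def has_real_derivative_iff_has_vector_derivative)
    then show ?thesis
      using fgh fgh' by (intro bexI[where x="\<lambda>x. f' (x $ 1) * g (x $ 2) * h (x $ 3)"]) (auto intro!: bump3I)
  next
    case 2
    have "((\<lambda>h. k (x + h *\<^sub>R b)) has_vector_derivative
        (f ((x + t *\<^sub>R b) $ 1) * g' ((x + t *\<^sub>R b) $ 2) * h ((x + t *\<^sub>R b) $ 3))) (at t)" for x t
      using DERIV_cmult_right[OF DERIV_cmult[OF shift[OF D(2), of "x $ 2" t], of "f (x $ 1)"], of "h (x $ 3)"]
      by (simp add: 2 k axis_def has_real_derivative_iff_has_vector_derivative)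
    then show ?thesis
      using fgh fgh' by (intro bexI[where x="\<lambda>x. f (x $ 1) * g' (x $ 2) * h (x $ 3)"]) (auto intro!: bump3I)
  next
    case 3
    have "((\<lambda>h. k (x + h *\<^sub>R b)) has_vector_derivative
        (f ((x + t *\<^sub>R b) $ 1) * g ((x + t *\<^sub>R b) $ 2) * h' ((x + t *\<^sub>R b) $ 3))) (at t)" for x t
      using DERIV_cmult[OF shift[OF D(3), of "x $ 3" t], of "f (x $ 1) * g (x $ 2)"]
      by (simp add: 3 k axis_def has_real_derivative_iff_has_vector_derivative)
    then show ?thesis
      using fgh fgh' by (intro bexI[where x="\<lambda>x. f (x $ 1) * g (x $ 2) * h' (x $ 3)"]) (auto intro!: bump3I)
  qed
qed

lemma bump3_normalized:
  assumes "e > 0"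
  obtains k where "k \<in> bump3 e" "\<And>x. k x \<ge> 0" "integral (cbox (- vec e) (vec e)) k = 1"
proof -
  define f where "f = (\<lambda>x. flat_exp 0 (e + x) * flat_exp 0 (e - x))"
  define k where "k = (\<lambda>x::real^3. f (x $ 1) * f (x $ 2) * f (x $ 3))"
  let ?B = "cbox (- vec e) (vec e) :: (real^3) set"
  have f: "f \<in> bump1 e" "\<And>x. f x \<ge> 0" "f 0 > 0"
    using bump1.base[of 0 e 0] assms by (auto simp: f_def flat_exp_def)
  then have k: "k \<in> bump3 e" "\<And>x. k x \<ge> 0" "k 0 > 0"
    unfolding k_def by (auto intro: bump3I)
  have int: "k integrable_on ?B"
    by (intro integrable_continuous bump3_continuous[OF k(1)])
  have "integral ?B k \<noteq> 0"
  proof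
    assume "integral ?B k = 0"
    then have "(k has_integral 0) ?B"
      using integrable_integral[OF int] by simp
    moreover have "0 \<in> ?B" "box (- vec e) (vec e) \<noteq> ({} :: (real^3) set)"
      using assms by (auto simp: mem_box_cart interval_ne_empty_cart)
    ultimately have "k 0 = 0"
      using has_integral_0_cbox_imp_0[of "- vec e" "vec e" k 0] bump3_continuous[OF k(1)] k(2) by blast
    then show False using k by simp
  qed
  moreover have "integral ?B k \<ge> 0"
    by (rule integral_nonneg[OF int]) (use k in auto)
  ultimately have pos: "integral ?B k > 0" by simp
  \<comment> \<open>The normalizing constant is put into the first factor, so that the kernel keeps
    its product form.\<close>
  define c where "c = inverse (integral ?B k)"
  have cf: "(\<lambda>x. c * f x) \<in> bump1 e"
    using bump1.lin[OF f(1) f(1), of c 0] by simp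
  have "(\<lambda>x. c * k x) = (\<lambda>x. c * f (x $ 1) * f (x $ 2) * f (x $ 3))"
    by (simp add: k_def mult.assoc)
  then have "(\<lambda>x. c * k x) \<in> bump3 e"
    using bump3I[OF cf f(1) f(1)] by simp
  moreover have "integral ?B (\<lambda>x. c * k x) = 1"
    using pos by (simp add: c_def)
  moreover have "c * k x \<ge> 0" for x
    using pos k(2) by (simp add: c_def)
  ultimately show thesis using that by blast
qed

section \<open>Convolution: smoothness, derivatives and uniform closeness\<close>

definition convol :: "(real^3 \<Rightarrow> real) \<Rightarrow> (real^3 \<Rightarrow> real^3) \<Rightarrow> real^3 \<Rightarrow> real^3" where
  "convol k f x = integral UNIV (\<lambda>y. k (x - y) *\<^sub>R f y)"

lemma integral_UNIV_eq_support:
  fixes f :: "'a::euclidean_space \<Rightarrow> 'b::banach"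
  assumes "\<And>x. x \<notin> S \<Longrightarrow> f x = 0"
  shows "integral UNIV f = integral S f"
proof -
  have "f = (\<lambda>x. if x \<in> S then f x else 0)" using assms by auto
  then show ?thesis using integral_restrict_UNIV[of S f] by simp
qed

lemma convol_box:
  assumes "\<And>y. y \<notin> cbox a b \<Longrightarrow> f y = 0"
  shows "convol k f x = integral (cbox a b) (\<lambda>y. k (x - y) *\<^sub>R f y)"
  unfolding convol_def by (rule integral_UNIV_eq_support) (use assms in auto)

text \<open>Both forms of the integral are used. With the shift in the kernel, derivatives fall on
  the kernel, which gives smoothness. With the shift in the field they fall on the field, which
  shows that derivatives of mollifications are mollified derivatives and hence converge.\<close>

lemma convol_swap:
  assumes k: "k \<in> bump3 e" and f: "continuous_on UNIV f" "\<And>y. y \<notin> cbox a b \<Longrightarrow> f y = 0"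
  shows "convol k f x = integral (cbox (- vec e) (vec e)) (\<lambda>y. k y *\<^sub>R f (x - y))"
proof -
  let ?g = "\<lambda>y. k y *\<^sub>R f (x - y)"
  have "continuous_on (cbox a b) (\<lambda>y. k (x - y) *\<^sub>R f y)"
    by (intro continuous_intros continuous_on_compose2[OF bump3_continuous[OF k, of UNIV]]
        continuous_on_subset[OF f(1)]) auto
  then have 1: "((\<lambda>y. k (x - y) *\<^sub>R f y) has_integral convol k f x) (cbox a b)"
    using integrable_integral[OF integrable_continuous] by (simp add: convol_box[of a b f, OF f(2)])
  have "(?g has_integral convol k f x) ((\<lambda>y. (1 / - 1) *\<^sub>R y + - ((1 / - 1) *\<^sub>R x)) ` cbox a b)"
    using has_integral_affinity[OF 1, of "-1" x] by (simp add: )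
  moreover have "(\<lambda>y. (1 / - 1) *\<^sub>R y + - ((1 / - 1) *\<^sub>R x)) ` cbox a b = (\<lambda>y. x - y) ` cbox a b"
    by simp
  ultimately have "convol k f x = integral ((\<lambda>y. x - y) ` cbox a b) ?g"
    by (metis integral_unique)
  also have "\<dots> = integral UNIV ?g"
    by (rule integral_UNIV_eq_support[symmetric])
      (use f(2) in \<open>auto simp: image_iff, metis diff_diff_eq2 add_diff_cancel_left'\<close>)
  also have "\<dots> = integral (cbox (- vec e) (vec e)) ?g"
    by (rule integral_UNIV_eq_support) (use bump3_support[OF k] in auto)
  finally show ?thesis .
qed

lemma convol_derivative:
  assumes f: "continuous_on UNIV f" "\<And>y. y \<notin> cbox a b \<Longrightarrow> f y = 0"
    and k': "k' \<in> bump3 e"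
    and k: "k \<in> bump3 e" "\<And>x h. ((\<lambda>h. k (x + h *\<^sub>R v)) has_vector_derivative k' (x + h *\<^sub>R v)) (at h)"
  shows "((\<lambda>h. convol k f (x + h *\<^sub>R v)) has_vector_derivative convol k' f x) (at 0)"
proof -
  have "((\<lambda>h. integral (cbox a b) (\<lambda>y. k (x + h *\<^sub>R v - y) *\<^sub>R f y)) has_vector_derivative
     integral (cbox a b) (\<lambda>y. k' (x + 0 *\<^sub>R v - y) *\<^sub>R f y)) (at 0 within UNIV)"
  proof (rule leibniz_rule_vector_derivative)
    fix h :: real and y
    have "((\<lambda>h. k ((x - y) + h *\<^sub>R v)) has_vector_derivative k' ((x - y) + h *\<^sub>R v)) (at h)"
      by (rule k)
    then have "((\<lambda>h. k (x + h *\<^sub>R v - y)) has_real_derivative k' (x + h *\<^sub>R v - y)) (at h)"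
      by (simp add: has_real_derivative_iff_has_vector_derivative algebra_simps)
    from has_vector_derivative_scaleR[OF this has_vector_derivative_const[of "f y"]]
    show "((\<lambda>h. k (x + h *\<^sub>R v - y) *\<^sub>R f y) has_vector_derivative k' (x + h *\<^sub>R v - y) *\<^sub>R f y) (at h within UNIV)"
      by simp
  next
    fix h :: real
    show "(\<lambda>y. k (x + h *\<^sub>R v - y) *\<^sub>R f y) integrable_on cbox a b"
      by (intro integrable_continuous continuous_intros continuous_on_compose2[OF bump3_continuous[OF k(1), of UNIV]]
        continuous_on_subset[OF f(1)]) auto
  next
    show "continuous_on (UNIV \<times> cbox a b) (\<lambda>(h, y). k' (x + h *\<^sub>R v - y) *\<^sub>R f y)"
      unfolding split_beta
      by (intro continuous_intros continuous_on_compose2[OF bump3_continuous[OF k', of UNIV]]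
        continuous_on_compose2[OF f(1)]) auto
  qed auto
  then show ?thesis
    by (simp add: convol_box[of a b f, OF f(2)])
qed

text \<open>The hypothesis supplies a directional derivative at increment 0 for every base point;
  composing with a translation gives it at every increment, as differentiation under the integral
  requires.\<close>

lemma convol_derivative_right:
  assumes f: "continuous_on UNIV f" "\<And>y. y \<notin> cbox a b \<Longrightarrow> f y = 0"
    and f': "continuous_on UNIV f'" "\<And>y. y \<notin> cbox a b \<Longrightarrow> f' y = 0"
    and D: "\<And>x. ((\<lambda>h. f (x + h *\<^sub>R v)) has_vector_derivative f' x) (at 0)"
    and k: "k \<in> bump3 e"
  shows "((\<lambda>h. convol k f (x + h *\<^sub>R v)) has_vector_derivative convol k f' x) (at 0)"
proof -
  let ?B = "cbox (- vec e) (vec e) :: (real^3) set"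
  have "((\<lambda>h. integral ?B (\<lambda>y. k y *\<^sub>R f (x + h *\<^sub>R v - y))) has_vector_derivative
     integral ?B (\<lambda>y. k y *\<^sub>R f' (x + 0 *\<^sub>R v - y))) (at 0 within UNIV)"
  proof (rule leibniz_rule_vector_derivative)
    fix h :: real and y
    have "((\<lambda>s. f ((x + h *\<^sub>R v - y) + s *\<^sub>R v)) has_vector_derivative f' (x + h *\<^sub>R v - y)) (at 0)"
      by (rule D)
    then have "(((\<lambda>s. f ((x + h *\<^sub>R v - y) + s *\<^sub>R v)) \<circ> (\<lambda>s. s - h)) has_vector_derivative 1 *\<^sub>R f' (x + h *\<^sub>R v - y)) (at h)"
      by (intro vector_diff_chain_at) (auto intro!: derivative_eq_intros)
    then have "((\<lambda>h. f (x + h *\<^sub>R v - y)) has_vector_derivative f' (x + h *\<^sub>R v - y)) (at h)"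
      by (simp add: o_def algebra_simps)
    then show "((\<lambda>h. k y *\<^sub>R f (x + h *\<^sub>R v - y)) has_vector_derivative k y *\<^sub>R f' (x + h *\<^sub>R v - y)) (at h within UNIV)"
      by (auto intro!: derivative_eq_intros)
  next
    fix h :: real
    show "(\<lambda>y. k y *\<^sub>R f (x + h *\<^sub>R v - y)) integrable_on ?B"
      by (intro integrable_continuous continuous_intros bump3_continuous[OF k] continuous_on_compose2[OF f(1)]) auto
  next
    show "continuous_on (UNIV \<times> ?B) (\<lambda>(h, y). k y *\<^sub>R f' (x + h *\<^sub>R v - y))"
      unfolding split_beta
      by (intro continuous_intros continuous_on_compose2[OF bump3_continuous[OF k, of UNIV]]
        continuous_on_compose2[OF f'(1)]) auto
  qed auto
  then show ?thesis
    by (simp add: convol_swap[OF k f] convol_swap[OF k f'])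
qed

lemma convol_continuous:
  assumes k: "k \<in> bump3 e" and f: "continuous_on UNIV f" "\<And>y. y \<notin> cbox a b \<Longrightarrow> f y = 0"
  shows "continuous_on UNIV (convol k f)"
proof -
  have "continuous_on UNIV (\<lambda>x. integral (cbox a b) (\<lambda>y. k (x - y) *\<^sub>R f y))"
    by (rule integral_continuous_on_param, unfold split_beta)
      (intro continuous_intros continuous_on_compose2[OF bump3_continuous[OF k, of UNIV]]
        continuous_on_compose2[OF f(1)]; auto)
  then show ?thesis
    by (simp add: convol_box[of a b f, OF f(2)])
qed

text \<open>A nonnegative kernel of mass one averages the values of \<open>f\<close> near
  \<open>x\<close>, so a bound on their distance to \<open>w\<close> survives. With
  \<open>w = 0\<close> this becomes a sup bound, otherwise an approximation estimate.\<close>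

lemma convol_close:
  assumes k: "k \<in> bump3 e" "\<And>x. k x \<ge> 0" "integral (cbox (- vec e) (vec e)) k = 1"
    and f: "continuous_on UNIV f" "\<And>y. y \<notin> cbox a b \<Longrightarrow> f y = 0"
    and close: "\<And>y. y \<in> cbox (- vec e) (vec e) \<Longrightarrow> norm (f (x - y) - w) \<le> \<eta>"
  shows "norm (convol k f x - w) \<le> \<eta>"
proof -
  let ?B = "cbox (- vec e) (vec e) :: (real^3) set"
  have i1: "k integrable_on ?B"
    by (intro integrable_continuous bump3_continuous[OF k(1)])
  have i2: "(\<lambda>y. k y *\<^sub>R f (x - y)) integrable_on ?B"
    by (intro integrable_continuous continuous_intros bump3_continuous[OF k(1)] continuous_on_compose2[OF f(1)]) auto
  have i3: "(\<lambda>y. k y *\<^sub>R w) integrable_on ?B"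
    by (intro integrable_continuous continuous_intros bump3_continuous[OF k(1)])
  have "integral ?B (\<lambda>y. k y *\<^sub>R w) = w"
    using integral_linear[OF i1, of "\<lambda>c. c *\<^sub>R w"] k(3) by (simp add: o_def bounded_linear_scaleR_left)
  then have "convol k f x - w = integral ?B (\<lambda>y. k y *\<^sub>R (f (x - y) - w))"
    using i2 i3 by (simp add: convol_swap[OF k(1) f] scaleR_diff_right integral_diff)
  also have "norm \<dots> \<le> integral ?B (\<lambda>y. k y * \<eta>)"
  proof (rule integral_norm_bound_integral)
    show "(\<lambda>y. k y *\<^sub>R (f (x - y) - w)) integrable_on ?B"
      using integrable_diff[OF i2 i3] by (simp add: scaleR_diff_right)
    show "(\<lambda>y. k y * \<eta>) integrable_on ?B"
      by (intro integrable_continuous continuous_intros bump3_continuous[OF k(1)])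
  qed (use k(2) close in \<open>auto intro!: mult_left_mono\<close>)
  also have "\<dots> = \<eta>"
    using k(3) by simp
  finally show ?thesis .
qed

lemma iter_pdv_convol:
  assumes k: "k \<in> bump3 e" and f: "continuous_on UNIV f" "\<And>y. y \<notin> cbox a b \<Longrightarrow> f y = 0"
    and "set ds \<subseteq> Basis"
  shows "\<exists>k'\<in>bump3 e. iter_pdv ds (convol k f) UNIV = convol k' f"
  using assms(4)
proof (induction ds)
  case Nil
  then show ?case using k by (auto simp: iter_pdv_def)
next
  case (Cons v ds)
  then obtain k' where k': "k' \<in> bump3 e" "iter_pdv ds (convol k f) UNIV = convol k' f" "v \<in> Basis"
    by auto
  obtain k'' where k'': "k'' \<in> bump3 e"
     "\<And>x h. ((\<lambda>h. k' (x + h *\<^sub>R v)) has_vector_derivative k'' (x + h *\<^sub>R v)) (at h)"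
    using bump3_derivative[OF k'(1,3)] by blast
  have "pdv v (convol k' f) UNIV = convol k'' f"
    unfolding pdv_def using convol_derivative[of f a b, OF f k''(1) k'(1) k''(2)]
    by (auto intro!: vector_derivative_at)
  then show ?case
    using k' k''(1) by (auto simp: iter_pdv_def)
qed

lemma convol_test_field:
  assumes k: "k \<in> bump3 e" and f: "continuous_on UNIV f" "\<And>y. y \<notin> cbox a b \<Longrightarrow> f y = 0"
  shows "test_field (convol k f)"
  unfolding test_field_def
proof
  show "smooth_on UNIV (convol k f)"
    unfolding smooth_on_def
  proof (intro allI impI conjI ballI)
    fix ds :: "(real^3) list" assume ds: "set ds \<subseteq> Basis"
    obtain k' where k': "k' \<in> bump3 e" "iter_pdv ds (convol k f) UNIV = convol k' f"
      using iter_pdv_convol[OF k f ds] by auto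
    then show "continuous_on UNIV (iter_pdv ds (convol k f) UNIV)"
      using convol_continuous[OF k'(1) f] by simp
    fix v x :: "real^3" assume "v \<in> Basis"
    then obtain k'' where k'': "k'' \<in> bump3 e"
     "\<And>x h. ((\<lambda>h. k' (x + h *\<^sub>R v)) has_vector_derivative k'' (x + h *\<^sub>R v)) (at h)"
      using bump3_derivative[OF k'(1)] by blast
    note D = convol_derivative[of f a b, OF f k''(1) k'(1) k''(2)]
    show "((\<lambda>h. iter_pdv ds (convol k f) UNIV (x + h *\<^sub>R v)) has_vector_derivative
           pdv v (iter_pdv ds (convol k f) UNIV) UNIV x) (at 0 within {h. x + h *\<^sub>R v \<in> UNIV})"
      using D[of x] by (simp add: k'(2) pdv_def vector_derivative_at[OF D])
  qed
  let ?C = "(\<lambda>(x, y). x + y) ` (cbox (- vec e) (vec e) \<times> cbox a b)"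
  have "compact ?C"
    by (intro compact_continuous_image compact_Times compact_cbox) (auto simp: split_beta intro!: continuous_intros)
  then obtain R where R: "\<And>x. x \<in> ?C \<Longrightarrow> norm x \<le> R"
    using compact_imp_bounded bounded_iff by metis
  have "convol k f x = 0" if "norm x > R" for x
  proof -
    have "k (x - y) *\<^sub>R f y = 0" for y
    proof (rule ccontr)
      assume "k (x - y) *\<^sub>R f y \<noteq> 0"
      then have "y \<in> cbox a b" "x - y \<in> cbox (- vec e) (vec e)"
        using f(2) bump3_support[OF k] by force+
      then have "x \<in> ?C" by (force simp: image_iff)
      then show False using R that by force
    qed
    then show ?thesis unfolding convol_def by (simp only: integral_0)
  qed
  then show "\<exists>R. \<forall>x. R < norm x \<longrightarrow> convol k f x = 0" by blast
qed

text \<open>The Lipschitz bound is what excludes Cantor-type behaviour: it dominates the forward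
  difference quotients, which converge a.e. to the given derivative. Their integrals are differences
  of averages of \<open>f\<close> near the two ends and converge to the increment, so dominated
  convergence writes the increment as the integral of the a.e. derivative.\<close>

lemma lipschitz_bound_of_AE_derivative:
  fixes f D :: "real \<Rightarrow> real"
  assumes lip: "C0-lipschitz_on {a..b} f"
    and AE: "AE t in lebesgue_on {a..b}. (f has_real_derivative D t) (at t within {a..b}) \<and> \<bar>D t\<bar> \<le> C"
    and C: "0 \<le> C" and xy: "a \<le> x" "x \<le> y" "y \<le> b"
  shows "\<bar>f y - f x\<bar> \<le> C * (y - x)"
proof (cases "x = y")
  case False
  then have "x < y" using xy by simp
  have C0: "C0 \<ge> 0" using lip by (auto simp: lipschitz_on_def)
  have lip': "\<bar>f s - f t\<bar> \<le> C0 * \<bar>s - t\<bar>" if "s \<in> {a..b}" "t \<in> {a..b}" for s t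
    using lipschitz_onD[OF lip that] by (simp add: dist_real_def)
  obtain N where N: "{t \<in> space (lebesgue_on {a..b}). \<not> ((f has_real_derivative D t) (at t within {a..b}) \<and> \<bar>D t\<bar> \<le> C)} \<subseteq> N"
    "emeasure (lebesgue_on {a..b}) N = 0" "N \<in> sets (lebesgue_on {a..b})"
    by (rule AE_E[OF AE])
  have "N \<in> null_sets (lebesgue_on {a..b})" using N(2,3) by auto
  then have "negligible N"
    by (subst (asm) null_sets_restrict_space) (auto simp: negligible_iff_null_sets)
  \<comment> \<open>The end points are discarded as well, so that off \<open>N'\<close> the
    derivative within \<open>{a..b}\<close> is a two-sided derivative.\<close>
  define N' where "N' = N \<union> {x, y}"
  have N': "negligible N'" unfolding N'_def using \<open>negligible N\<close> by (intro negligible_Un) auto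
  \<comment> \<open>Constant continuation of \<open>f\<close> outside \<open>[x, y]\<close>: forward
    quotients at points near \<open>y\<close> stay meaningful and the Lipschitz constant is
    unchanged.\<close>
  define g where "g = (\<lambda>t. f (max x (min y t)))"
  define G where "G = (\<lambda>t. integral {x - 1..t} g)"
  define h where "h = (\<lambda>k::nat. inverse (real (Suc k)))"
  have h: "0 < h k" "h k \<le> 1" for k by (auto simp: h_def field_simps)
  have h0: "filterlim h (at 0) sequentially"
    unfolding filterlim_at using LIMSEQ_inverse_real_of_nat h(1)
    by (auto simp: h_def intro: eventually_mono less_imp_neq)
  have glip: "\<bar>g s - g t\<bar> \<le> C0 * \<bar>s - t\<bar>" for s t
  proof -
    have "\<bar>g s - g t\<bar> \<le> C0 * \<bar>max x (min y s) - max x (min y t)\<bar>"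
      unfolding g_def using xy by (intro lip') auto
    also have "\<dots> \<le> C0 * \<bar>s - t\<bar>" using C0 by (intro mult_left_mono) auto
    finally show ?thesis .
  qed
  have "C0-lipschitz_on UNIV g"
    using glip C0 by (auto simp: lipschitz_on_def dist_real_def)
  then have gc: "continuous_on S g" for S
    using lipschitz_on_continuous_on continuous_on_subset by blast
  have G: "(G has_real_derivative g t) (at t)" if "x \<le> t" "t \<le> y + 1" for t
  proof -
    have "(G has_real_derivative g t) (at t within {x - 1..y + 2})"
      unfolding G_def using that by (intro integral_has_real_derivative gc) auto
    then have "(G has_real_derivative g t) (at t within {x - 1<..<y + 2})"
      by (rule DERIV_subset) auto
    then show ?thesis
      using that by (subst (asm) at_within_open) auto
  qed
  define q where "q = (\<lambda>k t. (g (t + h k) - g t) / h k)"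
  have q_int: "(q k has_integral ((G (y + h k) - G y) / h k - (G (x + h k) - G x) / h k)) {x..y}" for k
  proof -
    have "((\<lambda>t. (G (t + h k) - G t) / h k) has_vector_derivative q k t) (at t within {x..y})" if "t \<in> {x..y}" for t
    proof -
      have "(G has_real_derivative g (t + h k)) (at (t + h k))" using that h[of k] by (intro G) auto
      then have "((\<lambda>t. G (t + h k)) has_real_derivative g (t + h k)) (at t)" by (simp add: DERIV_shift)
      moreover have "(G has_real_derivative g t) (at t)" using that by (intro G) auto
      ultimately have "((\<lambda>t. (G (t + h k) - G t) / h k) has_real_derivative q k t) (at t)"
        unfolding q_def by (intro DERIV_cdivide DERIV_diff)
      then show ?thesis
        by (simp add: has_real_derivative_iff_has_vector_derivative has_vector_derivative_at_within)
    qed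
    from fundamental_theorem_of_calculus[OF xy(2) this] show ?thesis by (simp add: diff_divide_distrib)
  qed
  have "(\<lambda>k. (G (t + h k) - G t) / h k) \<longlonglongrightarrow> g t" if "x \<le> t" "t \<le> y" for t
    using G[of t] that filterlim_compose[OF _ h0] by (auto simp: DERIV_def)
  then have lim: "(\<lambda>k. (G (y + h k) - G y) / h k - (G (x + h k) - G x) / h k) \<longlonglongrightarrow> g y - g x"
    using xy by (intro tendsto_diff) auto
  define q' where "q' = (\<lambda>k t. if t \<in> N' then 0 else q k t)"
  define D' where "D' = (\<lambda>t. if t \<in> N' then 0 else D t)"
  have q'_int: "(q' k has_integral ((G (y + h k) - G y) / h k - (G (x + h k) - G x) / h k)) {x..y}" for k
    by (rule has_integral_spike[OF N' _ q_int]) (auto simp: q'_def)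
  have good: "(f has_real_derivative D t) (at t)" "\<bar>D t\<bar> \<le> C" "t \<in> {x<..<y}" if "t \<in> {x..y}" "t \<notin> N'" for t
  proof -
    have "t \<in> space (lebesgue_on {a..b})" using that xy by auto
    moreover have "t \<notin> N" using that by (simp add: N'_def)
    ultimately have "(f has_real_derivative D t) (at t within {a..b})" "\<bar>D t\<bar> \<le> C"
      using N(1) by blast+
    moreover show "t \<in> {x<..<y}" using that by (auto simp: N'_def)
    moreover have "at t within {a..b} = at t"
      using \<open>t \<in> {x<..<y}\<close> xy by (intro at_within_interior) auto
    ultimately show "(f has_real_derivative D t) (at t)" "\<bar>D t\<bar> \<le> C" by auto
  qed
  have conv: "(\<lambda>k. q' k t) \<longlonglongrightarrow> D' t" if "t \<in> {x..y}" for t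
  proof (cases "t \<in> N'")
    case False
    note t = good[OF that False]
    have "(g has_real_derivative D t) (at t)"
      by (rule has_field_derivative_transform_within_open[OF t(1), where S="{x<..<y}"])
        (use t(3) in \<open>auto simp: g_def\<close>)
    then have "(\<lambda>k. q k t) \<longlonglongrightarrow> D t"
      unfolding q_def DERIV_def by (rule filterlim_compose[OF _ h0])
    then show ?thesis using False by (simp add: q'_def D'_def)
  qed (simp add: q'_def D'_def)
  have bd: "norm (q' k t) \<le> C0" for k t
  proof -
    have "\<bar>q k t\<bar> \<le> C0"
      using glip[of "t + h k" t] h[of k] by (simp add: q_def field_simps)
    then show ?thesis using C0 by (simp add: q'_def)
  qed
  note dom = dominated_convergence[of q' "{x..y}" "\<lambda>_. C0" D', OF _ _ bd conv]
  have D'_int: "D' integrable_on {x..y}" and "(\<lambda>k. integral {x..y} (q' k)) \<longlonglongrightarrow> integral {x..y} D'"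
    using dom q'_int by blast+
  then have "(\<lambda>k. (G (y + h k) - G y) / h k - (G (x + h k) - G x) / h k) \<longlonglongrightarrow> integral {x..y} D'"
    using integral_unique[OF q'_int] by simp
  then have "g y - g x = integral {x..y} D'"
    using lim LIMSEQ_unique by blast
  moreover have "norm (integral {x..y} D') \<le> integral {x..y} (\<lambda>_. C)"
    using good C by (intro integral_norm_bound_integral D'_int) (auto simp: D'_def)
  ultimately show ?thesis
    using xy by (simp add: g_def mult.commute)
qed simp

section \<open>Uniform approximation of compactly supported families\<close>

lemma compact_support_uniformly_continuous:
  fixes \<phi> :: "real \<Rightarrow> 'a::euclidean_space \<Rightarrow> 'b::real_normed_vector"
  assumes cont: "continuous_on ({a..b} \<times> UNIV) (\<lambda>(t, x). \<phi> t x)"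
    and supp: "\<And>t x. t \<in> {a..b} \<Longrightarrow> x \<notin> cbox c d \<Longrightarrow> \<phi> t x = 0" and "\<eta> > 0"
  obtains \<delta> where "\<delta> > 0" "\<And>t t' x x'. t \<in> {a..b} \<Longrightarrow> t' \<in> {a..b} \<Longrightarrow> \<bar>t' - t\<bar> < \<delta> \<Longrightarrow> norm (x' - x) < \<delta>
    \<Longrightarrow> norm (\<phi> t' x' - \<phi> t x) \<le> \<eta>"
proof -
  obtain R where R: "\<And>x. x \<in> cbox c d \<Longrightarrow> norm x \<le> R"
    using bounded_cbox[of c d] by (auto simp: bounded_iff)
  let ?K = "{a..b} \<times> cball 0 (R + 1)"
  have "uniformly_continuous_on ?K (\<lambda>(t, x). \<phi> t x)"
    by (intro compact_uniformly_continuous compact_Times continuous_on_subset[OF cont]) auto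
  then obtain \<delta> where \<delta>: "\<delta> > 0" "\<And>p p'. p \<in> ?K \<Longrightarrow> p' \<in> ?K \<Longrightarrow> dist p' p < \<delta> \<Longrightarrow>
      dist ((\<lambda>(t, x). \<phi> t x) p') ((\<lambda>(t, x). \<phi> t x) p) < \<eta>"
    using \<open>\<eta> > 0\<close> unfolding uniformly_continuous_on_def by metis
  show thesis
  proof (rule that)
    \<comment> \<open>Steps shorter than 1 cannot lead from outside the ball of radius R + 1 into
      the ball of radius R that contains the support. So either both points lie in the compact set
      or both values vanish. The half splits the distance in the product between time and
      space.\<close>
    show "min (\<delta> / 2) 1 > 0" using \<delta> by auto
    fix t t' :: real and x x' :: 'a
    assume t: "t \<in> {a..b}" "t' \<in> {a..b}" "\<bar>t' - t\<bar> < min (\<delta> / 2) 1" "norm (x' - x) < min (\<delta> / 2) 1"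
    show "norm (\<phi> t' x' - \<phi> t x) \<le> \<eta>"
    proof (cases "norm x \<le> R + 1 \<and> norm x' \<le> R + 1")
      case True
      have "dist (t', x') (t, x) \<le> \<bar>t' - t\<bar> + norm (x' - x)"
        by (simp add: dist_prod_def dist_norm sqrt_sum_squares_le_sum_abs[of "\<bar>t' - t\<bar>" "norm (x' - x)", simplified])
      also have "\<dots> < \<delta>" using t by auto
      finally show ?thesis
        using \<delta>(2)[of "(t, x)" "(t', x')"] True t by (auto simp: dist_norm)
    next
      case False
      have "\<bar>norm x' - norm x\<bar> < 1" using t(4) norm_triangle_ineq3[of x' x] by auto
      then have "norm x > R" "norm x' > R" using False by auto
      then have "x \<notin> cbox c d" "x' \<notin> cbox c d" using R by force+
      then show ?thesis using supp t \<open>\<eta> > 0\<close> by simp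
    qed
  qed
qed

lemma compact_support_bounded:
  fixes \<phi> :: "real \<Rightarrow> 'a::euclidean_space \<Rightarrow> 'b::real_normed_vector"
  assumes cont: "continuous_on ({a..b} \<times> UNIV) (\<lambda>(t, x). \<phi> t x)"
    and supp: "\<And>t x. t \<in> {a..b} \<Longrightarrow> x \<notin> cbox c d \<Longrightarrow> \<phi> t x = 0"
  obtains B where "B \<ge> 0" "\<And>t x. t \<in> {a..b} \<Longrightarrow> norm (\<phi> t x) \<le> B"
proof -
  have "compact ((\<lambda>(t, x). \<phi> t x) ` ({a..b} \<times> cbox c d))"
    by (intro compact_continuous_image compact_Times continuous_on_subset[OF cont]) auto
  then obtain B where B: "\<And>y. y \<in> (\<lambda>(t, x). \<phi> t x) ` ({a..b} \<times> cbox c d) \<Longrightarrow> norm y \<le> B"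
    using compact_imp_bounded bounded_iff by metis
  show thesis
  proof (rule that[of "max B 0"])
    fix t x assume "t \<in> {a..b}"
    then show "norm (\<phi> t x) \<le> max B 0"
      using B[OF imageI[of "(t, x)"]] supp[of t x] by (cases "x \<in> cbox c d") (auto simp: le_max_iff_disj)
  qed auto
qed

lemma norm_le_of_mem_cube:
  fixes y :: "real^3"
  assumes "y \<in> cbox (- vec e) (vec e)"
  shows "norm y \<le> 3 * e"
proof -
  have "norm y \<le> (\<Sum>i\<in>UNIV. \<bar>y $ i\<bar>)" by (rule norm_le_l1_cart)
  also have "\<dots> \<le> (\<Sum>i\<in>(UNIV::3 set). e)"
    using assms by (intro sum_mono) (auto simp: mem_box_cart abs_le_iff minus_le_iff)
  finally show ?thesis by simp
qed

definition mollifier :: "nat \<Rightarrow> real^3 \<Rightarrow> real" where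
  "mollifier n = (SOME k. k \<in> bump3 (inverse (Suc n)) \<and> (\<forall>x. k x \<ge> 0) \<and>
     integral (cbox (- vec (inverse (Suc n))) (vec (inverse (Suc n)))) k = 1)"

lemma mollifier:
  "mollifier n \<in> bump3 (inverse (Suc n))" "mollifier n x \<ge> 0"
  "integral (cbox (- vec (inverse (Suc n))) (vec (inverse (Suc n)))) (mollifier n) = 1"
proof -
  have "\<exists>k. k \<in> bump3 (inverse (Suc n)) \<and> (\<forall>x. k x \<ge> 0) \<and>
     integral (cbox (- vec (inverse (Suc n))) (vec (inverse (Suc n)))) k = 1"
    using bump3_normalized[of "inverse (Suc n)"] by (metis inverse_positive_iff_positive of_nat_0_less_iff zero_less_Suc)
  from someI_ex[OF this] show "mollifier n \<in> bump3 (inverse (Suc n))" "mollifier n x \<ge> 0"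
  "integral (cbox (- vec (inverse (Suc n))) (vec (inverse (Suc n)))) (mollifier n) = 1"
    unfolding mollifier_def by auto
qed

lemma slice_continuous:
  assumes "continuous_on ({a..b} \<times> UNIV) (\<lambda>(t, x). \<phi> t x)" "t \<in> {a..b}"
  shows "continuous_on UNIV (\<phi> t)"
proof -
  have "continuous_on UNIV (\<lambda>x. case (t, x) of (t, x) \<Rightarrow> \<phi> t x)"
    by (rule continuous_on_compose2[OF assms(1)]) (use assms(2) in \<open>auto intro: continuous_on_Pair\<close>)
  then show ?thesis by simp
qed

lemma convol_mollifier_close:
  fixes \<phi> :: "real \<Rightarrow> real^3 \<Rightarrow> real^3"
  assumes cont: "continuous_on ({a..b} \<times> UNIV) (\<lambda>(t, x). \<phi> t x)"
    and supp: "\<And>t x. t \<in> {a..b} \<Longrightarrow> x \<notin> cbox c d \<Longrightarrow> \<phi> t x = 0" and "\<eta> > 0"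
  obtains \<delta> n0 where "\<delta> > 0" "\<And>t q n x. t \<in> {a..b} \<Longrightarrow> q \<in> {a..b} \<Longrightarrow> \<bar>q - t\<bar> < \<delta> \<Longrightarrow> n \<ge> n0
    \<Longrightarrow> norm (convol (mollifier n) (\<phi> q) x - \<phi> t x) \<le> \<eta>"
proof -
  obtain \<delta> where \<delta>: "\<delta> > 0" "\<And>t t' x x'. t \<in> {a..b} \<Longrightarrow> t' \<in> {a..b} \<Longrightarrow> \<bar>t' - t\<bar> < \<delta> \<Longrightarrow> norm (x' - x) < \<delta>
    \<Longrightarrow> norm (\<phi> t' x' - \<phi> t x) \<le> \<eta>"
    using compact_support_uniformly_continuous[OF cont supp \<open>\<eta> > 0\<close>] by metis
  \<comment> \<open>The third compensates for the cube: half-width e only gives norm at most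
    3e.\<close>
  obtain n0 where n0: "inverse (real (Suc n0)) < \<delta> / 3"
    using reals_Archimedean[of "\<delta> / 3"] \<delta> by auto
  show thesis
  proof (rule that[OF \<delta>(1), of n0])
    fix t q n x assume *: "t \<in> {a..b}" "q \<in> {a..b}" "\<bar>q - t\<bar> < \<delta>" "n \<ge> n0"
    show "norm (convol (mollifier n) (\<phi> q) x - \<phi> t x) \<le> \<eta>"
    proof (rule convol_close[OF mollifier, of "\<phi> q" c d])
      show "continuous_on UNIV (\<phi> q)" using slice_continuous[OF cont] * by auto
      show "\<phi> q y = 0" if "y \<notin> cbox c d" for y using supp * that by auto
      fix y :: "real^3" assume "y \<in> cbox (- vec (inverse (real (Suc n)))) (vec (inverse (real (Suc n))))"
      then have "norm y \<le> 3 * inverse (real (Suc n))" by (rule norm_le_of_mem_cube)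
      also have "\<dots> \<le> 3 * inverse (real (Suc n0))" using * by (simp add: field_simps)
      also have "\<dots> < \<delta>" using n0 by simp
      finally show "norm (\<phi> q (x - y) - \<phi> t x) \<le> \<eta>" using * by (intro \<delta>) auto
    qed
  qed
qed

section \<open>Testing the flow with time-dependent fields\<close>

text \<open>If \<open>W l\<close> is the l-th partial derivative of the curl, this is the quadratic
  form on the right-hand side of the flow equation. Only the three vectors \<open>W l\<close> occur,
  so it also makes sense for limits of curls.\<close>

definition dir_quad :: "(3 \<Rightarrow> real^3) \<Rightarrow> real^3 \<Rightarrow> real" where
  "dir_quad W \<xi> = (\<Sum>l\<in>UNIV. \<xi> $ l * (W l \<bullet> \<xi>))"

lemma dir_quad_bound:
  assumes "norm \<xi> = 1" "\<And>l. norm (W l) \<le> B"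
  shows "\<bar>dir_quad W \<xi>\<bar> \<le> 3 * B"
proof -
  have "\<bar>dir_quad W \<xi>\<bar> \<le> (\<Sum>l\<in>UNIV. \<bar>\<xi> $ l * (W l \<bullet> \<xi>)\<bar>)"
    unfolding dir_quad_def by (rule sum_abs)
  also have "\<dots> \<le> (\<Sum>l\<in>(UNIV::3 set). B)"
  proof (rule sum_mono)
    fix l :: 3
    have "\<bar>\<xi> $ l\<bar> \<le> 1" using component_le_norm_cart[of \<xi> l] assms by simp
    moreover have "\<bar>W l \<bullet> \<xi>\<bar> \<le> B" using Cauchy_Schwarz_ineq2[of "W l" \<xi>] assms(1) assms(2)[of l] by simp
    ultimately have "\<bar>\<xi> $ l\<bar> * \<bar>W l \<bullet> \<xi>\<bar> \<le> 1 * B" by (intro mult_mono) auto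
    then show "\<bar>\<xi> $ l * (W l \<bullet> \<xi>)\<bar> \<le> B" by (simp add: abs_mult)
  qed
  finally show ?thesis by simp
qed

lemma dir_quad_diff: "dir_quad W \<xi> - dir_quad W' \<xi> = dir_quad (\<lambda>l. W l - W' l) \<xi>"
  by (simp add: dir_quad_def sum_subtractf[symmetric] inner_diff_left algebra_simps)

section \<open>Integration against the varifolds of a flow\<close>

locale varifold_flow =
  fixes a b :: real and V :: "real \<Rightarrow> varifold" and m :: real
  assumes flow: "generalized_BCF {a..b} V"
    and vmass: "\<And>t. t \<in> {a..b} \<Longrightarrow> vmass (V t) \<le> m"
begin

lemma varifold: "t \<in> {a..b} \<Longrightarrow> oriented_integral_varifold (V t)"
  using flow by (auto simp: generalized_BCF_def)

lemma sets_V: "t \<in> {a..b} \<Longrightarrow> sets (V t) = sets borel"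
  using varifold by (auto simp: oriented_integral_varifold_def)

lemma finite_V: "t \<in> {a..b} \<Longrightarrow> finite_measure (V t)"
  using varifold by (auto simp: oriented_integral_varifold_def)

lemma m_nonneg: "t \<in> {a..b} \<Longrightarrow> 0 \<le> m"
  using vmass[of t, unfolded vmass_def] measure_nonneg[of "V t" "space (V t)"] by linarith

lemma AE_sphere:
  assumes "t \<in> {a..b}"
  shows "AE p in V t. norm (snd p) = 1"
proof (rule AE_I)
  have "closed (UNIV \<times> sphere 0 1 :: ((real^3) \<times> (real^3)) set)"
    by (intro closed_Times) auto
  then have "- (UNIV \<times> sphere 0 1) \<in> sets (borel :: ((real^3) \<times> (real^3)) measure)"
    by (rule borel_open[OF open_Compl])
  then show "- (UNIV \<times> sphere 0 1) \<in> sets (V t)"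
    using sets_V[OF assms] by simp
  show "emeasure (V t) (- (UNIV \<times> sphere 0 1)) = 0"
    using varifold[OF assms] by (simp add: oriented_integral_varifold_def)
  show "{p \<in> space (V t). norm (snd p) \<noteq> 1} \<subseteq> - (UNIV \<times> sphere 0 1)"
    by auto
qed

text \<open>The integrands are linear or quadratic in \<xi> and thus unbounded on the whole space; a
  bound for unit \<xi> suffices because the measure is concentrated on unit directions.\<close>

lemma integrable_V:
  fixes h :: "(real^3) \<times> (real^3) \<Rightarrow> real"
  assumes t: "t \<in> {a..b}" and h: "h \<in> borel_measurable borel"
    and B: "\<And>x \<xi>. norm \<xi> = 1 \<Longrightarrow> \<bar>h (x, \<xi>)\<bar> \<le> B"
  shows "integrable (V t) h"
proof (rule finite_measure.integrable_const_bound[OF finite_V[OF t]])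
  show "AE p in V t. norm (h p) \<le> B"
    using AE_sphere[OF t] by eventually_elim (metis B prod.collapse real_norm_def)
  show "h \<in> borel_measurable (V t)"
    using h sets_V[OF t] by (simp cong: measurable_cong_sets)
qed

lemma integral_V_bound:
  fixes h :: "(real^3) \<times> (real^3) \<Rightarrow> real"
  assumes t: "t \<in> {a..b}" and h: "h \<in> borel_measurable borel"
    and B: "\<And>x \<xi>. norm \<xi> = 1 \<Longrightarrow> \<bar>h (x, \<xi>)\<bar> \<le> B" and "0 \<le> B"
  shows "\<bar>\<integral>p. h p \<partial>V t\<bar> \<le> B * m"
proof -
  interpret finite_measure "V t" by (rule finite_V[OF t])
  have "\<bar>\<integral>p. h p \<partial>V t\<bar> \<le> (\<integral>p. \<bar>h p\<bar> \<partial>V t)"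
    using integral_norm_bound[of "V t" h] by simp
  also have "\<dots> \<le> (\<integral>p. B \<partial>V t)"
  proof (rule integral_mono_AE)
    show "AE p in V t. \<bar>h p\<bar> \<le> B"
      using AE_sphere[OF t] by eventually_elim (metis B prod.collapse)
    show "integrable (V t) (\<lambda>p. \<bar>h p\<bar>)"
      by (intro integrable_abs integrable_V[OF t h B])
  qed auto
  also have "\<dots> = B * vmass (V t)" by (simp add: vmass_def mult.commute)
  also have "\<dots> \<le> B * m" using vmass[OF t] \<open>0 \<le> B\<close> by (rule mult_left_mono)
  finally show ?thesis .
qed

lemma integral_V_diff_bound:
  fixes h h' :: "(real^3) \<times> (real^3) \<Rightarrow> real"
  assumes t: "t \<in> {a..b}" and h: "h \<in> borel_measurable borel" "h' \<in> borel_measurable borel"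
    and B: "\<And>x \<xi>. norm \<xi> = 1 \<Longrightarrow> \<bar>h (x, \<xi>)\<bar> \<le> B" "\<And>x \<xi>. norm \<xi> = 1 \<Longrightarrow> \<bar>h' (x, \<xi>)\<bar> \<le> B'"
    and \<eta>: "\<And>x \<xi>. norm \<xi> = 1 \<Longrightarrow> \<bar>h (x, \<xi>) - h' (x, \<xi>)\<bar> \<le> \<eta>" and "0 \<le> \<eta>"
  shows "\<bar>(\<integral>p. h p \<partial>V t) - (\<integral>p. h' p \<partial>V t)\<bar> \<le> \<eta> * m"
proof -
  have "(\<integral>p. h p \<partial>V t) - (\<integral>p. h' p \<partial>V t) = (\<integral>p. h p - h' p \<partial>V t)"
    by (intro Bochner_Integration.integral_diff[symmetric] integrable_V[OF t h(1) B(1)] integrable_V[OF t h(2) B(2)])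
  then show ?thesis
    using integral_V_bound[where h="\<lambda>p. h p - h' p" and B=\<eta>, OF t _ _ \<open>0 \<le> \<eta>\<close>] h \<eta> by simp
qed

abbreviation pairing :: "real \<Rightarrow> (real^3 \<Rightarrow> real^3) \<Rightarrow> real" where
  "pairing t Y \<equiv> first_moment (V t) Y"

lemma measurable_pairing:
  fixes Y :: "real^3 \<Rightarrow> real^3"
  assumes "continuous_on UNIV Y"
  shows "(\<lambda>p. Y (fst p) \<bullet> snd p) \<in> borel_measurable borel"
  by (intro borel_measurable_continuous_onI continuous_intros continuous_on_compose2[OF assms]) auto

lemma measurable_dir_quad:
  fixes W :: "3 \<Rightarrow> real^3 \<Rightarrow> real^3"
  assumes "\<And>l. continuous_on UNIV (W l)"
  shows "(\<lambda>p. dir_quad (\<lambda>l. W l (fst p)) (snd p)) \<in> borel_measurable borel"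
  unfolding dir_quad_def
  by (intro borel_measurable_continuous_onI continuous_intros continuous_on_compose2[OF assms]) auto

lemma inner_unit_bound: "norm \<xi> = 1 \<Longrightarrow> norm (y :: real^3) \<le> B \<Longrightarrow> \<bar>y \<bullet> \<xi>\<bar> \<le> B"
  using Cauchy_Schwarz_ineq2[of y \<xi>] by simp

lemma pairing_diff_bound:
  assumes t: "t \<in> {a..b}" and Y: "continuous_on UNIV Y" "continuous_on UNIV Y'"
    and B: "\<And>x. norm (Y x) \<le> B" and \<eta>: "\<And>x. norm (Y x - Y' x) \<le> \<eta>"
  shows "\<bar>pairing t Y - pairing t Y'\<bar> \<le> \<eta> * m"
  unfolding first_moment_def
proof (rule integral_V_diff_bound[OF t measurable_pairing[OF Y(1)] measurable_pairing[OF Y(2)], of B "B + \<eta>"])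
  fix x \<xi> :: "real^3" assume \<xi>: "norm \<xi> = 1"
  show "\<bar>Y (fst (x, \<xi>)) \<bullet> snd (x, \<xi>)\<bar> \<le> B" using inner_unit_bound[OF \<xi> B] by simp
  show "\<bar>Y (fst (x, \<xi>)) \<bullet> snd (x, \<xi>) - Y' (fst (x, \<xi>)) \<bullet> snd (x, \<xi>)\<bar> \<le> \<eta>"
    using inner_unit_bound[OF \<xi> \<eta>[of x]] by (simp add: inner_diff_left)
  have "norm (Y' x) \<le> B + \<eta>"
    using B[of x] \<eta>[of x] norm_triangle_ineq4[of "Y x" "Y x - Y' x"] by simp
  then show "\<bar>Y' (fst (x, \<xi>)) \<bullet> snd (x, \<xi>)\<bar> \<le> B + \<eta>" using inner_unit_bound[OF \<xi>] by simp
qed (use \<eta> norm_ge_zero order_trans in blast)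

lemma pairing_linear:
  assumes t: "t \<in> {a..b}" and Y: "continuous_on UNIV Y" "continuous_on UNIV Y'"
    and B: "\<And>x. norm (Y x) \<le> B" "\<And>x. norm (Y' x) \<le> B'"
  shows "pairing t (\<lambda>x. r *\<^sub>R (Y x - Y' x)) = r * (pairing t Y - pairing t Y')"
proof -
  have "integrable (V t) (\<lambda>p. Y (fst p) \<bullet> snd p)" "integrable (V t) (\<lambda>p. Y' (fst p) \<bullet> snd p)"
    using integrable_V[OF t measurable_pairing[OF Y(1)], of B] integrable_V[OF t measurable_pairing[OF Y(2)], of B']
      inner_unit_bound B by auto
  then show ?thesis
    by (simp add: first_moment_def inner_diff_left)
qed

end

text \<open>\<open>Z\<close> is the curl of \<open>X\<close>; apart from continuity only the derivatives \<open>Xd\<close> and \<open>Zd\<close> along the coordinate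
  axes are recorded, since these are all that \<^const>\<open>Dcurl_xixi\<close> sees.\<close>

locale test_family = varifold_flow +
  fixes c d :: "real^3" and X Xt Z :: "real \<Rightarrow> real^3 \<Rightarrow> real^3" and Xd Zd :: "3 \<Rightarrow> real \<Rightarrow> real^3 \<Rightarrow> real^3"
  assumes X_cont: "continuous_on ({a..b} \<times> UNIV) (\<lambda>(t, x). X t x)"
    and Xt_cont: "continuous_on ({a..b} \<times> UNIV) (\<lambda>(t, x). Xt t x)"
    and Xd_cont: "\<And>l. continuous_on ({a..b} \<times> UNIV) (\<lambda>(t, x). Xd l t x)"
    and Zd_cont: "\<And>l. continuous_on ({a..b} \<times> UNIV) (\<lambda>(t, x). Zd l t x)"
    and X_supp: "\<And>t x. t \<in> {a..b} \<Longrightarrow> x \<notin> cbox c d \<Longrightarrow> X t x = 0"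
    and Xt_supp: "\<And>t x. t \<in> {a..b} \<Longrightarrow> x \<notin> cbox c d \<Longrightarrow> Xt t x = 0"
    and Xd_supp: "\<And>l t x. t \<in> {a..b} \<Longrightarrow> x \<notin> cbox c d \<Longrightarrow> Xd l t x = 0"
    and Zd_supp: "\<And>l t x. t \<in> {a..b} \<Longrightarrow> x \<notin> cbox c d \<Longrightarrow> Zd l t x = 0"
    and X_t: "\<And>t x. t \<in> {a..b} \<Longrightarrow> ((\<lambda>t. X t x) has_vector_derivative Xt t x) (at t within {a..b})"
    and X_d: "\<And>l t x. t \<in> {a..b} \<Longrightarrow> ((\<lambda>h. X t (x + h *\<^sub>R axis l 1)) has_vector_derivative Xd l t x) (at 0)"
    and Z_eq: "\<And>t x. t \<in> {a..b} \<Longrightarrow>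
      Z t x = vector [Xd 2 t x $ 3 - Xd 3 t x $ 2, Xd 3 t x $ 1 - Xd 1 t x $ 3, Xd 1 t x $ 2 - Xd 2 t x $ 1]"
    and Z_d: "\<And>l t x. t \<in> {a..b} \<Longrightarrow> ((\<lambda>h. Z t (x + h *\<^sub>R axis l 1)) has_vector_derivative Zd l t x) (at 0)"
begin

lemma Z_supp: "t \<in> {a..b} \<Longrightarrow> x \<notin> cbox c d \<Longrightarrow> Z t x = 0"
  by (simp add: Z_eq Xd_supp vec_eq_iff forall_3)

lemma Z_slice: "t \<in> {a..b} \<Longrightarrow> continuous_on UNIV (Z t)"
proof -
  assume t: "t \<in> {a..b}"
  have "continuous_on UNIV (\<lambda>x. Z t x $ i)" for i
    using exhaust_3[of i] by (elim disjE)
      (simp_all add: Z_eq[OF t] continuous_on_diff continuous_on_component slice_continuous[OF Xd_cont t])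
  then have "continuous_on UNIV (\<lambda>x. \<chi> i. Z t x $ i)"
    by (rule continuous_on_vec_lambda)
  then show ?thesis by simp
qed

definition smoothed :: "nat \<Rightarrow> real \<Rightarrow> real^3 \<Rightarrow> real^3" where
  "smoothed n q = convol (mollifier n) (X q)"

lemma smoothed_test_field: "q \<in> {a..b} \<Longrightarrow> test_field (smoothed n q)"
  unfolding smoothed_def by (rule convol_test_field[OF mollifier(1) slice_continuous[OF X_cont] X_supp])

lemma smoothed_continuous: "q \<in> {a..b} \<Longrightarrow> continuous_on UNIV (smoothed n q)"
  unfolding smoothed_def by (rule convol_continuous[OF mollifier(1) slice_continuous[OF X_cont] X_supp])

lemma convol_Zd_continuous: "q \<in> {a..b} \<Longrightarrow> continuous_on UNIV (convol (mollifier n) (Zd l q))"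
  by (rule convol_continuous[OF mollifier(1) slice_continuous[OF Zd_cont] Zd_supp])

lemma vec_nth_derivative:
  "(f has_vector_derivative f') F \<Longrightarrow> ((\<lambda>x. f x $ i) has_vector_derivative f' $ i) F"
  by (rule bounded_linear.has_vector_derivative[OF bounded_linear_vec_nth])

lemma pd3_component:
  fixes f :: "real^3 \<Rightarrow> real^3"
  assumes "((\<lambda>h. f (x + h *\<^sub>R axis l 1)) has_vector_derivative f') (at 0)"
  shows "pd3 l (\<lambda>y. f y $ i) x = f' $ i"
  unfolding pd3_def pdv_def using vec_nth_derivative[OF assms] by (simp add: vector_derivative_at)

lemma smoothed_derivative:
  assumes "q \<in> {a..b}"
  shows "((\<lambda>h. smoothed n q (x + h *\<^sub>R axis l 1)) has_vector_derivative convol (mollifier n) (Xd l q) x) (at 0)"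
  unfolding smoothed_def
  by (rule convol_derivative_right[OF slice_continuous[OF X_cont assms] X_supp[OF assms]
        slice_continuous[OF Xd_cont assms] Xd_supp[OF assms] X_d[OF assms] mollifier(1)])

text \<open>Curl and convolution commute, so no derivative of the kernel appears. This is why the
  curl of a mollified slice and its derivatives converge uniformly, although the derivatives of the
  kernels blow up.\<close>

lemma curl_smoothed:
  assumes q: "q \<in> {a..b}"
  shows "curl (smoothed n q) = convol (mollifier n) (Z q)"
proof
  fix x
  let ?k = "mollifier n"
  have int: "(\<lambda>y. ?k (x - y) *\<^sub>R f y) integrable_on cbox c d" if "continuous_on UNIV f" for f :: "real^3 \<Rightarrow> real^3"
    by (intro integrable_continuous continuous_intros
        continuous_on_compose2[OF bump3_continuous[OF mollifier(1), of UNIV]] continuous_on_subset[OF that]) auto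
  have box: "convol ?k (Xd l q) x = integral (cbox c d) (\<lambda>y. ?k (x - y) *\<^sub>R Xd l q y)" for l
    by (rule convol_box) (use q Xd_supp in auto)
  have comp: "convol ?k (Xd l q) x $ i - convol ?k (Xd l' q) x $ i' = convol ?k (Z q) x $ j"
    if "\<And>y. Z q y $ j = Xd l q y $ i - Xd l' q y $ i'" for l l' i i' j
  proof -
    have "convol ?k (Z q) x $ j = integral (cbox c d) (\<lambda>y. (?k (x - y) *\<^sub>R Z q y) $ j)"
      using int[OF Z_slice[OF q]] convol_box[of c d "Z q" ?k x] Z_supp[OF q] by (simp del: vector_scaleR_component)
    also have "\<dots> = integral (cbox c d) (\<lambda>y. (?k (x - y) *\<^sub>R Xd l q y) $ i - (?k (x - y) *\<^sub>R Xd l' q y) $ i')"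
      by (simp add: that right_diff_distrib)
    also have "\<dots> = integral (cbox c d) (\<lambda>y. (?k (x - y) *\<^sub>R Xd l q y) $ i) - integral (cbox c d) (\<lambda>y. (?k (x - y) *\<^sub>R Xd l' q y) $ i')"
      using int[OF slice_continuous[OF Xd_cont q]]
      by (intro integral_diff) (auto intro!: integrable_linear[OF _ bounded_linear_vec_nth, unfolded o_def] simp del: vector_scaleR_component)
    also have "\<dots> = convol ?k (Xd l q) x $ i - convol ?k (Xd l' q) x $ i'"
      using int[OF slice_continuous[OF Xd_cont q]] by (simp add: box del: vector_scaleR_component)
    finally show ?thesis by simp
  qed
  show "curl (smoothed n q) x = convol ?k (Z q) x"
    unfolding curl_def pd3_component[OF smoothed_derivative[OF q]]
    by (simp add: vec_eq_iff forall_3 comp Z_eq[OF q])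
qed

lemma Dcurl_smoothed:
  assumes q: "q \<in> {a..b}"
  shows "Dcurl_xixi (smoothed n q) x \<xi> = dir_quad (\<lambda>l. convol (mollifier n) (Zd l q) x) \<xi>"
proof -
  have "((\<lambda>h. curl (smoothed n q) (x + h *\<^sub>R axis l 1)) has_vector_derivative convol (mollifier n) (Zd l q) x) (at 0)" for l
    unfolding curl_smoothed[OF q]
    by (rule convol_derivative_right[OF Z_slice[OF q] Z_supp[OF q]
        slice_continuous[OF Zd_cont q] Zd_supp[OF q] Z_d[OF q] mollifier(1)])
  then have "pd3 l (\<lambda>y. curl (smoothed n q) y $ k) x = convol (mollifier n) (Zd l q) x $ k" for k l
    by (rule pd3_component)
  then have "Dcurl_xixi (smoothed n q) x \<xi> = (\<Sum>k\<in>UNIV. \<Sum>l\<in>UNIV. convol (mollifier n) (Zd l q) x $ k * \<xi> $ k * \<xi> $ l)"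
    by (simp add: Dcurl_xixi_def)
  also have "\<dots> = (\<Sum>l\<in>UNIV. \<Sum>k\<in>UNIV. convol (mollifier n) (Zd l q) x $ k * \<xi> $ k * \<xi> $ l)"
    by (rule sum.swap)
  also have "\<dots> = dir_quad (\<lambda>l. convol (mollifier n) (Zd l q) x) \<xi>"
    by (simp add: dir_quad_def inner_vec_def sum_distrib_left mult_ac)
  finally show ?thesis .
qed

lemma X_bounded: obtains B where "0 \<le> B" "\<And>t x. t \<in> {a..b} \<Longrightarrow> norm (X t x) \<le> B"
  using compact_support_bounded[OF X_cont X_supp] by metis

lemma Xt_bounded: obtains B where "0 \<le> B" "\<And>t x. t \<in> {a..b} \<Longrightarrow> norm (Xt t x) \<le> B"
  using compact_support_bounded[OF Xt_cont Xt_supp] by metis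

lemma Zd_bounded: obtains B where "0 \<le> B" "\<And>l t x. t \<in> {a..b} \<Longrightarrow> norm (Zd l t x) \<le> B"
proof -
  have "\<exists>B. 0 \<le> B \<and> (\<forall>t x. t \<in> {a..b} \<longrightarrow> norm (Zd l t x) \<le> B)" for l
    using compact_support_bounded[OF Zd_cont[of l] Zd_supp[of _ _ l]] by metis
  then obtain B where B: "\<And>l. 0 \<le> B l" "\<And>l t x. t \<in> {a..b} \<Longrightarrow> norm (Zd l t x) \<le> B l"
    by metis
  show thesis
  proof (rule that[of "B 1 + B 2 + B 3"])
    fix l t x assume "t \<in> {a..b}"
    then show "norm (Zd l t x) \<le> B 1 + B 2 + B 3"
      using B(2)[of t l x] B(1)[of 1] B(1)[of 2] B(1)[of 3] exhaust_3[of l] by auto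
  qed (use B in auto)
qed

lemma convol_Zd_bounded:
  assumes "q \<in> {a..b}" "\<And>l t x. t \<in> {a..b} \<Longrightarrow> norm (Zd l t x) \<le> B"
  shows "norm (convol (mollifier n) (Zd l q) x) \<le> B"
  using convol_close[OF mollifier slice_continuous[OF Zd_cont assms(1)] Zd_supp[OF assms(1)], where w=0] assms by auto

lemma smoothed_close:
  assumes "\<eta> > 0"
  obtains \<delta> n0 where "\<delta> > 0" "\<And>t q n x. t \<in> {a..b} \<Longrightarrow> q \<in> {a..b} \<Longrightarrow> \<bar>q - t\<bar> < \<delta> \<Longrightarrow> n \<ge> n0
    \<Longrightarrow> norm (smoothed n q x - X t x) \<le> \<eta>"
  unfolding smoothed_def using convol_mollifier_close[OF X_cont X_supp assms] by metis

lemma Zd_close: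
  assumes "\<eta> > 0"
  obtains \<delta> n0 where "\<delta> > 0" "\<And>l t q n x. t \<in> {a..b} \<Longrightarrow> q \<in> {a..b} \<Longrightarrow> \<bar>q - t\<bar> < \<delta> \<Longrightarrow> n \<ge> n0
    \<Longrightarrow> norm (convol (mollifier n) (Zd l q) x - Zd l t x) \<le> \<eta>"
proof -
  have "\<exists>\<delta> n0. \<delta> > 0 \<and> (\<forall>t q n x. t \<in> {a..b} \<longrightarrow> q \<in> {a..b} \<longrightarrow> \<bar>q - t\<bar> < \<delta> \<longrightarrow> n \<ge> n0
    \<longrightarrow> norm (convol (mollifier n) (Zd l q) x - Zd l t x) \<le> \<eta>)" for l
    using convol_mollifier_close[OF Zd_cont[of l] Zd_supp[of _ _ l] assms] by metis
  then obtain \<delta> n0 where *: "\<And>l. \<delta> l > 0" "\<And>l t q n x. t \<in> {a..b} \<Longrightarrow> q \<in> {a..b} \<Longrightarrow> \<bar>q - t\<bar> < \<delta> l \<Longrightarrow> n \<ge> n0 l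
    \<Longrightarrow> norm (convol (mollifier n) (Zd l q) x - Zd l t x) \<le> \<eta>"
    by metis
  show thesis
  proof (rule that[of "Min (range \<delta>)" "Max (range n0)"])
    show "0 < Min (range \<delta>)" using *(1) by (subst Min_gr_iff) auto
    fix l t q n x assume **: "t \<in> {a..b}" "q \<in> {a..b}" "\<bar>q - t\<bar> < Min (range \<delta>)" "n \<ge> Max (range n0)"
    have "Min (range \<delta>) \<le> \<delta> l" "n0 l \<le> Max (range n0)" by auto
    then show "norm (convol (mollifier n) (Zd l q) x - Zd l t x) \<le> \<eta>" using ** by (intro *(2)) auto
  qed
qed

lemma smoothed_flow:
  assumes "q \<in> {a..b}"
  shows "\<exists>C. C-lipschitz_on {a..b} (\<lambda>t. pairing t (smoothed n q))"
    "AE t in lebesgue_on {a..b}. ((\<lambda>\<tau>. pairing \<tau> (smoothed n q)) has_real_derivative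
       - (\<integral>p. dir_quad (\<lambda>l. convol (mollifier n) (Zd l q) (fst p)) (snd p) \<partial>V t)) (at t within {a..b})"
proof -
  have "(\<exists>C. C-lipschitz_on {a..b} (\<lambda>t. pairing t (smoothed n q))) \<and>
    (AE t in lebesgue_on {a..b}. ((\<lambda>\<tau>. pairing \<tau> (smoothed n q)) has_real_derivative
       - (\<integral>p. Dcurl_xixi (smoothed n q) (fst p) (snd p) \<partial>V t)) (at t within {a..b}))"
    using flow smoothed_test_field[OF assms] unfolding generalized_BCF_def by blast
  then show "\<exists>C. C-lipschitz_on {a..b} (\<lambda>t. pairing t (smoothed n q))"
    "AE t in lebesgue_on {a..b}. ((\<lambda>\<tau>. pairing \<tau> (smoothed n q)) has_real_derivative
       - (\<integral>p. dir_quad (\<lambda>l. convol (mollifier n) (Zd l q) (fst p)) (snd p) \<partial>V t)) (at t within {a..b})"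
    by (simp_all only: Dcurl_smoothed[OF assms])
qed

lemma dir_quad_integral_diff_bound:
  fixes W W' :: "3 \<Rightarrow> real^3 \<Rightarrow> real^3"
  assumes t: "t \<in> {a..b}" and W: "\<And>l. continuous_on UNIV (W l)" "\<And>l. continuous_on UNIV (W' l)"
    and B: "\<And>l x. norm (W l x) \<le> B" "\<And>l x. norm (W' l x) \<le> B" and \<eta>: "\<And>l x. norm (W l x - W' l x) \<le> \<eta>" "0 \<le> \<eta>"
  shows "\<bar>(\<integral>p. dir_quad (\<lambda>l. W l (fst p)) (snd p) \<partial>V t) - (\<integral>p. dir_quad (\<lambda>l. W' l (fst p)) (snd p) \<partial>V t)\<bar> \<le> 3 * \<eta> * m"
  by (rule integral_V_diff_bound[OF t measurable_dir_quad[OF W(1)] measurable_dir_quad[OF W(2)], where B="3 * B" and B'="3 * B"])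
    (use dir_quad_bound B \<eta> in \<open>auto simp: dir_quad_diff\<close>)

text \<open>Both fields satisfy the flow equation a.e., so the difference of their pairings has a.e.
  derivative at most 3 \<eta> m. Being Lipschitz, it obeys the same bound for increments between
  arbitrary times. This turns closeness of fields into closeness of difference quotients.\<close>

lemma smoothed_diff_increment:
  assumes q: "q \<in> {a..b}" "q' \<in> {a..b}" and st: "s \<in> {a..b}" "t \<in> {a..b}"
    and \<eta>: "\<And>l x. norm (convol (mollifier n) (Zd l q) x - convol (mollifier n') (Zd l q') x) \<le> \<eta>" "0 \<le> \<eta>"
  shows "\<bar>(pairing s (smoothed n q) - pairing s (smoothed n' q')) - (pairing t (smoothed n q) - pairing t (smoothed n' q'))\<bar> \<le> 3 * \<eta> * m * \<bar>s - t\<bar>"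
proof -
  obtain B where B: "0 \<le> B" "\<And>l t x. t \<in> {a..b} \<Longrightarrow> norm (Zd l t x) \<le> B" using Zd_bounded by metis
  define f where "f = (\<lambda>\<tau>. pairing \<tau> (smoothed n q) - pairing \<tau> (smoothed n' q'))"
  define D where "D = (\<lambda>\<tau>. - (\<integral>p. dir_quad (\<lambda>l. convol (mollifier n) (Zd l q) (fst p)) (snd p) \<partial>V \<tau>)
       - - (\<integral>p. dir_quad (\<lambda>l. convol (mollifier n') (Zd l q') (fst p)) (snd p) \<partial>V \<tau>))"
  obtain C C' where "C-lipschitz_on {a..b} (\<lambda>t. pairing t (smoothed n q))" "C'-lipschitz_on {a..b} (\<lambda>t. pairing t (smoothed n' q'))"
    using smoothed_flow(1) q by metis
  then have lip: "(C + C')-lipschitz_on {a..b} f"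
    unfolding f_def by (rule lipschitz_on_diff)
  have "AE t in lebesgue_on {a..b}. t \<in> {a..b}" by (rule AE_I2) auto
  then have AE: "AE t in lebesgue_on {a..b}. (f has_real_derivative D t) (at t within {a..b}) \<and> \<bar>D t\<bar> \<le> 3 * \<eta> * m"
    using smoothed_flow(2)[OF q(1), of n] smoothed_flow(2)[OF q(2), of n']
  proof eventually_elim
    case (elim t)
    have "(f has_real_derivative D t) (at t within {a..b})"
      unfolding f_def D_def by (rule DERIV_diff[OF elim(2,3)])
    moreover have "\<bar>- D t\<bar> \<le> 3 * \<eta> * m"
      unfolding D_def
      using dir_quad_integral_diff_bound[OF elim(1) convol_Zd_continuous[OF q(1)] convol_Zd_continuous[OF q(2)]
          convol_Zd_bounded[OF q(1) B(2)] convol_Zd_bounded[OF q(2) B(2)] \<eta>] by simp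
    ultimately show ?case by simp
  qed
  have 0: "0 \<le> 3 * \<eta> * m" using \<eta>(2) m_nonneg[OF st(1)] by simp
  have "\<bar>f s - f t\<bar> \<le> 3 * \<eta> * m * \<bar>s - t\<bar>"
  proof (cases "s \<le> t")
    case True
    then show ?thesis
      using lipschitz_bound_of_AE_derivative[OF lip AE 0, of s t] st by (simp add: abs_minus_commute)
  next
    case False
    then show ?thesis
      using lipschitz_bound_of_AE_derivative[OF lip AE 0, of t s] st by simp
  qed
  then show ?thesis by (simp add: f_def)
qed

lemma pairing_smoothed_limit:
  assumes "q \<in> {a..b}" "s \<in> {a..b}"
  shows "(\<lambda>n. pairing s (smoothed n q)) \<longlonglongrightarrow> pairing s (X q)"
proof -
  obtain B where B: "\<And>t x. t \<in> {a..b} \<Longrightarrow> norm (X t x) \<le> B" using X_bounded by metis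
  have m: "0 \<le> m" using m_nonneg assms by blast
  show ?thesis
    unfolding LIMSEQ_def
  proof (intro allI impI)
    fix r :: real assume "r > 0"
    define \<eta> where "\<eta> = r / (m + 1)"
    have \<eta>: "\<eta> > 0" using \<open>r > 0\<close> m by (simp add: \<eta>_def)
    obtain \<delta> n0 where *: "\<delta> > 0" "\<And>t q n x. t \<in> {a..b} \<Longrightarrow> q \<in> {a..b} \<Longrightarrow> \<bar>q - t\<bar> < \<delta> \<Longrightarrow> n \<ge> n0
    \<Longrightarrow> norm (smoothed n q x - X t x) \<le> \<eta>" using smoothed_close[OF \<eta>] by metis
    have "dist (pairing s (smoothed n q)) (pairing s (X q)) < r" if "n \<ge> n0" for n
    proof -
      have "\<bar>pairing s (X q) - pairing s (smoothed n q)\<bar> \<le> \<eta> * m"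
        using * assms that B
        by (intro pairing_diff_bound[where B=B] smoothed_continuous slice_continuous[OF X_cont]) (auto simp: norm_minus_commute)
      also have "\<dots> < r" using \<open>r > 0\<close> m by (simp add: \<eta>_def field_simps)
      finally show ?thesis by (simp add: dist_real_def abs_minus_commute)
    qed
    then show "\<exists>n0. \<forall>n\<ge>n0. dist (pairing s (smoothed n q)) (pairing s (X q)) < r" by blast
  qed
qed

text \<open>The slice \<open>X t0\<close> is not an admissible test field. It is reached as the
  limit of its own mollifications, and since the increment bound is uniform in the mollification
  index, it passes to the limit.\<close>

lemma X_smoothed_increment:
  assumes q: "q \<in> {a..b}" "t0 \<in> {a..b}" and st: "s \<in> {a..b}" "t \<in> {a..b}"
    and \<eta>: "\<And>l x. norm (convol (mollifier n) (Zd l q) x - Zd l t0 x) \<le> \<eta>" "0 < \<eta>"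
  shows "\<bar>(pairing s (X t0) - pairing t (X t0)) - (pairing s (smoothed n q) - pairing t (smoothed n q))\<bar> \<le> 6 * \<eta> * m * \<bar>s - t\<bar>"
proof (rule LIMSEQ_le_const2)
  show "(\<lambda>k. \<bar>(pairing s (smoothed k t0) - pairing t (smoothed k t0)) - (pairing s (smoothed n q) - pairing t (smoothed n q))\<bar>)
    \<longlonglongrightarrow> \<bar>(pairing s (X t0) - pairing t (X t0)) - (pairing s (smoothed n q) - pairing t (smoothed n q))\<bar>"
    using q st by (intro tendsto_intros pairing_smoothed_limit)
  obtain \<delta> n0 where *: "\<delta> > 0" "\<And>l t q n x. t \<in> {a..b} \<Longrightarrow> q \<in> {a..b} \<Longrightarrow> \<bar>q - t\<bar> < \<delta> \<Longrightarrow> n \<ge> n0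
    \<Longrightarrow> norm (convol (mollifier n) (Zd l q) x - Zd l t x) \<le> \<eta>" using Zd_close[OF \<eta>(2)] by metis
  have "\<bar>(pairing s (smoothed k t0) - pairing t (smoothed k t0)) - (pairing s (smoothed n q) - pairing t (smoothed n q))\<bar> \<le> 6 * \<eta> * m * \<bar>s - t\<bar>"
    if "k \<ge> n0" for k
  proof -
    \<comment> \<open>Both mollified derivatives are within \<eta> of \<open>Zd l t0\<close>, which
      doubles the constant 3 to 6.\<close>
    have "norm (convol (mollifier k) (Zd l t0) x - convol (mollifier n) (Zd l q) x) \<le> 2 * \<eta>" for l x
    proof -
      have "norm (convol (mollifier k) (Zd l t0) x - Zd l t0 x) \<le> \<eta>"
        using * q that by auto
      then show ?thesis
        using \<eta>(1)[of l x] norm_triangle_ineq4[of "convol (mollifier k) (Zd l t0) x - Zd l t0 x" "convol (mollifier n) (Zd l q) x - Zd l t0 x"]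
        by simp
    qed
    from smoothed_diff_increment[OF q(2,1) st this] \<eta>(2) show ?thesis
      by (simp add: algebra_simps)
  qed
  then show "\<exists>N. \<forall>k\<ge>N. \<bar>(pairing s (smoothed k t0) - pairing t (smoothed k t0)) - (pairing s (smoothed n q) - pairing t (smoothed n q))\<bar> \<le> 6 * \<eta> * m * \<bar>s - t\<bar>"
    by blast
qed

lemma X_increment:
  assumes B: "\<And>l t x. t \<in> {a..b} \<Longrightarrow> norm (Zd l t x) \<le> B"
    and q: "q \<in> {a..b}" and st: "s \<in> {a..b}" "t \<in> {a..b}"
  shows "\<bar>pairing s (X q) - pairing t (X q)\<bar> \<le> 3 * B * m * \<bar>s - t\<bar>"
proof (rule LIMSEQ_le_const2)
  show "(\<lambda>k. \<bar>pairing s (smoothed k q) - pairing t (smoothed k q)\<bar>) \<longlonglongrightarrow> \<bar>pairing s (X q) - pairing t (X q)\<bar>"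
    using q st by (intro tendsto_intros pairing_smoothed_limit)
  have B0: "0 \<le> B" using B[OF q] norm_ge_zero order_trans by blast
  define D where "D = (\<lambda>n \<tau>. - (\<integral>p. dir_quad (\<lambda>l. convol (mollifier n) (Zd l q) (fst p)) (snd p) \<partial>V \<tau>))"
  have "\<bar>pairing s (smoothed n q) - pairing t (smoothed n q)\<bar> \<le> 3 * B * m * \<bar>s - t\<bar>" for n
  proof -
    obtain C where lip: "C-lipschitz_on {a..b} (\<lambda>t. pairing t (smoothed n q))"
      using smoothed_flow(1) q by metis
    have "AE t in lebesgue_on {a..b}. t \<in> {a..b}" by (rule AE_I2) auto
    then have AE: "AE t in lebesgue_on {a..b}. ((\<lambda>t. pairing t (smoothed n q)) has_real_derivative D n t) (at t within {a..b}) \<and> \<bar>D n t\<bar> \<le> 3 * B * m"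
      using smoothed_flow(2)[OF q(1), of n]
    proof eventually_elim
      case (elim t)
      have "\<bar>\<integral>p. dir_quad (\<lambda>l. convol (mollifier n) (Zd l q) (fst p)) (snd p) \<partial>V t\<bar> \<le> 3 * B * m"
        using convol_Zd_bounded[OF q B] B0
        by (intro integral_V_bound[OF elim(1)] measurable_dir_quad convol_Zd_continuous[OF q] dir_quad_bound) auto
      then show ?case using elim(2) by (simp add: D_def)
    qed
    have 0: "0 \<le> 3 * B * m" using B0 m_nonneg[OF st(1)] by simp
    show ?thesis
    proof (cases "s \<le> t")
      case True
      then show ?thesis
        using lipschitz_bound_of_AE_derivative[OF lip AE 0, of s t] st by (simp add: abs_minus_commute)
    next
      case False
      then show ?thesis
        using lipschitz_bound_of_AE_derivative[OF lip AE 0, of t s] st by simp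
    qed
  qed
  then show "\<exists>N. \<forall>n\<ge>N. \<bar>pairing s (smoothed n q) - pairing t (smoothed n q)\<bar> \<le> 3 * B * m * \<bar>s - t\<bar>" by blast
qed

text \<open>An increment is split at the mixed term with the measure at \<open>s\<close> and the
  field at \<open>t\<close>: changing the field costs the bound of \<open>Xt\<close>, changing the
  measure costs the bound of \<open>Zd\<close>.\<close>

lemma pairing_X_lipschitz: "\<exists>C. C-lipschitz_on {a..b} (\<lambda>t. pairing t (X t))"
proof (cases "a \<le> b")
  case True
  obtain B where B: "0 \<le> B" "\<And>l t x. t \<in> {a..b} \<Longrightarrow> norm (Zd l t x) \<le> B" using Zd_bounded by metis
  obtain B' where B': "0 \<le> B'" "\<And>t x. t \<in> {a..b} \<Longrightarrow> norm (Xt t x) \<le> B'" using Xt_bounded by metis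
  obtain B'' where B'': "\<And>t x. t \<in> {a..b} \<Longrightarrow> norm (X t x) \<le> B''" using X_bounded by metis
  have m: "0 \<le> m" using m_nonneg[of a] True by auto
  have "dist (pairing s (X s)) (pairing t (X t)) \<le> (B' * m + 3 * B * m) * dist s t" if st: "s \<in> {a..b}" "t \<in> {a..b}" for s t
  proof -
    have "norm (X s x - X t x) \<le> B' * \<bar>s - t\<bar>" for x
      using differentiable_bound[of "{a..b}" "\<lambda>t. X t x" "\<lambda>t h. h *\<^sub>R Xt t x" B' s t] X_t st B'
      by (auto simp: has_vector_derivative_def onorm_scaleR_left mult.commute onorm_id intro!: onorm_le)
    then have "\<bar>pairing s (X s) - pairing s (X t)\<bar> \<le> B' * \<bar>s - t\<bar> * m"
      using st B'' by (intro pairing_diff_bound[where B=B''] slice_continuous[OF X_cont]) auto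
    moreover have "\<bar>pairing s (X t) - pairing t (X t)\<bar> \<le> 3 * B * m * \<bar>s - t\<bar>"
      by (rule X_increment[OF B(2) st(2) st])
    ultimately show ?thesis by (simp add: dist_real_def algebra_simps)
  qed
  moreover have "0 \<le> B' * m + 3 * B * m" using B B' m by simp
  ultimately show ?thesis unfolding lipschitz_on_def by blast
qed (auto intro!: exI[of _ 0] simp: lipschitz_on_def)

text \<open>\<open>Xt t\<close> is merely continuous, so its pairing need not be Lipschitz in time.
  Continuity still follows, because it is a uniform limit of test fields and all masses are at most
  \<open>m\<close>.\<close>

lemma pairing_Xt_limit:
  assumes t: "t \<in> {a..b}"
  shows "((\<lambda>\<tau>. pairing \<tau> (Xt t)) \<longlongrightarrow> pairing t (Xt t)) (at t within {a..b})"
proof -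
  obtain B where B: "\<And>t x. t \<in> {a..b} \<Longrightarrow> norm (Xt t x) \<le> B" using Xt_bounded by metis
  have m: "0 \<le> m" using m_nonneg t by blast
  show ?thesis
  proof (rule tendstoI)
    fix r :: real assume "r > 0"
    define \<eta> where "\<eta> = r / (3 * (m + 1))"
    have \<eta>: "\<eta> > 0" using \<open>r > 0\<close> m by (simp add: \<eta>_def)
    have \<eta>m: "\<eta> * m < r / 3" using \<open>r > 0\<close> m by (simp add: \<eta>_def field_simps)
    obtain \<delta> n where "\<delta> > 0" "\<And>t q k x. t \<in> {a..b} \<Longrightarrow> q \<in> {a..b} \<Longrightarrow> \<bar>q - t\<bar> < \<delta> \<Longrightarrow> k \<ge> n
      \<Longrightarrow> norm (convol (mollifier k) (Xt q) x - Xt t x) \<le> \<eta>"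
      using convol_mollifier_close[OF Xt_cont Xt_supp \<eta>] by metis
    then have close: "norm (Xt t x - convol (mollifier n) (Xt t) x) \<le> \<eta>" for x
      using t by (auto simp: norm_minus_commute)
    let ?Y = "convol (mollifier n) (Xt t)"
    have "test_field ?Y" by (rule convol_test_field[OF mollifier(1) slice_continuous[OF Xt_cont t] Xt_supp[OF t]])
    then obtain C where "C-lipschitz_on {a..b} (\<lambda>\<tau>. pairing \<tau> ?Y)"
      using flow unfolding generalized_BCF_def by blast
    then have "((\<lambda>\<tau>. pairing \<tau> ?Y) \<longlongrightarrow> pairing t ?Y) (at t within {a..b})"
      using lipschitz_on_continuous_on t by (metis continuous_on)
    then have "\<forall>\<^sub>F \<tau> in at t within {a..b}. dist (pairing \<tau> ?Y) (pairing t ?Y) < r / 3"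
      by (rule tendstoD) (use \<open>r > 0\<close> in auto)
    moreover have "\<forall>\<^sub>F \<tau> in at t within {a..b}. \<tau> \<in> {a..b}"
      by (auto simp: eventually_at_filter)
    ultimately show "\<forall>\<^sub>F \<tau> in at t within {a..b}. dist (pairing \<tau> (Xt t)) (pairing t (Xt t)) < r"
    proof eventually_elim
      case (elim \<tau>)
      have "\<bar>pairing s (Xt t) - pairing s ?Y\<bar> \<le> \<eta> * m" if "s \<in> {a..b}" for s
        by (rule pairing_diff_bound[OF that slice_continuous[OF Xt_cont t]
            convol_continuous[OF mollifier(1) slice_continuous[OF Xt_cont t] Xt_supp[OF t]] B[OF t] close])
      from this[OF elim(2)] this[OF t] elim(1) \<eta>m show ?case
        unfolding dist_real_def abs_le_iff abs_less_iff by linarith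
    qed
  qed
qed

text \<open>The measure is taken at the moving time \<tau>, so convergence of the field quotient at
  single points would not be enough. The mean value inequality gives uniform convergence to
  \<open>Xt t\<close>, and the common mass bound then handles the moving measure.\<close>

lemma moving_part_derivative:
  assumes t: "t \<in> {a..b}"
  shows "((\<lambda>\<tau>. (pairing \<tau> (X \<tau>) - pairing \<tau> (X t)) / (\<tau> - t)) \<longlongrightarrow> pairing t (Xt t)) (at t within {a..b})"
proof -
  obtain B where B: "\<And>t x. t \<in> {a..b} \<Longrightarrow> norm (Xt t x) \<le> B" using Xt_bounded by metis
  obtain B' where B': "\<And>t x. t \<in> {a..b} \<Longrightarrow> norm (X t x) \<le> B'" using X_bounded by metis
  have m: "0 \<le> m" using m_nonneg t by blast
  have "((\<lambda>\<tau>. (pairing \<tau> (X \<tau>) - pairing \<tau> (X t)) / (\<tau> - t) - pairing \<tau> (Xt t)) \<longlongrightarrow> 0) (at t within {a..b})"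
  proof (rule tendstoI)
    fix r :: real assume "r > 0"
    define \<eta> where "\<eta> = r / (m + 1)"
    have \<eta>: "\<eta> > 0" using \<open>r > 0\<close> m by (simp add: \<eta>_def)
    have \<eta>m: "\<eta> * m < r" using \<open>r > 0\<close> m by (simp add: \<eta>_def field_simps)
    obtain \<delta> where \<delta>: "\<delta> > 0" "\<And>t t' x x'. t \<in> {a..b} \<Longrightarrow> t' \<in> {a..b} \<Longrightarrow> \<bar>t' - t\<bar> < \<delta> \<Longrightarrow> norm (x' - x) < \<delta>
      \<Longrightarrow> norm (Xt t' x' - Xt t x) \<le> \<eta>"
      using compact_support_uniformly_continuous[OF Xt_cont Xt_supp \<eta>] by metis
    have "\<forall>\<^sub>F \<tau> in at t within {a..b}. \<tau> \<in> {a..b} \<and> \<tau> \<noteq> t \<and> \<bar>\<tau> - t\<bar> < \<delta>"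
      using \<delta>(1) by (auto simp: eventually_at dist_real_def)
    then show "\<forall>\<^sub>F \<tau> in at t within {a..b}. dist ((pairing \<tau> (X \<tau>) - pairing \<tau> (X t)) / (\<tau> - t) - pairing \<tau> (Xt t)) 0 < r"
    proof eventually_elim
      case (elim \<tau>)
      define Y where "Y = (\<lambda>x. (1 / (\<tau> - t)) *\<^sub>R (X \<tau> x - X t x))"
      have Yp: "pairing \<tau> Y = (1 / (\<tau> - t)) * (pairing \<tau> (X \<tau>) - pairing \<tau> (X t))"
        unfolding Y_def using elim t B' by (intro pairing_linear[where B=B' and B'=B'] slice_continuous[OF X_cont]) auto
      have Yc: "continuous_on UNIV Y"
        unfolding Y_def using elim t by (intro continuous_intros slice_continuous[OF X_cont]) auto
      have "norm (Xt t x - Y x) \<le> \<eta>" for x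
      proof -
        have "norm (X \<tau> x - X t x - (\<tau> - t) *\<^sub>R Xt t x) \<le> norm (\<tau> - t) * \<eta>"
        proof (rule vector_differentiable_bound_linearization[where S="closed_segment t \<tau>"])
          fix s assume s: "s \<in> closed_segment t \<tau>"
          have "closed_segment t \<tau> \<subseteq> {a..b}" using elim t by (auto simp: closed_segment_eq_real_ivl)
          then show "((\<lambda>\<tau>. X \<tau> x) has_vector_derivative Xt s x) (at s within closed_segment t \<tau>)"
            using X_t s has_vector_derivative_within_subset by blast
          show "norm (Xt s x - Xt t x) \<le> \<eta>"
            using s elim \<open>closed_segment t \<tau> \<subseteq> {a..b}\<close> t \<delta>(1)
            by (intro \<delta>(2)) (auto simp: closed_segment_eq_real_ivl split: if_splits)
        qed auto
        moreover have "Xt t x - Y x = - (1 / (\<tau> - t)) *\<^sub>R (X \<tau> x - X t x - (\<tau> - t) *\<^sub>R Xt t x)"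
          using elim by (simp add: Y_def scaleR_diff_right)
        ultimately show ?thesis
          using elim by (simp only: norm_scaleR) (simp add: pos_divide_le_eq mult.commute)
      qed
      then have "\<bar>pairing \<tau> (Xt t) - pairing \<tau> Y\<bar> \<le> \<eta> * m"
        using elim t B by (intro pairing_diff_bound[where B=B] slice_continuous[OF Xt_cont] Yc) auto
      then show ?case using \<eta>m by (simp add: Yp abs_minus_commute)
    qed
  qed
  from tendsto_add[OF this pairing_Xt_limit[OF t]] show ?thesis by simp
qed

text \<open>At a good time \<open>t\<close> derivatives are known only for mollified slices at
  rational times. One such slice close to \<open>X t\<close> is fixed: its quotients differ from
  those of \<open>X t\<close> by at most 6 \<eta> m for every \<tau>, and its derivative from the
  claimed limit by at most 3 \<eta> m.\<close>

lemma frozen_part_derivative: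
  assumes t: "t \<in> {a..b}" and ab: "a < b"
    and E': "\<And>q n. q \<in> \<rat> \<inter> {a..b} \<Longrightarrow> ((\<lambda>\<tau>. pairing \<tau> (smoothed n q)) has_real_derivative
       - (\<integral>p. dir_quad (\<lambda>l. convol (mollifier n) (Zd l q) (fst p)) (snd p) \<partial>V t)) (at t within {a..b})"
  shows "((\<lambda>\<tau>. (pairing \<tau> (X t) - pairing t (X t)) / (\<tau> - t)) \<longlongrightarrow>
      - (\<integral>p. dir_quad (\<lambda>l. Zd l t (fst p)) (snd p) \<partial>V t)) (at t within {a..b})"
proof (rule tendstoI)
  fix r :: real assume "r > 0"
  have m: "0 \<le> m" using m_nonneg t by blast
  obtain B where B: "0 \<le> B" "\<And>l t x. t \<in> {a..b} \<Longrightarrow> norm (Zd l t x) \<le> B" using Zd_bounded by metis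
  \<comment> \<open>The two errors add up to 9 \<eta> m, and 9/20 is below the remaining half of
    \<open>r\<close>. The summand 1 covers \<open>m = 0\<close>.\<close>
  define \<eta> where "\<eta> = r / (20 * (m + 1))"
  have \<eta>: "\<eta> > 0" using \<open>r > 0\<close> m by (simp add: \<eta>_def)
  have \<eta>m: "9 * \<eta> * m < r / 2" using \<open>r > 0\<close> m by (simp add: \<eta>_def field_simps add_nonneg_pos)
  obtain \<delta> n where *: "\<delta> > 0" "\<And>l t q k x. t \<in> {a..b} \<Longrightarrow> q \<in> {a..b} \<Longrightarrow> \<bar>q - t\<bar> < \<delta> \<Longrightarrow> k \<ge> n
    \<Longrightarrow> norm (convol (mollifier k) (Zd l q) x - Zd l t x) \<le> \<eta>" using Zd_close[OF \<eta>] by metis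
  \<comment> \<open>The rational time must lie in \<open>{a..b}\<close> as well, which needs a
    nondegenerate interval when \<open>t\<close> is an end point.\<close>
  have "max a (t - \<delta>) < min b (t + \<delta>)" using t ab *(1) by auto
  then obtain q where q: "q \<in> \<rat>" "max a (t - \<delta>) < q" "q < min b (t + \<delta>)"
    using Rats_dense_in_real by blast
  then have qJ: "q \<in> {a..b}" and close: "\<And>l x. norm (convol (mollifier n) (Zd l q) x - Zd l t x) \<le> \<eta>"
    using *(2)[OF t, of q n] by auto
  let ?D = "\<integral>p. dir_quad (\<lambda>l. convol (mollifier n) (Zd l q) (fst p)) (snd p) \<partial>V t"
  let ?D' = "\<integral>p. dir_quad (\<lambda>l. Zd l t (fst p)) (snd p) \<partial>V t"
  have DD: "\<bar>?D - ?D'\<bar> \<le> 3 * \<eta> * m"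
    by (rule dir_quad_integral_diff_bound[OF t convol_Zd_continuous[OF qJ] slice_continuous[OF Zd_cont t]
      convol_Zd_bounded[OF qJ B(2)] B(2)[OF t] close]) (use \<eta> in auto)
  have "((\<lambda>\<tau>. (pairing \<tau> (smoothed n q) - pairing t (smoothed n q)) / (\<tau> - t)) \<longlongrightarrow> - ?D) (at t within {a..b})"
    using E'[of q n] q qJ by (auto simp: has_field_derivative_iff)
  then have "\<forall>\<^sub>F \<tau> in at t within {a..b}. dist ((pairing \<tau> (smoothed n q) - pairing t (smoothed n q)) / (\<tau> - t)) (- ?D) < r / 2"
    by (rule tendstoD) (use \<open>r > 0\<close> in auto)
  moreover have "\<forall>\<^sub>F \<tau> in at t within {a..b}. \<tau> \<in> {a..b} \<and> \<tau> \<noteq> t"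
    by (auto simp: eventually_at_filter)
  ultimately show "\<forall>\<^sub>F \<tau> in at t within {a..b}. dist ((pairing \<tau> (X t) - pairing t (X t)) / (\<tau> - t)) (- ?D') < r"
  proof eventually_elim
    case (elim \<tau>)
    let ?u = "pairing \<tau> (X t) - pairing t (X t)" and ?v = "pairing \<tau> (smoothed n q) - pairing t (smoothed n q)"
    have "\<bar>?u - ?v\<bar> \<le> 6 * \<eta> * m * \<bar>\<tau> - t\<bar>"
      using elim by (intro X_smoothed_increment[OF qJ t _ t close \<eta>]) auto
    then have "\<bar>?u / (\<tau> - t) - ?v / (\<tau> - t)\<bar> \<le> 6 * \<eta> * m"
      using elim by (simp add: diff_divide_distrib[symmetric] abs_divide pos_divide_le_eq)
    then show ?case using elim(1) DD \<eta>m
      unfolding dist_real_def abs_le_iff abs_less_iff by linarith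
  qed
qed

lemma pairing_X_derivative:
  assumes "a < b"
  shows "AE t in lebesgue_on {a..b}. t \<in> {a..b} \<and> ((\<lambda>\<tau>. pairing \<tau> (X \<tau>)) has_real_derivative
    pairing t (Xt t) - (\<integral>p. dir_quad (\<lambda>l. Zd l t (fst p)) (snd p) \<partial>V t)) (at t within {a..b})"
proof -
  have "countable (\<rat> \<inter> {a..b})" by (intro countable_Int1 countable_rat)
  then have "AE t in lebesgue_on {a..b}. \<forall>q\<in>\<rat> \<inter> {a..b}. \<forall>n. ((\<lambda>\<tau>. pairing \<tau> (smoothed n q)) has_real_derivative
       - (\<integral>p. dir_quad (\<lambda>l. convol (mollifier n) (Zd l q) (fst p)) (snd p) \<partial>V t)) (at t within {a..b})"
    using smoothed_flow(2) by (auto simp: AE_ball_countable AE_all_countable)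
  moreover have "AE t in lebesgue_on {a..b}. t \<in> {a..b}" by (rule AE_I2) auto
  ultimately show ?thesis
  proof eventually_elim
    case (elim t)
    from tendsto_add[OF moving_part_derivative[OF elim(2)] frozen_part_derivative[OF elim(2) assms]] elim
    have "((\<lambda>\<tau>. (pairing \<tau> (X \<tau>) - pairing \<tau> (X t)) / (\<tau> - t) + (pairing \<tau> (X t) - pairing t (X t)) / (\<tau> - t)) \<longlongrightarrow>
        pairing t (Xt t) + - (\<integral>p. dir_quad (\<lambda>l. Zd l t (fst p)) (snd p) \<partial>V t)) (at t within {a..b})"
      by blast
    then show ?case
      using elim by (simp add: has_field_derivative_iff add_divide_distrib[symmetric])
  qed
qed

end

section \<open>The pointwise estimate\<close>

lemma norm_cross_le: "norm (cross3 x y) \<le> norm x * norm y"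
proof -
  have "(norm (cross3 x y))\<^sup>2 \<le> (norm x * norm y)\<^sup>2"
    using norm_cross[of x y] by (simp add: power_mult_distrib)
  then show ?thesis by (rule power2_le_imp_le) simp
qed

lemma abs_inner_le: "norm x \<le> A \<Longrightarrow> norm y \<le> B \<Longrightarrow> \<bar>x \<bullet> y\<bar> \<le> A * B"
  for x y :: "real^3"
  by (meson Cauchy_Schwarz_ineq2 mult_mono norm_ge_zero order_trans)

lemma cross_orthogonal_parallel:
  fixes u k \<tau> :: "real^3"
  assumes "norm \<tau> = 1" "\<tau> \<bullet> u = 0" "\<tau> \<bullet> k = 0"
  shows "cross3 u k = (cross3 u k \<bullet> \<tau>) *\<^sub>R \<tau>"
proof -
  have "cross3 \<tau> (cross3 u k) = 0" using assms by (simp add: Lagrange)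
  then have "0 = cross3 \<tau> (cross3 \<tau> (cross3 u k))" by simp
  also have "\<dots> = (\<tau> \<bullet> cross3 u k) *\<^sub>R \<tau> - (\<tau> \<bullet> \<tau>) *\<^sub>R cross3 u k" by (rule Lagrange)
  also have "\<tau> \<bullet> \<tau> = 1" using assms by (simp add: dot_square_norm)
  finally show ?thesis by (simp add: inner_commute)
qed

lemma abs_sum7: "\<bar>x1\<bar> \<le> y1 \<Longrightarrow> \<bar>x2\<bar> \<le> y2 \<Longrightarrow> \<bar>x3\<bar> \<le> y3 \<Longrightarrow> \<bar>x4\<bar> \<le> y4 \<Longrightarrow> \<bar>x5\<bar> \<le> y5 \<Longrightarrow> \<bar>x6\<bar> \<le> y6 \<Longrightarrow> \<bar>x7\<bar> \<le> y7
   \<Longrightarrow> \<bar>x1 + x2 + x3 + x4 + x5 + x6 + x7\<bar> \<le> y1 + y2 + y3 + y4 + y5 + y6 + (y7 :: real)"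
  by linarith

text \<open>All terms of the difference are quadratic in the pair consisting of the distance
  \<^term>\<open>norm u\<close> and the component of \<^term>\<open>\<xi>\<close> orthogonal to \<^term>\<open>\<tau>\<close>: the first-order terms
  cancel because the curve moves by the binormal flow.\<close>

lemma binormal_quadratic_estimate:
  fixes \<tau> k w u \<xi> :: "real^3" and f f1 f2 c r M :: real
  defines "\<sigma> \<equiv> (\<xi> \<bullet> \<tau>) / c"
  defines "A \<equiv> 4 * f2 * (u \<bullet> \<xi>) * (cross3 u \<tau> \<bullet> \<xi>) + 2 * f1 * \<sigma> * (cross3 u k \<bullet> \<xi>)
      + (2 * f1 * (u \<bullet> \<xi>) / c + f * (\<xi> \<bullet> k + (u \<bullet> w) * \<sigma>) / c\<^sup>2) * (cross3 \<tau> k \<bullet> \<xi>)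
      + f / c * \<sigma> * (cross3 \<tau> w \<bullet> \<xi>)"
  defines "B \<equiv> - 2 * f1 * (u \<bullet> cross3 \<tau> k) * (\<tau> \<bullet> \<xi>) + f * (cross3 \<tau> w \<bullet> \<xi>)
      + f * (k \<bullet> \<xi>) * (u \<bullet> cross3 \<tau> w) / c"
  assumes unit: "norm \<tau> = 1" "norm \<xi> = 1" and orth: "\<tau> \<bullet> k = 0" "\<tau> \<bullet> u = 0"
    and r: "0 < r" and k: "norm k \<le> 1 / (2 * r)" and w: "norm w \<le> M" and u: "norm u \<le> r"
    and c: "c = 1 - u \<bullet> k"
    and f: "0 \<le> f" "f \<le> 1" "(norm u)\<^sup>2 / r\<^sup>2 \<le> 1 - f" and f1: "\<bar>f1\<bar> \<le> 3 / r\<^sup>2" and f2: "\<bar>f2\<bar> \<le> 6 / r ^ 4"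
  shows "\<bar>B - A\<bar> \<le> (77 / r\<^sup>2 + 28 * M) * (1 - f * (\<tau> \<bullet> \<xi>))"
proof -
  \<comment> \<open>Here \<open>A\<close> stands for D(curl X) on \<xi> and \<open>B\<close> for the
    time derivative of X paired with \<xi>. The quantity \<open>D\<close> is the integrand of F, and
    everything is measured by the distance \<open>d\<close>, the orthogonal part \<open>n\<close>
    and \<alpha>, the cosine of the angle between \<xi> and \<tau>.\<close>
  define \<alpha> where "\<alpha> = \<tau> \<bullet> \<xi>"
  define \<eta> where "\<eta> = \<xi> - \<alpha> *\<^sub>R \<tau>"
  define n where "n = norm \<eta>"
  define D where "D = 1 - f * \<alpha>"
  define d where "d = norm u"
  have \<xi>: "\<xi> = \<eta> + \<alpha> *\<^sub>R \<tau>" by (simp add: \<eta>_def)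
  have tt: "\<tau> \<bullet> \<tau> = 1" "\<xi> \<bullet> \<xi> = 1" using unit by (simp_all add: dot_square_norm)
  have \<alpha>: "\<bar>\<alpha>\<bar> \<le> 1" using Cauchy_Schwarz_ineq2[of \<tau> \<xi>] unit by (simp add: \<alpha>_def)
  have n2: "n\<^sup>2 = 1 - \<alpha>\<^sup>2"
  proof -
    have "n\<^sup>2 = \<eta> \<bullet> \<eta>" by (simp add: n_def power2_norm_eq_inner)
    also have "\<dots> = 1 - \<alpha>\<^sup>2"
      by (simp add: \<eta>_def inner_diff_left inner_diff_right tt \<alpha>_def[symmetric] inner_commute[of \<xi> \<tau>] power2_eq_square)
    finally show ?thesis .
  qed
  have M: "0 \<le> M" using w norm_ge_zero order_trans by blast
  have n0: "0 \<le> n" and d0: "0 \<le> d" by (simp_all add: n_def d_def)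
  have n1: "n \<le> 1" using n2 n0 by (metis abs_square_le_1 abs_of_nonneg diff_le_eq le_add_same_cancel1 zero_le_power2)
  have f\<alpha>: "f * \<alpha> \<le> 1"
    using mult_mono[of f 1 "\<bar>\<alpha>\<bar>" 1] f \<alpha> by (metis abs_ge_self abs_ge_zero mult.right_neutral mult_left_mono order_trans zero_le_one)
  have D0: "0 \<le> D" using f\<alpha> by (simp add: D_def)
  have a1: "1 - \<alpha> \<le> 2 * D"
  proof (cases "\<alpha> \<ge> 0")
    case True
    then have "f * \<alpha> \<le> \<alpha>" using f mult_right_mono[of f 1 \<alpha>] by simp
    then show ?thesis using D0 by (simp add: D_def)
  next
    case False
    then have "f * \<alpha> \<le> 0" using f by (simp add: mult_nonneg_nonpos)
    then have "1 \<le> D" by (simp add: D_def)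
    then show ?thesis using \<alpha> by linarith
  qed
  have nD: "n\<^sup>2 \<le> 2 * D"
  proof (cases "\<alpha> \<ge> 0")
    case True
    then have "f * \<alpha> \<le> \<alpha>" using f mult_right_mono[of f 1 \<alpha>] by simp
    moreover have "1 - \<alpha>\<^sup>2 = (1 - \<alpha>) * (1 + \<alpha>)" by (simp add: power2_eq_square algebra_simps)
    moreover have "(1 - \<alpha>) * (1 + \<alpha>) \<le> (1 - \<alpha>) * 2" using \<alpha> by (intro mult_left_mono) auto
    ultimately show ?thesis using n2 by (simp add: D_def)
  next
    case False
    then have "f * \<alpha> \<le> 0" using f by (simp add: mult_nonneg_nonpos)
    then have "1 \<le> D" by (simp add: D_def)
    moreover have "n\<^sup>2 \<le> 1" using n2 by simp
    ultimately show ?thesis by linarith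
  qed
  have dD: "d\<^sup>2 \<le> r\<^sup>2 * D"
  proof -
    have "f * \<alpha> \<le> f" using f \<alpha> mult_left_mono[of \<alpha> 1 f] by simp
    then have "d\<^sup>2 / r\<^sup>2 \<le> D" using f by (simp add: D_def d_def)
    then show ?thesis using r by (simp add: field_simps)
  qed
  \<comment> \<open>Mixed products are controlled by the arithmetic-geometric inequality weighted by
    \<open>r\<close>; the resulting 3/2 is rounded up to 2.\<close>
  have dn: "d * n \<le> 2 * r * D"
  proof -
    have "0 \<le> (d - r * n)\<^sup>2" by simp
    then have "2 * r * (d * n) \<le> d\<^sup>2 + r\<^sup>2 * n\<^sup>2" by (simp add: power2_eq_square algebra_simps)
    also have "\<dots> \<le> r\<^sup>2 * D + r\<^sup>2 * (2 * D)" using dD nD by (intro add_mono mult_left_mono) auto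
    also have "\<dots> \<le> 2 * r * (2 * r * D)" using D0 by (simp add: power2_eq_square)
    finally show ?thesis using r by (metis mult_le_cancel_left_pos mult_pos_pos zero_less_numeral)
  qed
  define \<kappa> where "\<kappa> = 1 / (2 * r)"
  have \<kappa>: "0 \<le> \<kappa>" "\<kappa> * r = 1 / 2" "norm k \<le> \<kappa>" using r k by (simp_all add: \<kappa>_def)
  have d\<kappa>: "d * \<kappa> \<le> 1 / 2" using mult_right_mono[of d r \<kappa>] u \<kappa> by (simp add: d_def mult.commute)
  have uk: "\<bar>u \<bullet> k\<bar> \<le> d * \<kappa>" by (rule abs_inner_le) (use \<kappa> in \<open>auto simp: d_def\<close>)
  \<comment> \<open>The factor one half in the definition of r acts here: \<bar>u\<bar> \<le> r
    together with curvature at most 1/(2r) keeps the Jacobian \<open>c\<close> away from 0.\<close>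
  have c2: "1 / 2 \<le> c" using uk d\<kappa> c by linarith
  have ic: "\<bar>1 / c\<bar> \<le> 2" using c2 by (simp add: field_simps)
  have rat: "\<bar>1 - \<alpha> / c\<bar> \<le> 2 * ((1 - \<alpha>) + d * \<kappa>)"
  proof -
    have "1 - \<alpha> / c = (1 / c) * (c - \<alpha>)" using c2 by (simp add: field_simps)
    moreover have "\<bar>c - \<alpha>\<bar> \<le> (1 - \<alpha>) + d * \<kappa>" using uk c \<alpha> by linarith
    ultimately show ?thesis using ic mult_mono[of "\<bar>1 / c\<bar>" 2 "\<bar>c - \<alpha>\<bar>" "(1 - \<alpha>) + d * \<kappa>"] by (simp add: abs_mult)
  qed
  define p q \<delta> e h v y z where "p = u \<bullet> \<eta>" and "q = cross3 u \<tau> \<bullet> \<eta>" and "\<delta> = u \<bullet> cross3 \<tau> k" and "e = k \<bullet> \<eta>"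
    and "h = cross3 \<tau> k \<bullet> \<eta>" and "v = u \<bullet> w" and "y = cross3 \<tau> w \<bullet> \<eta>" and "z = u \<bullet> cross3 \<tau> w"
  note defs = p_def q_def \<delta>_def e_def h_def v_def y_def z_def
  have cr: "norm (cross3 \<tau> k) \<le> \<kappa>" "norm (cross3 \<tau> w) \<le> M" "norm (cross3 u \<tau>) \<le> d"
    using norm_cross_le[of \<tau> k] norm_cross_le[of \<tau> w] norm_cross_le[of u \<tau>] unit \<kappa> w by (auto simp: d_def)
  have p: "\<bar>p\<bar> \<le> d * n" and q: "\<bar>q\<bar> \<le> d * n" and \<delta>: "\<bar>\<delta>\<bar> \<le> d * \<kappa>" and e: "\<bar>e\<bar> \<le> \<kappa> * n" and h: "\<bar>h\<bar> \<le> \<kappa> * n"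
    and v: "\<bar>v\<bar> \<le> d * M" and y: "\<bar>y\<bar> \<le> M * n" and z: "\<bar>z\<bar> \<le> d * M"
    unfolding defs by (intro abs_inner_le; use \<kappa> w cr in \<open>simp add: d_def n_def\<close>)+
  have ce: "u \<bullet> \<xi> = p" "cross3 u \<tau> \<bullet> \<xi> = q" "\<xi> \<bullet> k = e" "k \<bullet> \<xi> = e" "cross3 \<tau> k \<bullet> \<xi> = h" "cross3 \<tau> w \<bullet> \<xi> = y"
    using orth by (simp_all add: \<xi> defs inner_add_right inner_add_left dot_cross_self inner_commute)
  \<comment> \<open>Both factors of \<open>cross3 u k\<close> are orthogonal to \<tau>, so it is a
    multiple of \<tau> and pairs with \<xi> at first order only. This is the term of
    \<open>A\<close> that must cancel against the motion of the curve in \<open>B\<close>.\<close>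
  have uk\<xi>: "cross3 u k \<bullet> \<xi> = - \<alpha> * \<delta>"
  proof -
    have "cross3 u k \<bullet> \<tau> = - \<delta>"
      unfolding \<delta>_def using cross_triple[of u k \<tau>] cross_skew[of k \<tau>] by (simp add: inner_commute)
    then show ?thesis
      using cross_orthogonal_parallel[OF unit(1) orth(2,1)] by (metis \<alpha>_def inner_scaleR_left mult.commute mult_minus_left)
  qed
  \<comment> \<open>The cancellation becomes visible: the first-order terms with \<delta> and with
    \<open>y\<close> occur in both \<open>A\<close> and \<open>B\<close> and leave the factors 1 -
    \<alpha>/c and 1 - \<alpha>/c^2, which vanish for \<alpha> = c = 1. The other five terms are
    already products of two small quantities.\<close>
  have eq: "B - A = (- 4 * f2 * p * q) + (- 2 * f1 * \<alpha> * \<delta> * (1 - \<alpha> / c)) + (- 2 * f1 * p * (1 / c) * h)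
     + (- f * e * (1 / c)\<^sup>2 * h) + (- f * v * (\<alpha> * (1 / c)) * (1 / c)\<^sup>2 * h) + (f * y * (1 - \<alpha> / c\<^sup>2)) + (f * e * z * (1 / c))"
    using c2 unfolding A_def B_def \<sigma>_def ce uk\<xi>
    by (simp add: \<alpha>_def[symmetric] \<delta>_def[symmetric] v_def[symmetric] z_def[symmetric] inner_commute[of \<xi> \<tau>] divide_simps)
       (simp add: algebra_simps power2_eq_square)
  note nn = n0 d0 M \<kappa>(1) D0
  have prods: "d * n * (d * n) \<le> r\<^sup>2 * (2 * D)" "(\<kappa> * n) * (\<kappa> * n) \<le> \<kappa>\<^sup>2 * (2 * D)"
  proof -
    have "d\<^sup>2 * n\<^sup>2 \<le> r\<^sup>2 * (2 * D)"
      using nD u by (intro mult_mono power_mono) (auto simp: d_def)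
    then show "d * n * (d * n) \<le> r\<^sup>2 * (2 * D)" by (simp add: power2_eq_square mult_ac)
    have "\<kappa>\<^sup>2 * n\<^sup>2 \<le> \<kappa>\<^sup>2 * (2 * D)" using nD by (intro mult_left_mono) auto
    then show "(\<kappa> * n) * (\<kappa> * n) \<le> \<kappa>\<^sup>2 * (2 * D)" by (simp add: power2_eq_square mult_ac)
  qed
  have r2: "r\<^sup>2 > 0" using r by simp
  have \<kappa>2: "\<kappa>\<^sup>2 = 1 / (4 * r\<^sup>2)" by (simp add: \<kappa>_def power2_eq_square)
  have t1: "\<bar>- 4 * f2 * p * q\<bar> \<le> 48 / r\<^sup>2 * D"
  proof -
    have "\<bar>- 4 * f2 * p * q\<bar> = 4 * (\<bar>f2\<bar> * (\<bar>p\<bar> * \<bar>q\<bar>))" by (simp add: abs_mult)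
    also have "\<dots> \<le> 4 * (6 / r ^ 4 * (d * n * (d * n)))"
      using f2 p q nn r by (intro mult_left_mono mult_mono) auto
    also have "\<dots> \<le> 4 * (6 / r ^ 4 * (r\<^sup>2 * (2 * D)))"
      using prods(1) r by (intro mult_left_mono) auto
    also have "\<dots> = 48 / r\<^sup>2 * D" using r by (simp add: field_simps power2_eq_square power4_eq_xxxx)
    finally show ?thesis .
  qed
  have t2: "\<bar>- 2 * f1 * \<alpha> * \<delta> * (1 - \<alpha> / c)\<bar> \<le> 15 / r\<^sup>2 * D"
  proof -
    have "\<bar>- 2 * f1 * \<alpha> * \<delta> * (1 - \<alpha> / c)\<bar> = 2 * (\<bar>f1\<bar> * (\<bar>\<alpha>\<bar> * (\<bar>\<delta>\<bar> * \<bar>1 - \<alpha> / c\<bar>)))" by (simp add: abs_mult)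
    also have "\<dots> \<le> 2 * (3 / r\<^sup>2 * (1 * (d * \<kappa> * (2 * ((1 - \<alpha>) + d * \<kappa>)))))"
      using f1 \<alpha> \<delta> rat nn r by (intro mult_left_mono mult_mono) auto
    also have "d * \<kappa> * (2 * ((1 - \<alpha>) + d * \<kappa>)) = 2 * (d * \<kappa> * (1 - \<alpha>)) + 2 * (d\<^sup>2 * \<kappa>\<^sup>2)"
      by (simp add: power2_eq_square algebra_simps)
    also have "2 * (3 / r\<^sup>2 * (1 * (2 * (d * \<kappa> * (1 - \<alpha>)) + 2 * (d\<^sup>2 * \<kappa>\<^sup>2)))) \<le> 2 * (3 / r\<^sup>2 * (1 * (2 * (1 / 2 * (2 * D)) + 2 * ((r\<^sup>2 * D) * \<kappa>\<^sup>2))))"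
      using d\<kappa> a1 dD nn r \<alpha> by (intro mult_left_mono add_mono mult_mono) auto
    also have "\<dots> = 15 / r\<^sup>2 * D" using r by (simp add: \<kappa>2 field_simps)
    finally show ?thesis .
  qed
  have t3: "\<bar>- 2 * f1 * p * (1 / c) * h\<bar> \<le> 12 / r\<^sup>2 * D"
  proof -
    have "\<bar>- 2 * f1 * p * (1 / c) * h\<bar> = 2 * (\<bar>f1\<bar> * (\<bar>1 / c\<bar> * (\<bar>p\<bar> * \<bar>h\<bar>)))" by (simp add: abs_mult)
    also have "\<dots> \<le> 2 * (3 / r\<^sup>2 * (2 * (d * n * (\<kappa> * n))))"
      using f1 ic p h nn r by (intro mult_left_mono mult_mono) auto
    also have "d * n * (\<kappa> * n) = (d * \<kappa>) * n\<^sup>2" by (simp add: power2_eq_square)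
    also have "2 * (3 / r\<^sup>2 * (2 * ((d * \<kappa>) * n\<^sup>2))) \<le> 2 * (3 / r\<^sup>2 * (2 * (1 / 2 * (2 * D))))"
      using d\<kappa> nD nn r by (intro mult_left_mono mult_mono) auto
    also have "\<dots> = 12 / r\<^sup>2 * D" by simp
    finally show ?thesis .
  qed
  have ic2: "\<bar>(1 / c)\<^sup>2\<bar> \<le> 4" using power_mono[of "1 / c" 2 2] ic c2 by simp
  have t4: "\<bar>- f * e * (1 / c)\<^sup>2 * h\<bar> \<le> 2 / r\<^sup>2 * D"
  proof -
    have "\<bar>- f * e * (1 / c)\<^sup>2 * h\<bar> = \<bar>f\<bar> * (\<bar>(1 / c)\<^sup>2\<bar> * (\<bar>e\<bar> * \<bar>h\<bar>))" by (simp add: abs_mult)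
    also have "\<dots> \<le> 1 * (4 * ((\<kappa> * n) * (\<kappa> * n)))"
      using f ic2 e h nn r by (intro mult_left_mono mult_mono) auto
    also have "\<dots> \<le> 1 * (4 * (\<kappa>\<^sup>2 * (2 * D)))" by (intro mult_left_mono prods(2)) auto
    also have "\<dots> = 2 / r\<^sup>2 * D" by (simp add: \<kappa>2)
    finally show ?thesis .
  qed
  have t5: "\<bar>- f * v * (\<alpha> * (1 / c)) * (1 / c)\<^sup>2 * h\<bar> \<le> 8 * M * D"
  proof -
    have "\<bar>- f * v * (\<alpha> * (1 / c)) * (1 / c)\<^sup>2 * h\<bar> = \<bar>f\<bar> * (\<bar>\<alpha>\<bar> * (\<bar>1 / c\<bar> * (\<bar>(1 / c)\<^sup>2\<bar> * (\<bar>v\<bar> * \<bar>h\<bar>))))" by (simp add: abs_mult)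
    also have "\<dots> \<le> 1 * (1 * (2 * (4 * (d * M * (\<kappa> * n)))))"
      using f \<alpha> ic ic2 v h nn r by (intro mult_mono) auto
    also have "\<dots> = 8 * M * \<kappa> * (d * n)" by simp
    also have "\<dots> \<le> 8 * M * \<kappa> * (2 * r * D)" using dn nn by (intro mult_left_mono) auto
    also have "\<dots> = 8 * M * D" using r by (simp add: \<kappa>_def)
    finally show ?thesis .
  qed
  have rat2: "\<bar>1 - \<alpha> / c\<^sup>2\<bar> \<le> 4 * ((1 - \<alpha>) + 5 / 2 * (d * \<kappa>))"
  proof -
    have "1 - \<alpha> / c\<^sup>2 = (1 / c)\<^sup>2 * (c\<^sup>2 - \<alpha>)" using c2 by (simp add: field_simps)
    moreover have "\<bar>c\<^sup>2 - \<alpha>\<bar> \<le> (1 - \<alpha>) + 5 / 2 * (d * \<kappa>)"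
    proof -
      \<comment> \<open>The 5/2 below bounds \<open>c + 1\<close>, since \<open>c\<close> is at most
        3/2.\<close>
      have "c\<^sup>2 - 1 = - ((c + 1) * (u \<bullet> k))"
        by (simp add: c power2_eq_square algebra_simps)
      then have "\<bar>c\<^sup>2 - 1\<bar> = \<bar>c + 1\<bar> * \<bar>u \<bullet> k\<bar>" by (simp add: abs_mult)
      also have "\<dots> \<le> 5 / 2 * (d * \<kappa>)"
        using uk d\<kappa> c by (intro mult_mono) auto
      finally show ?thesis using \<alpha> by linarith
    qed
    ultimately show ?thesis
      using ic2 mult_mono[of "\<bar>(1 / c)\<^sup>2\<bar>" 4 "\<bar>c\<^sup>2 - \<alpha>\<bar>" "(1 - \<alpha>) + 5 / 2 * (d * \<kappa>)"] by (simp add: abs_mult)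
  qed
  have t6: "\<bar>f * y * (1 - \<alpha> / c\<^sup>2)\<bar> \<le> 18 * M * D"
  proof -
    have "\<bar>f * y * (1 - \<alpha> / c\<^sup>2)\<bar> = \<bar>f\<bar> * (\<bar>y\<bar> * \<bar>1 - \<alpha> / c\<^sup>2\<bar>)" by (simp add: abs_mult)
    also have "\<dots> \<le> 1 * (M * n * (4 * ((1 - \<alpha>) + 5 / 2 * (d * \<kappa>))))"
      using f y rat2 nn by (intro mult_mono) auto
    also have "\<dots> = 4 * M * (n * (1 - \<alpha>) + 5 / 2 * (\<kappa> * (d * n)))" by (simp add: algebra_simps)
    also have "\<dots> \<le> 4 * M * (1 * (2 * D) + 5 / 2 * (\<kappa> * (2 * r * D)))"
    proof -
      have "n * (1 - \<alpha>) \<le> 1 * (2 * D)" using n1 a1 nn \<alpha> by (intro mult_mono) auto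
      moreover have "5 / 2 * (\<kappa> * (d * n)) \<le> 5 / 2 * (\<kappa> * (2 * r * D))" using dn nn by (intro mult_left_mono) auto
      ultimately have "n * (1 - \<alpha>) + 5 / 2 * (\<kappa> * (d * n)) \<le> 1 * (2 * D) + 5 / 2 * (\<kappa> * (2 * r * D))"
        by (rule add_mono)
      then show ?thesis by (rule mult_left_mono) (use M in simp)
    qed
    also have "\<dots> = 18 * M * D" using r by (simp add: \<kappa>_def)
    finally show ?thesis .
  qed
  have t7: "\<bar>f * e * z * (1 / c)\<bar> \<le> 2 * M * D"
  proof -
    have "\<bar>f * e * z * (1 / c)\<bar> = \<bar>f\<bar> * (\<bar>1 / c\<bar> * (\<bar>e\<bar> * \<bar>z\<bar>))" by (simp add: abs_mult)
    also have "\<dots> \<le> 1 * (2 * (\<kappa> * n * (d * M)))"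
      using f ic e z nn by (intro mult_mono) auto
    also have "\<dots> = 2 * M * \<kappa> * (d * n)" by simp
    also have "\<dots> \<le> 2 * M * \<kappa> * (2 * r * D)" using dn nn by (intro mult_left_mono) auto
    also have "\<dots> = 2 * M * D" using r by (simp add: \<kappa>_def)
    finally show ?thesis .
  qed
  \<comment> \<open>The constants are the column sums 77 = 48 + 15 + 12 + 2 and 28 = 8 + 18 +
    2.\<close>
  have "\<bar>B - A\<bar> \<le> 48 / r\<^sup>2 * D + 15 / r\<^sup>2 * D + 12 / r\<^sup>2 * D + 2 / r\<^sup>2 * D + 8 * M * D + 18 * M * D + 2 * M * D"
    unfolding eq by (rule abs_sum7[OF t1 t2 t3 t4 t5 t6 t7])
  also have "\<dots> = (77 / r\<^sup>2 + 28 * M) * D" using r by (simp add: field_simps)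
  finally show ?thesis by (simp add: D_def \<alpha>_def)
qed

section \<open>Nearest points on a family of closed curves\<close>

text \<open>The branch \<open>sf\<close> and its convergence are given beforehand by uniqueness of
  nearest points, so only its derivative has to be found. The mean value theorem in \<open>s\<close>
  writes \<Phi> at \<open>sf h\<close> minus \<Phi> at \<open>s0\<close> as \<open>sf h - s0\<close>
  times a value of \<Phi>s close to \<open>\<Phi>s h0 s0\<close>. Working within \<open>S\<close>
  admits one-sided derivatives at the ends of the time interval.\<close>

lemma implicit_function_derivative:
  fixes \<Phi> \<Phi>s :: "real \<Rightarrow> real \<Rightarrow> real" and sf :: "real \<Rightarrow> real"
  assumes zero: "\<forall>\<^sub>F h in at h0 within S. \<Phi> h (sf h) = 0" "\<Phi> h0 s0 = 0" and sf0: "sf h0 = s0"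
    and lim: "(sf \<longlongrightarrow> s0) (at h0 within S)"
    and Dh: "((\<lambda>h. \<Phi> h s0) has_real_derivative A) (at h0 within S)"
    and Ds: "\<And>h s. h \<in> S \<Longrightarrow> (\<Phi> h has_real_derivative \<Phi>s h s) (at s)"
    and cont: "continuous (at (h0, s0) within S \<times> UNIV) (\<lambda>(h, s). \<Phi>s h s)"
    and nz: "\<Phi>s h0 s0 \<noteq> 0"
  shows "(sf has_real_derivative - A / \<Phi>s h0 s0) (at h0 within S)"
proof -
  have "\<exists>\<zeta>. \<bar>\<zeta> - s0\<bar> \<le> \<bar>sf h - s0\<bar> \<and> \<Phi> h (sf h) - \<Phi> h s0 = (sf h - s0) * \<Phi>s h \<zeta>" if hS: "h \<in> S" for h
  proof -
    consider "sf h < s0" | "sf h = s0" | "sf h > s0" by linarith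
    then show ?thesis
    proof cases
      case 1
      obtain z where "sf h < z" "z < s0" "\<Phi> h s0 - \<Phi> h (sf h) = (s0 - sf h) * \<Phi>s h z"
        using MVT2[OF 1, of "\<Phi> h" "\<Phi>s h"] Ds[OF hS] by blast
      then show ?thesis by (intro exI[of _ z]) (auto simp: algebra_simps)
    next
      case 2
      then show ?thesis by (intro exI[of _ s0]) auto
    next
      case 3
      obtain z where "s0 < z" "z < sf h" "\<Phi> h (sf h) - \<Phi> h s0 = (sf h - s0) * \<Phi>s h z"
        using MVT2[OF 3, of "\<Phi> h" "\<Phi>s h"] Ds[OF hS] by blast
      then show ?thesis by (intro exI[of _ z]) auto
    qed
  qed
  then obtain \<zeta> where \<zeta>: "\<And>h. h \<in> S \<Longrightarrow> \<bar>\<zeta> h - s0\<bar> \<le> \<bar>sf h - s0\<bar>"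
    "\<And>h. h \<in> S \<Longrightarrow> \<Phi> h (sf h) - \<Phi> h s0 = (sf h - s0) * \<Phi>s h (\<zeta> h)"
    by metis
  have inS: "\<forall>\<^sub>F h in at h0 within S. h \<in> S \<and> h \<noteq> h0"
    by (auto simp: eventually_at_filter)
  have "((\<lambda>h. \<zeta> h - s0) \<longlongrightarrow> 0) (at h0 within S)"
  proof (rule Lim_null_comparison)
    show "\<forall>\<^sub>F h in at h0 within S. norm (\<zeta> h - s0) \<le> \<bar>sf h - s0\<bar>"
      using inS by eventually_elim (use \<zeta>(1) in auto)
    show "((\<lambda>h. \<bar>sf h - s0\<bar>) \<longlongrightarrow> 0) (at h0 within S)"
      using tendsto_rabs[OF tendsto_diff[OF lim tendsto_const[of s0]]] by simp
  qed
  then have "(\<zeta> \<longlongrightarrow> s0) (at h0 within S)" by (simp add: LIM_zero_iff)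
  then have "((\<lambda>h. (h, \<zeta> h)) \<longlongrightarrow> (h0, s0)) (at h0 within S)"
    by (intro tendsto_Pair tendsto_ident_at)
  moreover have "\<forall>\<^sub>F h in at h0 within S. (h, \<zeta> h) \<in> S \<times> UNIV"
    using inS by (rule eventually_mono) auto
  ultimately have \<Phi>\<zeta>: "((\<lambda>h. \<Phi>s h (\<zeta> h)) \<longlongrightarrow> \<Phi>s h0 s0) (at h0 within S)"
    using continuous_within_tendsto_compose[OF cont, of "\<lambda>h. (h, \<zeta> h)" "at h0 within S"] by simp
  have "((\<lambda>h. - ((\<Phi> h s0 - \<Phi> h0 s0) / (h - h0)) / \<Phi>s h (\<zeta> h)) \<longlongrightarrow> - A / \<Phi>s h0 s0) (at h0 within S)"
    using Dh \<Phi>\<zeta> nz by (intro tendsto_intros) (auto simp: has_field_derivative_iff)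
  moreover have "\<forall>\<^sub>F h in at h0 within S. - ((\<Phi> h s0 - \<Phi> h0 s0) / (h - h0)) / \<Phi>s h (\<zeta> h) = (sf h - sf h0) / (h - h0)"
    using inS zero(1) tendsto_imp_eventually_ne[OF \<Phi>\<zeta> nz]
  proof eventually_elim
    case (elim h)
    then have "- \<Phi> h s0 = (sf h - s0) * \<Phi>s h (\<zeta> h)" using \<zeta>(2)[of h] by simp
    then have "sf h - sf h0 = - \<Phi> h s0 / \<Phi>s h (\<zeta> h)" using elim sf0 by simp
    then show ?case using zero(2) by (simp add: mult.commute)
  qed
  ultimately have "((\<lambda>h. (sf h - sf h0) / (h - h0)) \<longlongrightarrow> - A / \<Phi>s h0 s0) (at h0 within S)"
    by (rule Lim_transform_eventually)
  then show ?thesis by (simp add: has_field_derivative_iff)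
qed

lemma chain_two_variables:
  fixes F Fs :: "real \<Rightarrow> real \<Rightarrow> 'a::real_normed_vector"
  assumes Dh: "((\<lambda>h. F h s0) has_vector_derivative A) (at h0 within S)"
    and Ds: "\<And>h s. h \<in> S \<Longrightarrow> (F h has_vector_derivative Fs h s) (at s)"
    and cont: "continuous (at (h0, s0) within S \<times> UNIV) (\<lambda>(h, s). Fs h s)"
    and sf: "(sf has_real_derivative \<sigma>) (at h0 within S)" "sf h0 = s0"
  shows "((\<lambda>h. F h (sf h)) has_vector_derivative A + \<sigma> *\<^sub>R Fs h0 s0) (at h0 within S)"
proof -
  have "((\<lambda>(h, s). F h s) has_derivative (\<lambda>(th, ts). (th *\<^sub>R A) + blinfun_scaleR_left (Fs h0 s0) ts)) (at (h0, s0) within S \<times> UNIV)"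
  proof (rule has_derivative_partialsI)
    show "((\<lambda>h. F h s0) has_derivative (\<lambda>th. th *\<^sub>R A)) (at h0 within S)"
      using Dh by (simp add: has_vector_derivative_def)
    show "(F h has_derivative blinfun_apply (blinfun_scaleR_left (Fs h s))) (at s within UNIV)" if "h \<in> S" for h s
      using Ds[OF that] by (simp add: has_vector_derivative_def)
    show "continuous (at (h0, s0) within S \<times> UNIV) (\<lambda>(h, s). blinfun_scaleR_left (Fs h s))"
      using bounded_linear.continuous[OF bounded_linear_blinfun_scaleR_left cont] by (simp add: case_prod_unfold)
  qed auto
  moreover have "((\<lambda>h. (h, sf h)) has_derivative (\<lambda>th. (th, \<sigma> * th))) (at h0 within S)"
    using sf(1) by (auto intro!: derivative_eq_intros simp: has_field_derivative_def)
  ultimately have "((\<lambda>(h, s). F h s) \<circ> (\<lambda>h. (h, sf h)) has_derivative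
      (\<lambda>(th, ts). (th *\<^sub>R A) + blinfun_scaleR_left (Fs h0 s0) ts) \<circ> (\<lambda>th. (th, \<sigma> * th))) (at h0 within S)"
    by (intro diff_chain_within) (auto simp: sf(2) intro: has_derivative_subset)
  then show ?thesis
    by (simp add: has_vector_derivative_def o_def scaleR_add_right mult.commute)
qed

text \<open>The cutoff as a function of the squared distance. Writing it with \<open>max\<close> and
  a third power makes it C^2 on the whole line, with \<open>profile1\<close> and
  \<open>profile2\<close> as first and second derivatives; one for X, one more for its curl.\<close>

definition profile :: "real \<Rightarrow> real \<Rightarrow> real" where "profile r z = (max 0 (1 - z / r\<^sup>2)) ^ 3"
definition profile1 :: "real \<Rightarrow> real \<Rightarrow> real" where "profile1 r z = - 3 / r\<^sup>2 * (max 0 (1 - z / r\<^sup>2)) ^ 2"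
definition profile2 :: "real \<Rightarrow> real \<Rightarrow> real" where "profile2 r z = 6 / r ^ 4 * max 0 (1 - z / r\<^sup>2)"

lemma positive_part_power_derivative:
  "((\<lambda>y::real. max 0 y ^ (n + 2)) has_real_derivative real (n + 2) * max 0 y ^ (n + 1)) (at y)"
proof -
  consider "y > 0" | "y < 0" | "y = 0" by linarith
  then show ?thesis
  proof cases
    case 1
    have "((\<lambda>y::real. y ^ (n + 2)) has_real_derivative real (n + 2) * max 0 y ^ (n + 1)) (at y)"
      using 1 DERIV_pow[of "n + 2" y] by simp
    then show ?thesis
      by (rule has_field_derivative_transform_within_open[where S="{0<..}"]) (use 1 in auto)
  next
    case 2
    have "((\<lambda>y::real. 0) has_real_derivative 0) (at y)" by simp
    then have "((\<lambda>y::real. max 0 y ^ (n + 2)) has_real_derivative 0) (at y)"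
      by (rule has_field_derivative_transform_within_open[where S="{..<0}"]) (use 2 in auto)
    then show ?thesis using 2 by simp
  next
    case 3
    have "((\<lambda>h::real. max 0 h ^ (n + 1)) \<longlongrightarrow> max 0 0 ^ (n + 1)) (at 0)"
      by (intro tendsto_intros)
    moreover have "\<forall>\<^sub>F h in at 0. max 0 h ^ (n + 1) = max 0 h ^ (n + 2) / (h::real)"
      by (auto simp: eventually_at_filter max_def)
    ultimately have "((\<lambda>h::real. max 0 h ^ (n + 2) / h) \<longlongrightarrow> max 0 0 ^ (n + 1)) (at 0)"
      by (rule Lim_transform_eventually)
    then show ?thesis using 3 by (simp add: has_field_derivative_iff)
  qed
qed

lemma profile_derivative:
  "(profile r has_real_derivative profile1 r z) (at z)" "(profile1 r has_real_derivative profile2 r z) (at z)"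
proof -
  have D: "((\<lambda>z. 1 - z / r\<^sup>2) has_real_derivative - 1 / r\<^sup>2) (at z)"
    using DERIV_diff[OF DERIV_const[of 1] DERIV_cdivide[OF DERIV_ident, of "r\<^sup>2"]] by simp
  have "((\<lambda>z. max 0 (1 - z / r\<^sup>2) ^ (1 + 2)) has_real_derivative real (1 + 2) * max 0 (1 - z / r\<^sup>2) ^ (1 + 1) * (- 1 / r\<^sup>2)) (at z)"
    by (rule DERIV_chain2[OF positive_part_power_derivative D])
  then show "(profile r has_real_derivative profile1 r z) (at z)"
    unfolding profile_def[abs_def] profile1_def by (simp add: numeral_eq_Suc)
  have "((\<lambda>z. max 0 (1 - z / r\<^sup>2) ^ (0 + 2)) has_real_derivative real (0 + 2) * max 0 (1 - z / r\<^sup>2) ^ (0 + 1) * (- 1 / r\<^sup>2)) (at z)"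
    by (rule DERIV_chain2[OF positive_part_power_derivative D])
  moreover have "- 3 / r\<^sup>2 * (real (0 + 2) * max 0 (1 - z / r\<^sup>2) ^ (0 + 1) * (- 1 / r\<^sup>2)) = profile2 r z"
    by (simp add: profile2_def power2_eq_square power4_eq_xxxx)
  ultimately show "(profile1 r has_real_derivative profile2 r z) (at z)"
    using DERIV_cmult[of "\<lambda>z. max 0 (1 - z / r\<^sup>2) ^ (0 + 2)" _ z UNIV "- 3 / r\<^sup>2"]
    unfolding profile1_def[abs_def] by (metis add_0)
qed

lemma profile_continuous: "continuous_on S (profile r)" "continuous_on S (profile1 r)" "continuous_on S (profile2 r)"
  unfolding profile_def[abs_def] profile1_def[abs_def] profile2_def[abs_def] divide_inverse
  by (intro continuous_intros)+

lemma profile_zero: "r > 0 \<Longrightarrow> r\<^sup>2 \<le> z \<Longrightarrow> profile r z = 0 \<and> profile1 r z = 0 \<and> profile2 r z = 0"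
  by (simp add: profile_def profile1_def profile2_def max_def)

lemma profile_bounds:
  assumes "r > 0" "0 \<le> z" "z \<le> r\<^sup>2"
  shows "0 \<le> profile r z" "profile r z \<le> 1" "z / r\<^sup>2 \<le> 1 - profile r z" "\<bar>profile1 r z\<bar> \<le> 3 / r\<^sup>2" "\<bar>profile2 r z\<bar> \<le> 6 / r ^ 4"
proof -
  define y where "y = 1 - z / r\<^sup>2"
  have y: "0 \<le> y" "y \<le> 1" using assms by (auto simp: y_def field_simps)
  then have m: "max 0 (1 - z / r\<^sup>2) = y" by (simp add: y_def)
  \<comment> \<open>This yields f \<le> 1 - d^2/r^2, the reason why the deficit 1 - X.\<xi>
    dominates the squared distance.\<close>
  have "y ^ 3 \<le> y ^ 1" using y by (intro power_decreasing) auto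
  then show "z / r\<^sup>2 \<le> 1 - profile r z" unfolding profile_def m by (simp add: y_def)
  show "0 \<le> profile r z" "profile r z \<le> 1" unfolding profile_def m using y by (auto intro: power_le_one)
  have "y\<^sup>2 \<le> 1" using y by (intro power_le_one) auto
  then have "3 / r\<^sup>2 * y\<^sup>2 \<le> 3 / r\<^sup>2 * 1" using assms by (intro mult_left_mono) auto
  then show "\<bar>profile1 r z\<bar> \<le> 3 / r\<^sup>2" unfolding profile1_def m by (simp add: abs_mult)
  have "6 / r ^ 4 * y \<le> 6 / r ^ 4 * 1" using assms y by (intro mult_left_mono) auto
  then show "\<bar>profile2 r z\<bar> \<le> 6 / r ^ 4" unfolding profile2_def m using y by (simp add: abs_mult)
qed

section \<open>Periodic parametrizations and injectivity modulo the period\<close>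

lemma periodic_int_shift:
  fixes f :: "real \<Rightarrow> 'a"
  assumes "\<And>s. f (s + L) = f s"
  shows "f (s + of_int k * L) = f s"
proof (induction k arbitrary: s rule: int_induct[of _ 0])
  case (step1 i)
  then show ?case using assms[of "s + of_int i * L"] by (simp add: algebra_simps)
next
  case (step2 i)
  then show ?case using assms[of "s + (of_int i - 1) * L"] by (simp add: algebra_simps)
qed simp

lemma periodic_derivative:
  fixes f f' :: "real \<Rightarrow> 'a::real_normed_vector"
  assumes "\<And>s. f (s + L) = f s" "\<And>s. (f has_vector_derivative f' s) (at s)"
  shows "f' (s + L) = f' s"
proof -
  have "((f \<circ> (\<lambda>s. s + L)) has_vector_derivative 1 *\<^sub>R f' (s + L)) (at s)"
    by (rule vector_diff_chain_at) (auto intro!: derivative_eq_intros assms(2))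
  moreover have "f \<circ> (\<lambda>s. s + L) = f" using assms(1) by auto
  ultimately show ?thesis using assms(2)[of s] vector_derivative_unique_at by fastforce
qed

lemma period_representative:
  fixes L :: real
  assumes "L > 0"
  obtains k :: int where "c \<le> s + of_int k * L" "s + of_int k * L < c + L"
proof -
  define k where "k = - \<lfloor>(s - c) / L\<rfloor>"
  have "of_int \<lfloor>(s - c) / L\<rfloor> * L \<le> s - c" "s - c < (of_int \<lfloor>(s - c) / L\<rfloor> + 1) * L"
    using pos_le_divide_eq[OF assms, THEN iffD1, OF of_int_floor_le]
      pos_divide_less_eq[OF assms, THEN iffD1, OF floor_correct[THEN conjunct2]] by simp_all
  then show thesis by (intro that[of k]) (auto simp: k_def algebra_simps)
qed

lemma periodic_injective_shift:
  fixes f :: "real \<Rightarrow> 'a"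
  assumes L: "L > 0" and per: "\<And>s. f (s + L) = f s" and inj: "inj_on f {0..<L}" and eq: "f s = f s'"
  obtains k :: int where "s' = s + of_int k * L"
proof -
  obtain i :: int where i: "0 \<le> s + of_int i * L" "s + of_int i * L < 0 + L" using period_representative[OF L] .
  obtain j :: int where j: "0 \<le> s' + of_int j * L" "s' + of_int j * L < 0 + L" using period_representative[OF L] .
  have "f (s + of_int i * L) = f (s' + of_int j * L)"
    using eq periodic_int_shift[of f L, OF per] by simp
  then have "s + of_int i * L = s' + of_int j * L"
    using inj_onD[OF inj] i j by auto
  then show thesis by (intro that[of "i - j"]) (simp add: algebra_simps)
qed

text \<open>No radius occurs in this locale: here the facts are proved that make
  \<open>r_gamma\<close> positive, before \<open>curve_family\<close>, which presupposes that
  radius, can be interpreted.\<close>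

locale closed_curves =
  fixes a b L :: real and g g1 g2 :: "real \<Rightarrow> real \<Rightarrow> real^3"
  assumes ab: "a \<le> b" and L: "L > 0"
    and cont0: "continuous_on ({a..b} \<times> UNIV) (\<lambda>(t, s). g t s)"
    and cont2: "continuous_on ({a..b} \<times> UNIV) (\<lambda>(t, s). g2 t s)"
    and per: "\<And>t s. t \<in> {a..b} \<Longrightarrow> g t (s + L) = g t s"
    and ds0: "\<And>t s. t \<in> {a..b} \<Longrightarrow> (g t has_vector_derivative g1 t s) (at s)"
    and ds1: "\<And>t s. t \<in> {a..b} \<Longrightarrow> (g1 t has_vector_derivative g2 t s) (at s)"
    and unit: "\<And>t s. t \<in> {a..b} \<Longrightarrow> norm (g1 t s) = 1"
    and inj: "\<And>t. t \<in> {a..b} \<Longrightarrow> inj_on (g t) {0..<L}"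
begin

lemma per1: "t \<in> {a..b} \<Longrightarrow> g1 t (s + L) = g1 t s"
  by (rule periodic_derivative[OF per ds0])

lemma per2: "t \<in> {a..b} \<Longrightarrow> g2 t (s + L) = g2 t s"
  by (rule periodic_derivative[OF per1 ds1])

lemma shift0: "t \<in> {a..b} \<Longrightarrow> g t (s + of_int k * L) = g t s"
  using periodic_int_shift[of "g t" L] per by blast

lemma curve_cont: "t \<in> {a..b} \<Longrightarrow> continuous_on S (g t)"
  using ds0 by (meson continuous_at_imp_continuous_on has_vector_derivative_continuous)

lemma range_eq: "t \<in> {a..b} \<Longrightarrow> range (g t) = g t ` {c..c + L}"
proof (intro equalityI subsetI)
  fix y assume t: "t \<in> {a..b}" and "y \<in> range (g t)"
  then obtain s where s: "y = g t s" by auto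
  obtain k :: int where "c \<le> s + of_int k * L" "s + of_int k * L < c + L" using period_representative[OF L] .
  then show "y \<in> g t ` {c..c + L}" using shift0[OF t, of s k] s by (metis atLeastAtMost_iff image_eqI less_imp_le)
qed auto

lemma compact_range: "t \<in> {a..b} \<Longrightarrow> compact (range (g t))"
  unfolding range_eq[of t 0] by (intro compact_continuous_image curve_cont compact_Icc)

lemma periodic_bounded:
  fixes f :: "real \<Rightarrow> real \<Rightarrow> real^3"
  assumes f: "continuous_on ({a..b} \<times> UNIV) (\<lambda>(t, s). f t s)" "\<And>t s. t \<in> {a..b} \<Longrightarrow> f t (s + L) = f t s"
  shows "\<exists>B>0. \<forall>t\<in>{a..b}. \<forall>s. norm (f t s) \<le> B"
proof -
  have "compact ((\<lambda>(t, s). f t s) ` ({a..b} \<times> {0..L}))"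
    by (intro compact_continuous_image compact_Times continuous_on_subset[OF f(1)]) auto
  then obtain B where B: "\<And>y. y \<in> (\<lambda>(t, s). f t s) ` ({a..b} \<times> {0..L}) \<Longrightarrow> norm y \<le> B"
    using compact_imp_bounded bounded_iff by metis
  show ?thesis
  proof (intro exI[of _ "max B 1"] conjI ballI allI)
    fix t s assume t: "t \<in> {a..b}"
    obtain k :: int where k: "0 \<le> s + of_int k * L" "s + of_int k * L < 0 + L" using period_representative[OF L] .
    have "f t s = f t (s + of_int k * L)" using periodic_int_shift[of "f t" L] f(2)[OF t] by metis
    then show "norm (f t s) \<le> max B 1"
      using B[OF imageI[of "(t, s + of_int k * L)"]] t k by (auto simp: le_max_iff_disj)
  qed simp
qed

definition near :: "real \<Rightarrow> real^3 \<Rightarrow> real \<Rightarrow> bool" where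
  "near t x s \<longleftrightarrow> (\<forall>s'. dist x (g t s) \<le> dist x (g t s'))"

lemma near_iff: "near t x s \<longleftrightarrow> dist x (g t s) = infdist x (range (g t))"
proof
  assume "near t x s"
  then have "dist x (g t s) \<le> infdist x (range (g t))"
    unfolding near_def by (auto simp: infdist_notempty intro!: cINF_greatest)
  then show "dist x (g t s) = infdist x (range (g t))"
    using infdist_le[of "g t s" "range (g t)" x] by simp
next
  assume "dist x (g t s) = infdist x (range (g t))"
  then show "near t x s" unfolding near_def by (metis infdist_le rangeI)
qed

lemma near_shift: "t \<in> {a..b} \<Longrightarrow> near t x (s + of_int k * L) \<longleftrightarrow> near t x s"
  by (simp add: near_def shift0)

lemma near_exists:
  assumes "t \<in> {a..b}"
  obtains s where "near t x s" "c \<le> s" "s < c + L"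
proof -
  obtain p where "p \<in> range (g t)" "infdist x (range (g t)) = dist x p"
    using infdist_attains_inf[of "range (g t)" x] compact_imp_closed[OF compact_range[OF assms]] by auto
  then obtain s where "near t x s" by (auto simp: near_iff)
  moreover obtain k :: int where "c \<le> s + of_int k * L" "s + of_int k * L < c + L" using period_representative[OF L] .
  ultimately show thesis using that near_shift[OF assms] by blast
qed

lemma near_orthogonal:
  assumes "t \<in> {a..b}" "near t x s"
  shows "(x - g t s) \<bullet> g1 t s = 0"
proof -
  have "((\<lambda>s. (x - g t s) \<bullet> (x - g t s)) has_real_derivative - 2 * ((x - g t s) \<bullet> g1 t s)) (at s)"
  proof -
    have D: "((\<lambda>s. x - g t s) has_vector_derivative - g1 t s) (at s)"
      using ds0[OF assms(1)] by (auto intro!: derivative_eq_intros)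
    from bounded_bilinear.has_vector_derivative[OF bounded_bilinear_inner D D]
    show ?thesis by (simp add: has_real_derivative_iff_has_vector_derivative inner_commute)
  qed
  moreover have "(x - g t s) \<bullet> (x - g t s) \<le> (x - g t s') \<bullet> (x - g t s')" for s'
    using assms(2) by (simp add: near_def dist_norm norm_le)
  ultimately have "- 2 * ((x - g t s) \<bullet> g1 t s) = 0"
    by (intro DERIV_local_min[of "\<lambda>s. (x - g t s) \<bullet> (x - g t s)" _ s 1]) auto
  then show ?thesis by simp
qed

end

locale curve_family = closed_curves +
  fixes g3 :: "real \<Rightarrow> real \<Rightarrow> real^3" and r M :: real
  assumes r: "r > 0"
    and cont1: "continuous_on ({a..b} \<times> UNIV) (\<lambda>(t, s). g1 t s)"
    and cont3: "continuous_on ({a..b} \<times> UNIV) (\<lambda>(t, s). g3 t s)"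
    and ds2: "\<And>t s. t \<in> {a..b} \<Longrightarrow> (g2 t has_vector_derivative g3 t s) (at s)"
    and dt0: "\<And>t s. t \<in> {a..b} \<Longrightarrow> ((\<lambda>t. g t s) has_vector_derivative cross3 (g1 t s) (g2 t s)) (at t within {a..b})"
    and dt1: "\<And>t s. t \<in> {a..b} \<Longrightarrow> ((\<lambda>t. g1 t s) has_vector_derivative cross3 (g1 t s) (g3 t s)) (at t within {a..b})"
    and curv: "\<And>t s. t \<in> {a..b} \<Longrightarrow> norm (g2 t s) \<le> 1 / (2 * r)"
    and tors: "\<And>t s. t \<in> {a..b} \<Longrightarrow> norm (g3 t s) \<le> M"
    and uniq: "\<And>t x. t \<in> {a..b} \<Longrightarrow> infdist x (range (g t)) < 2 * r \<Longrightarrow> closest_unique (range (g t)) x"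
begin

lemma per3: "t \<in> {a..b} \<Longrightarrow> g3 t (s + L) = g3 t s"
  by (rule periodic_derivative[OF per2 ds2])

lemma shift:
  assumes "t \<in> {a..b}"
  shows "g t (s + of_int k * L) = g t s" "g1 t (s + of_int k * L) = g1 t s"
    "g2 t (s + of_int k * L) = g2 t s" "g3 t (s + of_int k * L) = g3 t s"
  using periodic_int_shift[of "g t" L] periodic_int_shift[of "g1 t" L]
    periodic_int_shift[of "g2 t" L] periodic_int_shift[of "g3 t" L] per per1 per2 per3 assms by metis+

lemma near_unique:
  assumes "t \<in> {a..b}" "infdist x (range (g t)) < 2 * r" "near t x s" "near t x s'"
  obtains k :: int where "s' = s + of_int k * L"
proof -
  have "g t s = g t s'"
    using uniq[OF assms(1,2)] assms(3,4) unfolding closest_unique_def near_iff by blast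
  then show thesis
    using periodic_injective_shift[OF L per inj] assms(1) that by metis
qed

text \<open>Compactness: if it failed, nearest parameters for a sequence of times and points tending
  to \<open>t0\<close> and \<open>x0\<close> would accumulate at a nearest parameter of
  \<open>x0\<close>. Uniqueness identifies that one with \<open>s0\<close> up to a multiple of the
  period.\<close>

lemma near_close:
  assumes t0: "t0 \<in> {a..b}" and tube: "infdist x0 (range (g t0)) < 2 * r" and s0: "near t0 x0 s0" and "\<epsilon> > 0"
  obtains \<delta> where "\<delta> > 0" "\<And>t x. t \<in> {a..b} \<Longrightarrow> \<bar>t - t0\<bar> < \<delta> \<Longrightarrow> norm (x - x0) < \<delta> \<Longrightarrow> \<exists>s. \<bar>s - s0\<bar> < \<epsilon> \<and> near t x s"
proof (rule ccontr)
  assume "\<not> thesis"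
  then have "\<exists>t x. t \<in> {a..b} \<and> \<bar>t - t0\<bar> < inverse (real (Suc n)) \<and> norm (x - x0) < inverse (real (Suc n)) \<and> \<not> (\<exists>s. \<bar>s - s0\<bar> < \<epsilon> \<and> near t x s)" for n
    using that[of "inverse (real (Suc n))"] by (metis inverse_positive_iff_positive of_nat_0_less_iff zero_less_Suc)
  then obtain T X where TX: "\<And>n. T n \<in> {a..b}" "\<And>n. \<bar>T n - t0\<bar> < inverse (real (Suc n))"
    "\<And>n. norm (X n - x0) < inverse (real (Suc n))" "\<And>n. \<not> (\<exists>s. \<bar>s - s0\<bar> < \<epsilon> \<and> near (T n) (X n) s)"
    by metis
  \<comment> \<open>Representatives are taken in the window of one period centred at
    \<open>s0\<close>, so the accumulation point is at most L/2 away from \<open>s0\<close> and no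
    nonzero multiple of L fits.\<close>
  have "\<exists>s. near (T n) (X n) s \<and> s \<in> {s0 - L / 2..s0 + L / 2}" for n
  proof -
    obtain s where "near (T n) (X n) s" "s0 - L / 2 \<le> s" "s < s0 - L / 2 + L"
      using near_exists[OF TX(1)] .
    then show ?thesis by (intro exI[of _ s]) auto
  qed
  then obtain s where s: "\<And>n. near (T n) (X n) (s n)" "\<And>n. s n \<in> {s0 - L / 2..s0 + L / 2}" by metis
  obtain s1 \<phi> where s1: "s1 \<in> {s0 - L / 2..s0 + L / 2}" "strict_mono \<phi>" "(s \<circ> \<phi>) \<longlonglongrightarrow> s1"
    using compact_Icc[of "s0 - L / 2" "s0 + L / 2"] s(2) unfolding compact_def by (metis (no_types, lifting))
  have "T \<longlonglongrightarrow> t0"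
    by (rule LIM_zero_cancel, rule Lim_null_comparison[OF _ LIMSEQ_inverse_real_of_nat])
      (use TX(2) in \<open>auto intro!: always_eventually less_imp_le\<close>)
  then have T: "(T \<circ> \<phi>) \<longlonglongrightarrow> t0" using s1(2) LIMSEQ_subseq_LIMSEQ by blast
  have "X \<longlonglongrightarrow> x0"
    by (rule LIM_zero_cancel, rule Lim_null_comparison[OF _ LIMSEQ_inverse_real_of_nat])
      (use TX(3) in \<open>auto intro!: always_eventually less_imp_le\<close>)
  then have X: "(X \<circ> \<phi>) \<longlonglongrightarrow> x0" using s1(2) LIMSEQ_subseq_LIMSEQ by blast
  have glim: "(\<lambda>n. g (T (\<phi> n)) (z n)) \<longlonglongrightarrow> g t0 z0" if "z \<longlonglongrightarrow> z0" for z z0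
  proof -
    have "(\<lambda>n. (T (\<phi> n), z n)) \<longlonglongrightarrow> (t0, z0)"
      using T that by (intro tendsto_Pair) (auto simp: o_def)
    from continuous_on_tendsto_compose[OF cont0 this] show ?thesis using t0 TX(1) by simp
  qed
  have "near t0 x0 s1"
    unfolding near_def
  proof
    fix s'
    have "(\<lambda>n. dist (X (\<phi> n)) (g (T (\<phi> n)) (s (\<phi> n)))) \<longlonglongrightarrow> dist x0 (g t0 s1)"
      using X s1(3) by (intro tendsto_dist glim) (auto simp: o_def)
    moreover have "(\<lambda>n. dist (X (\<phi> n)) (g (T (\<phi> n)) s')) \<longlonglongrightarrow> dist x0 (g t0 s')"
      using X by (intro tendsto_dist glim) (auto simp: o_def)
    ultimately show "dist x0 (g t0 s1) \<le> dist x0 (g t0 s')"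
      by (rule LIMSEQ_le) (use s(1) in \<open>auto simp: near_def\<close>)
  qed
  then obtain k :: int where k: "s1 = s0 + of_int k * L" using near_unique[OF t0 tube s0] by blast
  have "\<bar>of_int k * L\<bar> \<le> L / 2" using s1(1) k by auto
  then have "\<bar>real_of_int k\<bar> * L < 1 * L" using L by (simp add: abs_mult)
  then have "\<bar>real_of_int k\<bar> < 1" using L mult_less_cancel_right_pos by blast
  then have "k = 0" by linarith
  then have "(s \<circ> \<phi>) \<longlonglongrightarrow> s0" using s1(3) k by simp
  then obtain n where "dist ((s \<circ> \<phi>) n) s0 < \<epsilon>" using \<open>\<epsilon> > 0\<close> unfolding LIMSEQ_def by blast
  then show False using TX(4) s(1) by (auto simp: dist_real_def)
qed

lemma infdist_close:
  assumes t0: "t0 \<in> {a..b}" and "\<epsilon> > 0"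
  obtains \<delta> where "\<delta> > 0" "\<And>t x. t \<in> {a..b} \<Longrightarrow> \<bar>t - t0\<bar> < \<delta> \<Longrightarrow> norm (x - x0) < \<delta> \<Longrightarrow>
    \<bar>infdist x (range (g t)) - infdist x0 (range (g t0))\<bar> < \<epsilon>"
proof -
  have "uniformly_continuous_on ({a..b} \<times> {0..L}) (\<lambda>(t, s). g t s)"
    by (intro compact_uniformly_continuous compact_Times continuous_on_subset[OF cont0]) auto
  then obtain \<delta> where \<delta>: "\<delta> > 0" "\<And>p p'. p \<in> {a..b} \<times> {0..L} \<Longrightarrow> p' \<in> {a..b} \<times> {0..L} \<Longrightarrow> dist p' p < \<delta> \<Longrightarrow>
      dist ((\<lambda>(t, x). g t x) p') ((\<lambda>(t, x). g t x) p) < \<epsilon> / 2"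
    using \<open>\<epsilon> > 0\<close> unfolding uniformly_continuous_on_def by (metis half_gt_zero)
  show thesis
  proof (rule that)
    show "min \<delta> (\<epsilon> / 2) > 0" using \<delta>(1) \<open>\<epsilon> > 0\<close> by simp
    fix t x assume t: "t \<in> {a..b}" "\<bar>t - t0\<bar> < min \<delta> (\<epsilon> / 2)" "norm (x - x0) < min \<delta> (\<epsilon> / 2)"
    have gg: "dist (g t s) (g t0 s) < \<epsilon> / 2" if "0 \<le> s" "s < 0 + L" for s
      using \<delta>(2)[of "(t0, s)" "(t, s)"] that t t0 by (auto simp: dist_prod_def dist_real_def)
    obtain s where s: "near t x s" "0 \<le> s" "s < 0 + L" using near_exists[OF t(1)] .
    obtain s' where s': "near t0 x0 s'" "0 \<le> s'" "s' < 0 + L" using near_exists[OF t0] .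
    have xx: "dist x x0 < \<epsilon> / 2" using t by (simp add: dist_norm)
    have "infdist x0 (range (g t0)) \<le> dist x0 (g t0 s)" by (intro infdist_le) auto
    also have "\<dots> \<le> dist x0 x + dist x (g t s) + dist (g t s) (g t0 s)"
      by (meson add_mono dist_triangle order_trans order_refl)
    also have "\<dots> < infdist x (range (g t)) + \<epsilon>"
      using s gg[of s] xx by (simp add: near_iff dist_commute)
    finally have 1: "infdist x0 (range (g t0)) < infdist x (range (g t)) + \<epsilon>" .
    have "infdist x (range (g t)) \<le> dist x (g t s')" by (intro infdist_le) auto
    also have "\<dots> \<le> dist x x0 + dist x0 (g t0 s') + dist (g t0 s') (g t s')"
      by (meson add_mono dist_triangle order_trans order_refl)
    also have "\<dots> < infdist x0 (range (g t0)) + \<epsilon>"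
      using s' gg[of s'] xx by (simp add: near_iff dist_commute)
    finally show "\<bar>infdist x (range (g t)) - infdist x0 (range (g t0))\<bar> < \<epsilon>" using 1 by linarith
  qed
qed

text \<open>A path in time and space at once: constant \<theta> serves the spatial derivatives and
  constant \<rho> the time derivative.\<close>

lemma near_path:
  assumes S: "h0 \<in> S" "\<And>h. h \<in> S \<Longrightarrow> \<theta> h \<in> {a..b}" "(\<theta> \<longlongrightarrow> \<theta> h0) (at h0 within S)" "(\<rho> \<longlongrightarrow> \<rho> h0) (at h0 within S)"
    and tube: "infdist (\<rho> h0) (range (g (\<theta> h0))) < 2 * r" and s0: "near (\<theta> h0) (\<rho> h0) s0"
  obtains sf where "sf h0 = s0" "(sf \<longlongrightarrow> s0) (at h0 within S)"
    "\<forall>\<^sub>F h in at h0 within S. near (\<theta> h) (\<rho> h) (sf h) \<and> infdist (\<rho> h) (range (g (\<theta> h))) < 2 * r"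
proof -
  \<comment> \<open>The choice is made once, in the window of half-width L/2 and independently of
    \<epsilon>. Convergence follows because \<open>near_close\<close> provides a nearest parameter
    closer to \<open>s0\<close>, which must coincide with the chosen one.\<close>
  define sf where "sf = (\<lambda>h. if h = h0 then s0 else SOME s. \<bar>s - s0\<bar> < L / 2 \<and> near (\<theta> h) (\<rho> h) s)"
  have close: "\<forall>\<^sub>F h in at h0 within S. h \<in> S \<and> h \<noteq> h0 \<and> \<bar>\<theta> h - \<theta> h0\<bar> < \<delta> \<and> norm (\<rho> h - \<rho> h0) < \<delta>" if "\<delta> > 0" for \<delta>
    using tendstoD[OF S(3) that] tendstoD[OF S(4) that] eventually_at_topological
    by (auto simp: dist_norm eventually_at_filter elim: eventually_elim2)
  obtain \<delta>1 where \<delta>1: "\<delta>1 > 0" "\<And>t x. t \<in> {a..b} \<Longrightarrow> \<bar>t - \<theta> h0\<bar> < \<delta>1 \<Longrightarrow> norm (x - \<rho> h0) < \<delta>1 \<Longrightarrow> \<exists>s. \<bar>s - s0\<bar> < L / 2 \<and> near t x s"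
    using near_close[OF S(2)[OF S(1)] tube s0, of "L / 2"] L by auto
  obtain \<delta>2 where \<delta>2: "\<delta>2 > 0" "\<And>t x. t \<in> {a..b} \<Longrightarrow> \<bar>t - \<theta> h0\<bar> < \<delta>2 \<Longrightarrow> norm (x - \<rho> h0) < \<delta>2 \<Longrightarrow>
    \<bar>infdist x (range (g t)) - infdist (\<rho> h0) (range (g (\<theta> h0)))\<bar> < 2 * r - infdist (\<rho> h0) (range (g (\<theta> h0)))"
    using infdist_close[OF S(2)[OF S(1)], of "2 * r - infdist (\<rho> h0) (range (g (\<theta> h0)))" "\<rho> h0"] tube by auto
  have ev: "\<forall>\<^sub>F h in at h0 within S. h \<in> S \<and> \<bar>sf h - s0\<bar> < L / 2 \<and> near (\<theta> h) (\<rho> h) (sf h) \<and> infdist (\<rho> h) (range (g (\<theta> h))) < 2 * r"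
    using close[OF \<delta>1(1)] close[OF \<delta>2(1)]
  proof eventually_elim
    case (elim h)
    have "\<bar>sf h - s0\<bar> < L / 2 \<and> near (\<theta> h) (\<rho> h) (sf h)"
      using elim(1) someI_ex[OF \<delta>1(2)[of "\<theta> h" "\<rho> h"]] S(2)[of h] unfolding sf_def by auto
    moreover have "infdist (\<rho> h) (range (g (\<theta> h))) < 2 * r"
      using \<delta>2(2)[of "\<theta> h" "\<rho> h"] elim(2) S(2)[of h] by linarith
    ultimately show ?case using elim(1) by blast
  qed
  show thesis
  proof (rule that[of sf])
    show "sf h0 = s0" by (simp add: sf_def)
    show "(sf \<longlongrightarrow> s0) (at h0 within S)"
    proof (rule tendstoI)
      fix \<epsilon> :: real assume "\<epsilon> > 0"
      then have "min \<epsilon> (L / 2) > 0" using L by simp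
      then obtain \<delta> where \<delta>: "\<delta> > 0" "\<And>t x. t \<in> {a..b} \<Longrightarrow> \<bar>t - \<theta> h0\<bar> < \<delta> \<Longrightarrow> norm (x - \<rho> h0) < \<delta> \<Longrightarrow> \<exists>s. \<bar>s - s0\<bar> < min \<epsilon> (L / 2) \<and> near t x s"
        using near_close[OF S(2)[OF S(1)] tube s0] by metis
      show "\<forall>\<^sub>F h in at h0 within S. dist (sf h) s0 < \<epsilon>"
        using ev close[OF \<delta>(1)]
      proof eventually_elim
        case (elim h)
        then obtain s where s: "\<bar>s - s0\<bar> < min \<epsilon> (L / 2)" "near (\<theta> h) (\<rho> h) s" using \<delta>(2)[of "\<theta> h" "\<rho> h"] S(2)[of h] by auto
        obtain k :: int where k: "s = sf h + of_int k * L"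
          using near_unique[of "\<theta> h" "\<rho> h" "sf h" s] elim s(2) S(2)[of h] by blast
        \<comment> \<open>Two parameters within L/2 of \<open>s0\<close> differ by strictly less
          than a period.\<close>
        have "\<bar>of_int k * L\<bar> < L" using k s(1) elim by linarith
        then have "\<bar>real_of_int k\<bar> * L < 1 * L" using L by (simp add: abs_mult)
        then have "\<bar>real_of_int k\<bar> < 1" using L mult_less_cancel_right_pos by blast
        then have "k = 0" by linarith
        then show ?case using k s(1) by (simp add: dist_real_def)
      qed
    qed
    show "\<forall>\<^sub>F h in at h0 within S. near (\<theta> h) (\<rho> h) (sf h) \<and> infdist (\<rho> h) (range (g (\<theta> h))) < 2 * r"
      using ev by (rule eventually_mono) auto
  qed
qed

end

section \<open>The localized tangent field and its derivatives\<close>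

lemma dist_Pair_le: "dist (p, q) (p', q') \<le> dist p p' + dist q q'"
  by (simp add: dist_Pair_Pair sqrt_sum_squares_le_sum)

lemma bounded_bilinear_cross3: "bounded_bilinear cross3"
  using bilinear_cross bilinear_conv_bounded_bilinear by blast

lemmas cross3_derivative = bounded_bilinear.has_vector_derivative[OF bounded_bilinear_cross3]

lemma inner_real_derivative:
  assumes "(f has_vector_derivative f') (at x within S)" "(h has_vector_derivative h') (at x within S)"
  shows "((\<lambda>x. f x \<bullet> h x) has_real_derivative f x \<bullet> h' + f' \<bullet> h x) (at x within S)"
  using bounded_bilinear.has_vector_derivative[OF bounded_bilinear_inner assms]
  by (simp add: has_real_derivative_iff_has_vector_derivative)

lemma chain_real_vector:
  assumes "(sf has_real_derivative \<sigma>) (at x)" "(f has_vector_derivative f') (at (sf x))"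
  shows "((\<lambda>x. f (sf x)) has_vector_derivative \<sigma> *\<^sub>R f') (at x)"
  using vector_diff_chain_at[of sf \<sigma> x f f'] assms
  by (simp add: has_real_derivative_iff_has_vector_derivative o_def)

context curve_family
begin

definition near_param :: "real \<Rightarrow> real^3 \<Rightarrow> real" where
  "near_param t x = (SOME s. near t x s)"

definition lift :: "(real \<Rightarrow> real^3 \<Rightarrow> real \<Rightarrow> real^3) \<Rightarrow> real \<Rightarrow> real^3 \<Rightarrow> real^3" where
  "lift P t x = (if infdist x (range (g t)) < 2 * r then P t x (near_param t x) else 0)"

text \<open>Periodicity makes the lifted field independent of the chosen nearest parameter.
  Vanishing from distance r on, while nearest points are unique up to 2r, leaves a collar in which
  the formula and the zero field agree, so the two can be glued without loss of regularity.\<close>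

definition admissible :: "(real \<Rightarrow> real^3 \<Rightarrow> real \<Rightarrow> real^3) \<Rightarrow> bool" where
  "admissible P \<longleftrightarrow> (\<forall>t\<in>{a..b}. \<forall>x s k. P t x (s + of_int k * L) = P t x s)
     \<and> (\<forall>t x s. r \<le> norm (x - g t s) \<longrightarrow> P t x s = 0)"

text \<open>Half the second derivative in \<open>s\<close> of the squared distance, and the Jacobian
  factor of tubular coordinates. It is positive at nearest points inside the tube, which makes the
  nearest parameter differentiable.\<close>

definition jac :: "real \<Rightarrow> real^3 \<Rightarrow> real \<Rightarrow> real" where
  "jac t x s = 1 - (x - g t s) \<bullet> g2 t s"

lemma near_param: "t \<in> {a..b} \<Longrightarrow> near t x (near_param t x)"
  unfolding near_param_def by (rule someI_ex) (metis near_exists)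

lemma norm_near: "near t x s \<Longrightarrow> norm (x - g t s) = infdist x (range (g t))"
  by (simp add: near_iff dist_norm)

lemma lift_eq:
  assumes "t \<in> {a..b}" "infdist x (range (g t)) < 2 * r" "near t x s" "admissible P"
  shows "lift P t x = P t x s"
proof -
  obtain k :: int where "near_param t x = s + of_int k * L"
    using near_unique[OF assms(1,2,3) near_param[OF assms(1)]] .
  then show ?thesis using assms by (simp add: lift_def admissible_def)
qed

lemma lift_zero:
  assumes "t \<in> {a..b}" "r \<le> infdist x (range (g t))" "admissible P"
  shows "lift P t x = 0"
  using norm_near[OF near_param[OF assms(1), of x]] assms by (auto simp: lift_def admissible_def)

lemma jac_pos:
  assumes "t \<in> {a..b}" "infdist x (range (g t)) < 2 * r" "near t x s"
  shows "jac t x s > 0"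
proof -
  have "\<bar>(x - g t s) \<bullet> g2 t s\<bar> \<le> infdist x (range (g t)) * (1 / (2 * r))"
    using curv[OF assms(1)] norm_near[OF assms(3)] by (intro abs_inner_le) auto
  also have "\<dots> < 1" using assms(2) r by simp
  finally show ?thesis by (simp add: jac_def)
qed

definition dom0 :: "(real \<times> (real^3) \<times> real) set" where
  "dom0 = {(t, x, s). t \<in> {a..b} \<and> jac t x s \<noteq> 0}"

text \<open>Inside the tube, nearby points have a nearest parameter close to \<open>s0\<close>, so
  continuity of \<open>P\<close> in all variables is enough. Outside, a whole neighbourhood keeps
  distance at least r and the field vanishes on it.\<close>

lemma lift_continuous:
  assumes P: "admissible P" and cont: "continuous_on dom0 (\<lambda>(t, x, s). P t x s)"
  shows "continuous_on ({a..b} \<times> UNIV) (\<lambda>(t, x). lift P t x)"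
  unfolding continuous_on_iff
proof (intro ballI allI impI)
  fix p :: "real \<times> (real^3)" and e :: real
  assume p: "p \<in> {a..b} \<times> UNIV" and "0 < e"
  obtain t0 x0 where [simp]: "p = (t0, x0)" by (cases p)
  have t0: "t0 \<in> {a..b}" using p by simp
  show "\<exists>d>0. \<forall>x'\<in>{a..b} \<times> UNIV. dist x' p < d \<longrightarrow> dist ((\<lambda>(t, x). lift P t x) x') ((\<lambda>(t, x). lift P t x) p) < e"
  proof (cases "infdist x0 (range (g t0)) < 2 * r")
    case True
    define s0 where "s0 = near_param t0 x0"
    have s0: "near t0 x0 s0" unfolding s0_def by (rule near_param[OF t0])
    have "(t0, x0, s0) \<in> dom0" using jac_pos[OF t0 True s0] t0 by (simp add: dom0_def)
    then obtain d where d: "d > 0" "\<And>q. q \<in> dom0 \<Longrightarrow> dist q (t0, x0, s0) < d \<Longrightarrow> dist ((\<lambda>(t, x, s). P t x s) q) (P t0 x0 s0) < e"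
      using cont \<open>0 < e\<close> unfolding continuous_on_iff by fastforce
    obtain \<delta>1 where \<delta>1: "\<delta>1 > 0" "\<And>t x. t \<in> {a..b} \<Longrightarrow> \<bar>t - t0\<bar> < \<delta>1 \<Longrightarrow> norm (x - x0) < \<delta>1 \<Longrightarrow> \<exists>s. \<bar>s - s0\<bar> < d / 3 \<and> near t x s"
      using near_close[OF t0 True s0, of "d / 3"] d(1) by auto
    obtain \<delta>2 where \<delta>2: "\<delta>2 > 0" "\<And>t x. t \<in> {a..b} \<Longrightarrow> \<bar>t - t0\<bar> < \<delta>2 \<Longrightarrow> norm (x - x0) < \<delta>2 \<Longrightarrow>
      \<bar>infdist x (range (g t)) - infdist x0 (range (g t0))\<bar> < 2 * r - infdist x0 (range (g t0))"
      using infdist_close[OF t0, of "2 * r - infdist x0 (range (g t0))" x0] True by auto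
    define \<delta> where "\<delta> = min (d / 3) (min \<delta>1 \<delta>2)"
    have "dist (lift P t x) (lift P t0 x0) < e" if t: "t \<in> {a..b}" and "dist (t, x) (t0, x0) < \<delta>" for t x
    proof -
      have tx: "\<bar>t - t0\<bar> < \<delta>" "norm (x - x0) < \<delta>"
        using dist_fst_le[of "(t, x)" "(t0, x0)"] dist_snd_le[of "(t, x)" "(t0, x0)"] that(2) by (auto simp: dist_norm)
      obtain s where s: "\<bar>s - s0\<bar> < d / 3" "near t x s" using \<delta>1(2)[OF t] tx unfolding \<delta>_def by auto
      have tube: "infdist x (range (g t)) < 2 * r" using \<delta>2(2)[OF t, of x] tx unfolding \<delta>_def by linarith
      have "(t, x, s) \<in> dom0" using jac_pos[OF t tube s(2)] t by (simp add: dom0_def)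
      moreover have "dist (t, x, s) (t0, x0, s0) < d"
        using dist_Pair_le[of t "(x, s)" t0 "(x0, s0)"] dist_Pair_le[of x s x0 s0] tx s(1)
        by (simp add: \<delta>_def dist_norm)
      ultimately show ?thesis
        using d(2) lift_eq[OF t tube s(2) P] lift_eq[OF t0 True s0 P] by fastforce
    qed
    moreover have "\<delta> > 0" using d(1) \<delta>1(1) \<delta>2(1) by (simp add: \<delta>_def)
    ultimately show ?thesis by (intro exI[of _ \<delta>]) auto
  next
    case False
    \<comment> \<open>At distance 2r or more, a change of the distance below r stays in the region
      where \<open>P\<close> vanishes.\<close>
    obtain \<delta> where \<delta>: "\<delta> > 0" "\<And>t x. t \<in> {a..b} \<Longrightarrow> \<bar>t - t0\<bar> < \<delta> \<Longrightarrow> norm (x - x0) < \<delta> \<Longrightarrow>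
      \<bar>infdist x (range (g t)) - infdist x0 (range (g t0))\<bar> < r"
      using infdist_close[OF t0 r, of x0] by auto
    have "lift P t x = 0" if t: "t \<in> {a..b}" and "dist (t, x) (t0, x0) < \<delta>" for t x
    proof -
      have "\<bar>t - t0\<bar> < \<delta>" "norm (x - x0) < \<delta>"
        using dist_fst_le[of "(t, x)" "(t0, x0)"] dist_snd_le[of "(t, x)" "(t0, x0)"] that(2) by (auto simp: dist_norm)
      then have "r \<le> infdist x (range (g t))" using \<delta>(2)[OF t, of x] False by linarith
      then show ?thesis by (rule lift_zero[OF t _ P])
    qed
    moreover have "lift P t0 x0 = 0" using False by (simp add: lift_def)
    ultimately show ?thesis using \<delta>(1) \<open>0 < e\<close> by (intro exI[of _ \<delta>]) auto
  qed
qed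

text \<open>The same gluing as for continuity reduces differentiation of the field to
  differentiation of the formula along one branch of nearest parameters, which is what
  \<open>step\<close> asks for.\<close>

lemma lift_derivative:
  assumes S: "h0 \<in> S" "\<And>h. h \<in> S \<Longrightarrow> \<theta> h \<in> {a..b}" "(\<theta> \<longlongrightarrow> \<theta> h0) (at h0 within S)" "(\<rho> \<longlongrightarrow> \<rho> h0) (at h0 within S)"
    and P: "admissible P" "admissible P'"
    and step: "\<And>s0 sf. infdist (\<rho> h0) (range (g (\<theta> h0))) < 2 * r \<Longrightarrow> near (\<theta> h0) (\<rho> h0) s0 \<Longrightarrow> sf h0 = s0 \<Longrightarrow>
      (sf \<longlongrightarrow> s0) (at h0 within S) \<Longrightarrow> \<forall>\<^sub>F h in at h0 within S. near (\<theta> h) (\<rho> h) (sf h) \<Longrightarrow>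
      ((\<lambda>h. P (\<theta> h) (\<rho> h) (sf h)) has_vector_derivative P' (\<theta> h0) (\<rho> h0) s0) (at h0 within S)"
  shows "((\<lambda>h. lift P (\<theta> h) (\<rho> h)) has_vector_derivative lift P' (\<theta> h0) (\<rho> h0)) (at h0 within S)"
proof (cases "infdist (\<rho> h0) (range (g (\<theta> h0))) < 2 * r")
  case True
  define s0 where "s0 = near_param (\<theta> h0) (\<rho> h0)"
  have s0: "near (\<theta> h0) (\<rho> h0) s0" unfolding s0_def by (rule near_param[OF S(2)[OF S(1)]])
  obtain sf where sf: "sf h0 = s0" "(sf \<longlongrightarrow> s0) (at h0 within S)"
    and ev: "\<forall>\<^sub>F h in at h0 within S. near (\<theta> h) (\<rho> h) (sf h) \<and> infdist (\<rho> h) (range (g (\<theta> h))) < 2 * r"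
    using near_path[OF S True s0] by blast
  have "\<forall>\<^sub>F h in at h0 within S. near (\<theta> h) (\<rho> h) (sf h)"
    using ev by (rule eventually_mono) auto
  from step[OF True s0 sf this]
  have "((\<lambda>h. P (\<theta> h) (\<rho> h) (sf h)) has_derivative (\<lambda>h. h *\<^sub>R P' (\<theta> h0) (\<rho> h0) s0)) (at h0 within S)"
    by (simp add: has_vector_derivative_def)
  moreover have "\<forall>\<^sub>F h in at h0 within S. h \<in> S" by (auto simp: eventually_at_filter)
  then have "\<forall>\<^sub>F h in at h0 within S. P (\<theta> h) (\<rho> h) (sf h) = lift P (\<theta> h) (\<rho> h)"
    using ev by eventually_elim (use lift_eq[OF S(2) _ _ P(1)] in auto)
  moreover have "P (\<theta> h0) (\<rho> h0) (sf h0) = lift P (\<theta> h0) (\<rho> h0)"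
    using lift_eq[OF S(2)[OF S(1)] True s0 P(1)] sf(1) by simp
  ultimately have "((\<lambda>h. lift P (\<theta> h) (\<rho> h)) has_derivative (\<lambda>h. h *\<^sub>R P' (\<theta> h0) (\<rho> h0) s0)) (at h0 within S)"
    using S(1) by (rule has_derivative_transform_eventually)
  then show ?thesis
    using lift_eq[OF S(2)[OF S(1)] True s0 P(2)] by (simp add: has_vector_derivative_def)
next
  case False
  obtain \<delta> where \<delta>: "\<delta> > 0" "\<And>t x. t \<in> {a..b} \<Longrightarrow> \<bar>t - \<theta> h0\<bar> < \<delta> \<Longrightarrow> norm (x - \<rho> h0) < \<delta> \<Longrightarrow>
      \<bar>infdist x (range (g t)) - infdist (\<rho> h0) (range (g (\<theta> h0)))\<bar> < r"
    using infdist_close[OF S(2)[OF S(1)] r, of "\<rho> h0"] by auto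
  have "\<forall>\<^sub>F h in at h0 within S. h \<in> S" by (auto simp: eventually_at_filter)
  then have "\<forall>\<^sub>F h in at h0 within S. 0 = lift P (\<theta> h) (\<rho> h)"
    using tendstoD[OF S(3) \<delta>(1)] tendstoD[OF S(4) \<delta>(1)]
  proof eventually_elim
    case (elim h)
    then have "r \<le> infdist (\<rho> h) (range (g (\<theta> h)))"
      using \<delta>(2)[of "\<theta> h" "\<rho> h"] S(2)[of h] False by (auto simp: dist_norm)
    then show ?case using lift_zero[OF S(2)[OF elim(1)] _ P(1)] by simp
  qed
  moreover have "0 = lift P (\<theta> h0) (\<rho> h0)" using False by (simp add: lift_def)
  moreover have "((\<lambda>h. 0) has_derivative (\<lambda>h. h *\<^sub>R 0)) (at h0 within S)" by simp
  ultimately have "((\<lambda>h. lift P (\<theta> h) (\<rho> h)) has_derivative (\<lambda>h. h *\<^sub>R 0)) (at h0 within S)"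
    using S(1) has_derivative_transform_eventually[where f="\<lambda>h. 0" and g="\<lambda>h. lift P (\<theta> h) (\<rho> h)"] by blast
  then show ?thesis using False by (simp add: has_vector_derivative_def lift_def)
qed

section \<open>Explicit formulas for the field, its curl and their derivatives\<close>

abbreviation sq :: "real \<Rightarrow> real^3 \<Rightarrow> real \<Rightarrow> real" where
  "sq t x s \<equiv> (x - g t s) \<bullet> (x - g t s)"

text \<open>The fields are functions of time, space and a parameter \<^term>\<open>s\<close> of the nearest curve point, so that
  derivatives reduce to the implicit derivative of that parameter: \<open>fXt\<close> is the time derivative of \<open>fX\<close>,
  \<open>fXd v\<close> its derivative in direction \<open>v\<close>, \<open>fZ\<close> its curl and \<open>fZd v\<close> the derivative of the curl.\<close>

definition fX :: "real \<Rightarrow> real^3 \<Rightarrow> real \<Rightarrow> real^3" where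
  "fX t x s = profile r (sq t x s) *\<^sub>R g1 t s"

definition fXt :: "real \<Rightarrow> real^3 \<Rightarrow> real \<Rightarrow> real^3" where
  "fXt t x s = (profile1 r (sq t x s) * (- 2 * ((x - g t s) \<bullet> cross3 (g1 t s) (g2 t s)))) *\<^sub>R g1 t s
    + profile r (sq t x s) *\<^sub>R (cross3 (g1 t s) (g3 t s) + (((x - g t s) \<bullet> cross3 (g1 t s) (g3 t s)) / jac t x s) *\<^sub>R g2 t s)"

definition fXd :: "real^3 \<Rightarrow> real \<Rightarrow> real^3 \<Rightarrow> real \<Rightarrow> real^3" where
  "fXd v t x s = (2 * profile1 r (sq t x s) * ((x - g t s) \<bullet> v)) *\<^sub>R g1 t s
    + (profile r (sq t x s) * ((v \<bullet> g1 t s) / jac t x s)) *\<^sub>R g2 t s"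

definition fZ :: "real \<Rightarrow> real^3 \<Rightarrow> real \<Rightarrow> real^3" where
  "fZ t x s = (2 * profile1 r (sq t x s)) *\<^sub>R cross3 (x - g t s) (g1 t s)
    + (profile r (sq t x s) / jac t x s) *\<^sub>R cross3 (g1 t s) (g2 t s)"

definition fZd :: "real^3 \<Rightarrow> real \<Rightarrow> real^3 \<Rightarrow> real \<Rightarrow> real^3" where
  "fZd v t x s =
    (4 * profile2 r (sq t x s) * ((x - g t s) \<bullet> v)) *\<^sub>R cross3 (x - g t s) (g1 t s)
    + (2 * profile1 r (sq t x s)) *\<^sub>R (cross3 v (g1 t s) + ((v \<bullet> g1 t s) / jac t x s) *\<^sub>R cross3 (x - g t s) (g2 t s))
    + (2 * profile1 r (sq t x s) * ((x - g t s) \<bullet> v) / jac t x s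
       + profile r (sq t x s) * (v \<bullet> g2 t s + ((x - g t s) \<bullet> g3 t s) * ((v \<bullet> g1 t s) / jac t x s)) / (jac t x s)\<^sup>2) *\<^sub>R cross3 (g1 t s) (g2 t s)
    + (profile r (sq t x s) / jac t x s * ((v \<bullet> g1 t s) / jac t x s)) *\<^sub>R cross3 (g1 t s) (g3 t s)"

lemma profile_far: "r \<le> norm (x - g t s) \<Longrightarrow> profile r (sq t x s) = 0 \<and> profile1 r (sq t x s) = 0 \<and> profile2 r (sq t x s) = 0"
  by (rule profile_zero[OF r]) (use r in \<open>auto simp: dot_square_norm intro: power_mono\<close>)

lemma admissible_fields: "admissible fX" "admissible fXt" "admissible (fXd v)" "admissible fZ" "admissible (fZd v)"
  unfolding admissible_def using profile_far
  by (auto simp: fX_def fXt_def fXd_def fZ_def fZd_def jac_def shift)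

lemma continuous_dom0_curve:
  "continuous_on dom0 (\<lambda>p. g (fst p) (snd (snd p)))" "continuous_on dom0 (\<lambda>p. g1 (fst p) (snd (snd p)))"
  "continuous_on dom0 (\<lambda>p. g2 (fst p) (snd (snd p)))" "continuous_on dom0 (\<lambda>p. g3 (fst p) (snd (snd p)))"
proof -
  have c: "continuous_on dom0 (\<lambda>p. (fst p, snd (snd p)))" by (intro continuous_intros)
  have s: "(\<lambda>p. (fst p, snd (snd p))) ` dom0 \<subseteq> {a..b} \<times> UNIV" by (auto simp: dom0_def)
  show "continuous_on dom0 (\<lambda>p. g (fst p) (snd (snd p)))" "continuous_on dom0 (\<lambda>p. g1 (fst p) (snd (snd p)))"
  "continuous_on dom0 (\<lambda>p. g2 (fst p) (snd (snd p)))" "continuous_on dom0 (\<lambda>p. g3 (fst p) (snd (snd p)))"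
    using continuous_on_compose2[OF cont0 c s] continuous_on_compose2[OF cont1 c s]
      continuous_on_compose2[OF cont2 c s] continuous_on_compose2[OF cont3 c s] by simp_all
qed

lemma jac_nonzero_dom0: "p \<in> dom0 \<Longrightarrow> jac (fst p) (fst (snd p)) (snd (snd p)) \<noteq> 0"
  by (auto simp: dom0_def)

lemma continuous_dom0_jac: "continuous_on dom0 (\<lambda>p. jac (fst p) (fst (snd p)) (snd (snd p)))"
  unfolding jac_def by (intro continuous_intros continuous_dom0_curve)

lemma continuous_dom0_profile:
  "continuous_on dom0 (\<lambda>p. profile r (sq (fst p) (fst (snd p)) (snd (snd p))))"
  "continuous_on dom0 (\<lambda>p. profile1 r (sq (fst p) (fst (snd p)) (snd (snd p))))"
  "continuous_on dom0 (\<lambda>p. profile2 r (sq (fst p) (fst (snd p)) (snd (snd p))))"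
proof -
  have c: "continuous_on dom0 (\<lambda>p. sq (fst p) (fst (snd p)) (snd (snd p)))"
    by (intro continuous_intros continuous_dom0_curve)
  show "continuous_on dom0 (\<lambda>p. profile r (sq (fst p) (fst (snd p)) (snd (snd p))))"
  "continuous_on dom0 (\<lambda>p. profile1 r (sq (fst p) (fst (snd p)) (snd (snd p))))"
  "continuous_on dom0 (\<lambda>p. profile2 r (sq (fst p) (fst (snd p)) (snd (snd p))))"
    by (rule continuous_on_compose2[OF profile_continuous(1) c] continuous_on_compose2[OF profile_continuous(2) c]
      continuous_on_compose2[OF profile_continuous(3) c], rule order_refl)+
qed

lemma continuous_fields:
  "continuous_on dom0 (\<lambda>(t, x, s). fX t x s)" "continuous_on dom0 (\<lambda>(t, x, s). fXt t x s)"
  "continuous_on dom0 (\<lambda>(t, x, s). fXd v t x s)" "continuous_on dom0 (\<lambda>(t, x, s). fZd v t x s)"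
  unfolding fX_def fXt_def fXd_def fZd_def case_prod_unfold
  by (intro continuous_intros continuous_on_cross continuous_dom0_curve continuous_dom0_profile continuous_dom0_jac
      ballI jac_nonzero_dom0 power_not_zero; assumption?)+

text \<open>Implicit differentiation of the orthogonality relation between
  \<open>x + h v - g\<close> and the tangent \<open>g1\<close>, whose derivative in \<open>s\<close>
  is minus the Jacobian.\<close>

lemma spatial_param:
  assumes t: "t \<in> {a..b}" and tube: "infdist x (range (g t)) < 2 * r" and s0: "near t x s0"
    and sf: "sf 0 = s0" "(sf \<longlongrightarrow> s0) (at 0)" "\<forall>\<^sub>F h in at 0. near t (x + h *\<^sub>R v) (sf h)"
  shows "(sf has_real_derivative (v \<bullet> g1 t s0) / jac t x s0) (at 0)"
proof -
  define \<Phi> where "\<Phi> = (\<lambda>h s. (x + h *\<^sub>R v - g t s) \<bullet> g1 t s)"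
  define \<Phi>s where "\<Phi>s = (\<lambda>h s. (x + h *\<^sub>R v - g t s) \<bullet> g2 t s - 1)"
  have "(sf has_real_derivative - (v \<bullet> g1 t s0) / \<Phi>s 0 s0) (at 0 within UNIV)"
  proof (rule implicit_function_derivative[where \<Phi>=\<Phi> and \<Phi>s=\<Phi>s and ?s0.0=s0])
    show "\<forall>\<^sub>F h in at 0. \<Phi> h (sf h) = 0"
      using sf(3) by (rule eventually_mono) (simp add: \<Phi>_def near_orthogonal[OF t])
    show "\<Phi> 0 s0 = 0" using near_orthogonal[OF t s0] by (simp add: \<Phi>_def)
    show "((\<lambda>h. \<Phi> h s0) has_real_derivative v \<bullet> g1 t s0) (at 0)"
    proof -
      have "((\<lambda>h. x + h *\<^sub>R v - g t s0) has_vector_derivative v) (at 0)"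
        by (auto intro!: derivative_eq_intros)
      from inner_real_derivative[OF this has_vector_derivative_const] show ?thesis by (simp add: \<Phi>_def)
    qed
    show "(\<Phi> h has_real_derivative \<Phi>s h s) (at s)" for h s
    proof -
      have "((\<lambda>s. x + h *\<^sub>R v - g t s) has_vector_derivative - g1 t s) (at s)"
        using ds0[OF t] by (auto intro!: derivative_eq_intros)
      from inner_real_derivative[OF this ds1[OF t]] show ?thesis
        using unit[OF t, of s] by (simp add: \<Phi>_def \<Phi>s_def dot_square_norm)
    qed
    have "continuous_on UNIV (\<lambda>(h, s). \<Phi>s h s)"
      unfolding \<Phi>s_def case_prod_unfold
      by (intro continuous_intros continuous_on_compose2[OF curve_cont[OF t], of UNIV]
          continuous_on_compose2[OF slice_continuous[OF cont2 t]]) auto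
    then show "continuous (at (0, s0) within UNIV \<times> UNIV) (\<lambda>(h, s). \<Phi>s h s)"
      by (simp add: continuous_on_eq_continuous_within)
    show "\<Phi>s 0 s0 \<noteq> 0" using jac_pos[OF t tube s0] by (simp add: \<Phi>s_def jac_def)
  qed (use sf in auto)
  moreover have "\<Phi>s 0 s0 = - jac t x s0" by (simp add: \<Phi>s_def jac_def)
  ultimately show ?thesis by simp
qed

text \<open>The binormal velocity is orthogonal to the tangent, so the motion of the curve drops out
  of the differentiated orthogonality relation and only the rotation of the tangent moves the
  nearest parameter.\<close>

lemma time_param:
  assumes t: "t \<in> {a..b}" and tube: "infdist x (range (g t)) < 2 * r" and s0: "near t x s0"
    and sf: "sf t = s0" "(sf \<longlongrightarrow> s0) (at t within {a..b})" "\<forall>\<^sub>F h in at t within {a..b}. near h x (sf h)"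
  shows "(sf has_real_derivative ((x - g t s0) \<bullet> cross3 (g1 t s0) (g3 t s0)) / jac t x s0) (at t within {a..b})"
proof -
  define \<Phi> where "\<Phi> = (\<lambda>h s. (x - g h s) \<bullet> g1 h s)"
  define \<Phi>s where "\<Phi>s = (\<lambda>h s. (x - g h s) \<bullet> g2 h s - 1)"
  have inJ: "\<forall>\<^sub>F h in at t within {a..b}. h \<in> {a..b}" by (auto simp: eventually_at_filter)
  have "(sf has_real_derivative - ((x - g t s0) \<bullet> cross3 (g1 t s0) (g3 t s0)) / \<Phi>s t s0) (at t within {a..b})"
  proof (rule implicit_function_derivative[where \<Phi>=\<Phi> and \<Phi>s=\<Phi>s and ?s0.0=s0])
    show "\<forall>\<^sub>F h in at t within {a..b}. \<Phi> h (sf h) = 0"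
      using sf(3) inJ by eventually_elim (simp add: \<Phi>_def near_orthogonal)
    show "\<Phi> t s0 = 0" using near_orthogonal[OF t s0] by (simp add: \<Phi>_def)
    show "((\<lambda>h. \<Phi> h s0) has_real_derivative (x - g t s0) \<bullet> cross3 (g1 t s0) (g3 t s0)) (at t within {a..b})"
    proof -
      have "((\<lambda>h. x - g h s0) has_vector_derivative - cross3 (g1 t s0) (g2 t s0)) (at t within {a..b})"
        using dt0[OF t] by (auto intro!: derivative_eq_intros)
      from inner_real_derivative[OF this dt1[OF t, of s0]] show ?thesis by (simp add: \<Phi>_def dot_cross_self)
    qed
    show "(\<Phi> h has_real_derivative \<Phi>s h s) (at s)" if h: "h \<in> {a..b}" for h s
    proof -
      have "((\<lambda>s. x - g h s) has_vector_derivative - g1 h s) (at s)"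
        using ds0[OF h] by (auto intro!: derivative_eq_intros)
      from inner_real_derivative[OF this ds1[OF h]] show ?thesis
        using unit[OF h, of s] by (simp add: \<Phi>_def \<Phi>s_def dot_square_norm)
    qed
    have "continuous_on ({a..b} \<times> UNIV) (\<lambda>(h, s). \<Phi>s h s)"
      using cont0 cont2 unfolding \<Phi>s_def case_prod_unfold by (intro continuous_intros)
    then show "continuous (at (t, s0) within {a..b} \<times> UNIV) (\<lambda>(h, s). \<Phi>s h s)"
      using t by (simp add: continuous_on_eq_continuous_within)
    show "\<Phi>s t s0 \<noteq> 0" using jac_pos[OF t tube s0] by (simp add: \<Phi>s_def jac_def)
  qed (use sf in auto)
  moreover have "\<Phi>s t s0 = - jac t x s0" by (simp add: \<Phi>s_def jac_def)
  ultimately show ?thesis by simp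
qed

lemma g12_orthogonal:
  assumes "t \<in> {a..b}"
  shows "g1 t s \<bullet> g2 t s = 0"
proof -
  have "((\<lambda>s. g1 t s \<bullet> g1 t s) has_real_derivative 2 * (g1 t s \<bullet> g2 t s)) (at s)"
    using inner_real_derivative[OF ds1[OF assms] ds1[OF assms]] by (simp add: inner_commute)
  moreover have "(\<lambda>s. g1 t s \<bullet> g1 t s) = (\<lambda>s. 1)"
    using unit[OF assms] by (auto simp: dot_square_norm)
  ultimately have "2 * (g1 t s \<bullet> g2 t s) = 0" using DERIV_unique[OF _ DERIV_const] by fastforce
  then show ?thesis by simp
qed

lemma spatial_derivatives:
  assumes t: "t \<in> {a..b}" and tube: "infdist x (range (g t)) < 2 * r" and s0: "near t x s0"
    and sf: "sf 0 = s0" "(sf \<longlongrightarrow> s0) (at 0)" "\<forall>\<^sub>F h in at 0. near t (x + h *\<^sub>R v) (sf h)"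
  shows "((\<lambda>h. fX t (x + h *\<^sub>R v) (sf h)) has_vector_derivative fXd v t x s0) (at 0)"
    "((\<lambda>h. fZ t (x + h *\<^sub>R v) (sf h)) has_vector_derivative fZd v t x s0) (at 0)"
proof -
  define \<sigma> where "\<sigma> = (v \<bullet> g1 t s0) / jac t x s0"
  define u where "u = x - g t s0"
  have Ds: "(sf has_real_derivative \<sigma>) (at 0)"
    unfolding \<sigma>_def by (rule spatial_param[OF assms])
  have Dg: "((\<lambda>h. g t (sf h)) has_vector_derivative \<sigma> *\<^sub>R g1 t s0) (at 0)"
    "((\<lambda>h. g1 t (sf h)) has_vector_derivative \<sigma> *\<^sub>R g2 t s0) (at 0)"
    "((\<lambda>h. g2 t (sf h)) has_vector_derivative \<sigma> *\<^sub>R g3 t s0) (at 0)"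
    by (rule chain_real_vector[OF Ds], simp add: sf(1) ds0[OF t] ds1[OF t] ds2[OF t])+
  have Du: "((\<lambda>h. x + h *\<^sub>R v - g t (sf h)) has_vector_derivative v - \<sigma> *\<^sub>R g1 t s0) (at 0)"
    by (rule has_vector_derivative_diff[OF _ Dg(1)]) (auto intro!: derivative_eq_intros)
  have og: "u \<bullet> g1 t s0 = 0" "g1 t s0 \<bullet> g2 t s0 = 0"
    using near_orthogonal[OF t s0] g12_orthogonal[OF t] by (auto simp: u_def)
  \<comment> \<open>Since \<open>u\<close> is orthogonal to the tangent, the motion of the nearest
    parameter does not contribute to the squared distance at first order.\<close>
  have Dsq: "((\<lambda>h. sq t (x + h *\<^sub>R v) (sf h)) has_real_derivative 2 * (u \<bullet> v)) (at 0)"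
    using inner_real_derivative[OF Du Du] og by (simp add: sf(1) u_def[symmetric] inner_diff_left inner_diff_right inner_commute)
  have Dc: "((\<lambda>h. profile r (sq t (x + h *\<^sub>R v) (sf h))) has_real_derivative profile1 r (u \<bullet> u) * (2 * (u \<bullet> v))) (at 0)"
    "((\<lambda>h. profile1 r (sq t (x + h *\<^sub>R v) (sf h))) has_real_derivative profile2 r (u \<bullet> u) * (2 * (u \<bullet> v))) (at 0)"
    using DERIV_chain2[OF profile_derivative(1) Dsq] DERIV_chain2[OF profile_derivative(2) Dsq] by (simp_all add: sf(1) u_def)
  have Dcc: "((\<lambda>h. jac t (x + h *\<^sub>R v) (sf h)) has_real_derivative - (v \<bullet> g2 t s0 + (u \<bullet> g3 t s0) * \<sigma>)) (at 0)"
    using DERIV_diff[OF DERIV_const inner_real_derivative[OF Du Dg(3)], of 1] og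
    by (simp add: jac_def sf(1) u_def[symmetric] inner_diff_left algebra_simps)
  have c0: "jac t x s0 \<noteq> 0" using jac_pos[OF t tube s0] by simp
  have "((\<lambda>h. profile r (sq t (x + h *\<^sub>R v) (sf h)) *\<^sub>R g1 t (sf h)) has_vector_derivative
     profile r (u \<bullet> u) *\<^sub>R (\<sigma> *\<^sub>R g2 t s0) + (profile1 r (u \<bullet> u) * (2 * (u \<bullet> v))) *\<^sub>R g1 t s0) (at 0)"
    using has_vector_derivative_scaleR[OF Dc(1) Dg(2)] by (simp add: sf(1) u_def)
  then show "((\<lambda>h. fX t (x + h *\<^sub>R v) (sf h)) has_vector_derivative fXd v t x s0) (at 0)"
    by (simp add: fX_def fXd_def u_def \<sigma>_def mult.assoc add.commute mult.left_commute)
  have D1: "((\<lambda>h. (2 * profile1 r (sq t (x + h *\<^sub>R v) (sf h))) *\<^sub>R cross3 (x + h *\<^sub>R v - g t (sf h)) (g1 t (sf h))) has_vector_derivative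
     (2 * profile1 r (u \<bullet> u)) *\<^sub>R (cross3 u (\<sigma> *\<^sub>R g2 t s0) + cross3 (v - \<sigma> *\<^sub>R g1 t s0) (g1 t s0))
     + (2 * (profile2 r (u \<bullet> u) * (2 * (u \<bullet> v)))) *\<^sub>R cross3 u (g1 t s0)) (at 0)"
    using has_vector_derivative_scaleR[OF DERIV_cmult[OF Dc(2), of 2] cross3_derivative[OF Du Dg(2)]] by (simp add: sf(1) u_def)
  have "((\<lambda>h. profile r (sq t (x + h *\<^sub>R v) (sf h)) / jac t (x + h *\<^sub>R v) (sf h)) has_real_derivative
      (profile1 r (u \<bullet> u) * (2 * (u \<bullet> v)) * jac t x s0 - profile r (u \<bullet> u) * - (v \<bullet> g2 t s0 + (u \<bullet> g3 t s0) * \<sigma>)) / (jac t x s0 * jac t x s0)) (at 0)"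
    using DERIV_divide[OF Dc(1) Dcc] c0 by (simp add: sf(1) u_def)
  then have Dq: "((\<lambda>h. profile r (sq t (x + h *\<^sub>R v) (sf h)) / jac t (x + h *\<^sub>R v) (sf h)) has_real_derivative
      2 * profile1 r (u \<bullet> u) * (u \<bullet> v) / jac t x s0 + profile r (u \<bullet> u) * (v \<bullet> g2 t s0 + (u \<bullet> g3 t s0) * \<sigma>) / (jac t x s0)\<^sup>2) (at 0)"
    by (rule DERIV_cong) (use c0 in \<open>simp add: field_simps power2_eq_square\<close>)
  have D2: "((\<lambda>h. (profile r (sq t (x + h *\<^sub>R v) (sf h)) / jac t (x + h *\<^sub>R v) (sf h)) *\<^sub>R cross3 (g1 t (sf h)) (g2 t (sf h))) has_vector_derivative
      (profile r (u \<bullet> u) / jac t x s0) *\<^sub>R (cross3 (g1 t s0) (\<sigma> *\<^sub>R g3 t s0) + cross3 (\<sigma> *\<^sub>R g2 t s0) (g2 t s0))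
      + (2 * profile1 r (u \<bullet> u) * (u \<bullet> v) / jac t x s0 + profile r (u \<bullet> u) * (v \<bullet> g2 t s0 + (u \<bullet> g3 t s0) * \<sigma>) / (jac t x s0)\<^sup>2) *\<^sub>R cross3 (g1 t s0) (g2 t s0)) (at 0)"
    using has_vector_derivative_scaleR[OF Dq cross3_derivative[OF Dg(2) Dg(3)]] by (simp add: sf(1) u_def)
  have "((\<lambda>h. fZ t (x + h *\<^sub>R v) (sf h)) has_vector_derivative
     ((2 * profile1 r (u \<bullet> u)) *\<^sub>R (cross3 u (\<sigma> *\<^sub>R g2 t s0) + cross3 (v - \<sigma> *\<^sub>R g1 t s0) (g1 t s0))
     + (2 * (profile2 r (u \<bullet> u) * (2 * (u \<bullet> v)))) *\<^sub>R cross3 u (g1 t s0)) +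
     ((profile r (u \<bullet> u) / jac t x s0) *\<^sub>R (cross3 (g1 t s0) (\<sigma> *\<^sub>R g3 t s0) + cross3 (\<sigma> *\<^sub>R g2 t s0) (g2 t s0))
      + (2 * profile1 r (u \<bullet> u) * (u \<bullet> v) / jac t x s0 + profile r (u \<bullet> u) * (v \<bullet> g2 t s0 + (u \<bullet> g3 t s0) * \<sigma>) / (jac t x s0)\<^sup>2) *\<^sub>R cross3 (g1 t s0) (g2 t s0))) (at 0)"
    unfolding fZ_def by (rule has_vector_derivative_add[OF D1 D2])
  moreover have "cross3 (v - \<sigma> *\<^sub>R g1 t s0) (g1 t s0) = cross3 v (g1 t s0)"
    by (simp add: Cross3.left_diff_distrib cross_mult_left)
  ultimately show "((\<lambda>h. fZ t (x + h *\<^sub>R v) (sf h)) has_vector_derivative fZd v t x s0) (at 0)"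
    unfolding fZd_def u_def[symmetric] \<sigma>_def[symmetric]
    by (simp add: cross_mult_left cross_mult_right algebra_simps)
qed

lemma time_derivative:
  assumes t: "t \<in> {a..b}" and tube: "infdist x (range (g t)) < 2 * r" and s0: "near t x s0"
    and sf: "sf t = s0" "(sf \<longlongrightarrow> s0) (at t within {a..b})" "\<forall>\<^sub>F h in at t within {a..b}. near h x (sf h)"
  shows "((\<lambda>h. fX h x (sf h)) has_vector_derivative fXt t x s0) (at t within {a..b})"
proof -
  define \<sigma> where "\<sigma> = ((x - g t s0) \<bullet> cross3 (g1 t s0) (g3 t s0)) / jac t x s0"
  define u where "u = x - g t s0"
  have Ds: "(sf has_real_derivative \<sigma>) (at t within {a..b})"
    unfolding \<sigma>_def by (rule time_param[OF assms])
  have cw: "continuous (at (t, s0) within {a..b} \<times> UNIV) (\<lambda>(h, s). g1 h s)" "continuous (at (t, s0) within {a..b} \<times> UNIV) (\<lambda>(h, s). g2 h s)"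
    using cont1 cont2 t by (auto simp: continuous_on_eq_continuous_within)
  have Dg: "((\<lambda>h. g h (sf h)) has_vector_derivative cross3 (g1 t s0) (g2 t s0) + \<sigma> *\<^sub>R g1 t s0) (at t within {a..b})"
    by (rule chain_two_variables[OF dt0[OF t] ds0 cw(1) Ds sf(1)])
  have Dg1: "((\<lambda>h. g1 h (sf h)) has_vector_derivative cross3 (g1 t s0) (g3 t s0) + \<sigma> *\<^sub>R g2 t s0) (at t within {a..b})"
    by (rule chain_two_variables[OF dt1[OF t] ds1 cw(2) Ds sf(1)])
  have Du: "((\<lambda>h. x - g h (sf h)) has_vector_derivative - (cross3 (g1 t s0) (g2 t s0) + \<sigma> *\<^sub>R g1 t s0)) (at t within {a..b})"
    using has_vector_derivative_diff[OF has_vector_derivative_const Dg] by simp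
  have og: "u \<bullet> g1 t s0 = 0" using near_orthogonal[OF t s0] by (auto simp: u_def)
  have Dsq: "((\<lambda>h. sq h x (sf h)) has_real_derivative - 2 * (u \<bullet> cross3 (g1 t s0) (g2 t s0))) (at t within {a..b})"
    using inner_real_derivative[OF Du Du] og by (simp add: sf(1) u_def[symmetric] inner_add_left inner_add_right inner_diff_left inner_diff_right inner_commute)
  have "((\<lambda>h. profile r (sq h x (sf h))) has_real_derivative profile1 r (u \<bullet> u) * (- 2 * (u \<bullet> cross3 (g1 t s0) (g2 t s0)))) (at t within {a..b})"
    using DERIV_chain2[OF profile_derivative(1) Dsq] by (simp add: sf(1) u_def)
  from has_vector_derivative_scaleR[OF this Dg1]
  show ?thesis
    by (simp add: fX_def fXt_def sf(1) u_def \<sigma>_def add.commute)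
qed

end

section \<open>The differential inequality\<close>

context curve_family
begin

lemma support_box:
  obtains c d :: "real^3" where "\<And>t x. t \<in> {a..b} \<Longrightarrow> x \<notin> cbox c d \<Longrightarrow> r \<le> infdist x (range (g t))"
proof -
  obtain R where R: "\<And>t s. t \<in> {a..b} \<Longrightarrow> norm (g t s) \<le> R"
    using periodic_bounded[OF cont0 per] by blast
  show thesis
  proof (rule that[of "- vec (R + r)" "vec (R + r)"], rule ccontr)
    fix t x assume t: "t \<in> {a..b}" and x: "x \<notin> cbox (- vec (R + r)) (vec (R + r))"
      and "\<not> r \<le> infdist x (range (g t))"
    then have "norm (x - g t (near_param t x)) < r"
      using norm_near[OF near_param[OF t]] by simp
    then have "norm x \<le> R + r"
      using norm_triangle_ineq[of "x - g t (near_param t x)" "g t (near_param t x)"] R[OF t, of "near_param t x"] by simp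
    then have "- (R + r) \<le> x $ i" "x $ i \<le> R + r" for i using component_le_norm_cart[of x i] by linarith+
    then show False using x by (simp add: mem_box_cart)
  qed
qed

text \<open>A field whose derivative in direction v is (p.v) q has curl \<open>cross3 p q\<close>.
  Applied to the two summands of \<open>fXd\<close>, with p = u and p = \<open>g1\<close>, this
  gives the two cross products of \<open>fZ\<close>.\<close>

lemma curl_components:
  "vector [fXd (axis 2 1) t x s $ 3 - fXd (axis 3 1) t x s $ 2, fXd (axis 3 1) t x s $ 1 - fXd (axis 1 1) t x s $ 3,
     fXd (axis 1 1) t x s $ 2 - fXd (axis 2 1) t x s $ 1] = fZ t x s"
  by (simp add: vec_eq_iff forall_3 fXd_def fZ_def cross_components inner_axis inner_axis' algebra_simps add_divide_distrib diff_divide_distrib)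

lemma lift_spatial_derivative:
  assumes t: "t \<in> {a..b}" and P: "admissible P" "admissible P'"
    and step: "\<And>s0 sf. infdist x (range (g t)) < 2 * r \<Longrightarrow> near t x s0 \<Longrightarrow> sf 0 = s0 \<Longrightarrow>
      (sf \<longlongrightarrow> s0) (at 0) \<Longrightarrow> \<forall>\<^sub>F h in at 0. near t (x + h *\<^sub>R v) (sf h) \<Longrightarrow>
      ((\<lambda>h. P t (x + h *\<^sub>R v) (sf h)) has_vector_derivative P' t x s0) (at 0)"
  shows "((\<lambda>h. lift P t (x + h *\<^sub>R v)) has_vector_derivative lift P' t x) (at 0)"
proof -
  have "((\<lambda>h. lift P ((\<lambda>_. t) h) ((\<lambda>h. x + h *\<^sub>R v) h)) has_vector_derivative lift P' ((\<lambda>_. t) 0) ((\<lambda>h. x + h *\<^sub>R v) 0)) (at 0 within UNIV)"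
  proof (rule lift_derivative[where \<theta>="\<lambda>_. t" and \<rho>="\<lambda>h. x + h *\<^sub>R v" and P=P and P'=P'])
    show "((\<lambda>h. x + h *\<^sub>R v) \<longlongrightarrow> x + 0 *\<^sub>R v) (at 0)" by (intro tendsto_intros)
  qed (use t P step in auto)
  then show ?thesis by simp
qed

lemma lift_fields_test_family:
  assumes "varifold_flow a b V m"
    and box: "\<And>t x. t \<in> {a..b} \<Longrightarrow> x \<notin> cbox c d \<Longrightarrow> r \<le> infdist x (range (g t))"
  shows "test_family a b V m c d (lift fX) (lift fXt) (lift fZ) (\<lambda>l. lift (fXd (axis l 1))) (\<lambda>l. lift (fZd (axis l 1)))"
proof (intro test_family.intro test_family_axioms.intro assms(1))
  show "continuous_on ({a..b} \<times> UNIV) (\<lambda>(t, x). lift fX t x)" "continuous_on ({a..b} \<times> UNIV) (\<lambda>(t, x). lift fXt t x)"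
    "continuous_on ({a..b} \<times> UNIV) (\<lambda>(t, x). lift (fXd v) t x)" "continuous_on ({a..b} \<times> UNIV) (\<lambda>(t, x). lift (fZd v) t x)" for v
    by (intro lift_continuous admissible_fields continuous_fields)+
  fix t x assume t: "t \<in> {a..b}"
  show "x \<notin> cbox c d \<Longrightarrow> lift fX t x = 0" "x \<notin> cbox c d \<Longrightarrow> lift fXt t x = 0"
    "x \<notin> cbox c d \<Longrightarrow> lift (fXd v) t x = 0" "x \<notin> cbox c d \<Longrightarrow> lift (fZd v) t x = 0" for v
    using box[OF t] lift_zero[OF t] admissible_fields by auto
  show "((\<lambda>t. lift fX t x) has_vector_derivative lift fXt t x) (at t within {a..b})"
    by (rule lift_derivative[where \<theta>="\<lambda>t. t" and \<rho>="\<lambda>_. x" and P=fX and P'=fXt])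
      (use t admissible_fields time_derivative in auto)
  show "((\<lambda>h. lift fX t (x + h *\<^sub>R axis l 1)) has_vector_derivative lift (fXd (axis l 1)) t x) (at 0)" for l
    by (rule lift_spatial_derivative[OF t admissible_fields(1,3) spatial_derivatives(1)[OF t]])
  show "((\<lambda>h. lift fZ t (x + h *\<^sub>R axis l 1)) has_vector_derivative lift (fZd (axis l 1)) t x) (at 0)" for l
    by (rule lift_spatial_derivative[OF t admissible_fields(4,5) spatial_derivatives(2)[OF t]])
  show "lift fZ t x = vector [lift (fXd (axis 2 1)) t x $ 3 - lift (fXd (axis 3 1)) t x $ 2,
     lift (fXd (axis 3 1)) t x $ 1 - lift (fXd (axis 1 1)) t x $ 3, lift (fXd (axis 1 1)) t x $ 2 - lift (fXd (axis 2 1)) t x $ 1]"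
  proof (cases "infdist x (range (g t)) < 2 * r")
    case True
    then show ?thesis by (simp add: lift_def curl_components)
  next
    case False
    then show ?thesis by (simp add: lift_def vec_eq_iff forall_3)
  qed
qed

text \<open>Linearity in the direction lets the sum over coordinate axes in \<open>dir_quad\<close>
  collapse to the derivative in direction \<xi>, the form in which the pointwise estimate
  applies.\<close>

lemma fZd_linear: "linear (\<lambda>v. fZd v t x s)"
proof -
  have "linear (\<lambda>v. (A * (u \<bullet> v)) *\<^sub>R p + B *\<^sub>R (cross3 v \<tau> + ((v \<bullet> \<tau>) / c) *\<^sub>R q)
      + (B * (u \<bullet> v) / c + D * (v \<bullet> k + e * ((v \<bullet> \<tau>) / c)) / c\<^sup>2) *\<^sub>R y + (E * ((v \<bullet> \<tau>) / c)) *\<^sub>R z)"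
    for A B D E c e :: real and u p q \<tau> k y z :: "real^3"
    by (intro linear_compose_add linearI)
      (simp_all add: inner_add_right inner_add_left cross_add_left cross_mult_left add_divide_distrib
        scaleR_add_left scaleR_add_right distrib_left mult_ac)
  then show ?thesis unfolding fZd_def by blast
qed

lemma dir_quad_fZd: "dir_quad (\<lambda>l. fZd (axis l 1) t x s) \<xi> = fZd \<xi> t x s \<bullet> \<xi>"
proof -
  interpret linear "\<lambda>v. fZd v t x s" by (rule fZd_linear)
  have "fZd \<xi> t x s = fZd (\<Sum>l\<in>UNIV. \<xi> $ l *\<^sub>R axis l 1) t x s"
    using basis_expansion[of \<xi>] by (simp add: scalar_mult_eq_scaleR)
  also have "\<dots> = (\<Sum>l\<in>UNIV. \<xi> $ l *\<^sub>R fZd (axis l 1) t x s)"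
    by (simp add: sum scale)
  finally show ?thesis by (simp add: dir_quad_def inner_sum_left)
qed

abbreviation rate :: real where "rate \<equiv> 77 / r\<^sup>2 + 28 * M"

lemma M_nonneg: "0 \<le> M"
  using order_trans[OF norm_ge_zero tors[of a 0]] ab by simp

lemma rate_nonneg: "0 \<le> rate"
  using M_nonneg by simp

lemma lift_fX_bound:
  assumes t: "t \<in> {a..b}"
  shows "norm (lift fX t x) \<le> 1"
proof (cases "r \<le> infdist x (range (g t))")
  case True
  then show ?thesis using lift_zero[OF t True admissible_fields(1)] by simp
next
  case False
  define s where "s = near_param t x"
  have "norm (x - g t s) < r" using False norm_near[OF near_param[OF t]] by (simp add: s_def)
  then have "(norm (x - g t s))\<^sup>2 \<le> r\<^sup>2" by (intro power_mono) auto
  then show ?thesis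
    using profile_bounds[OF r, of "sq t x s"] unit[OF t, of s] by (simp add: lift_def fX_def s_def dot_square_norm)
qed

text \<open>Off the support the left side is 0 and the right side is \<open>rate\<close>. On the
  support the nearest point supplies orthonormality relations, curvature and Jacobian for the
  algebraic estimate.\<close>

lemma pointwise_estimate:
  assumes t: "t \<in> {a..b}" and \<xi>: "norm \<xi> = 1"
  shows "\<bar>lift fXt t x \<bullet> \<xi> - dir_quad (\<lambda>l. lift (fZd (axis l 1)) t x) \<xi>\<bar> \<le> rate * (1 - lift fX t x \<bullet> \<xi>)"
proof (cases "r \<le> infdist x (range (g t))")
  case True
  then show ?thesis
    using lift_zero[OF t True] admissible_fields rate_nonneg by (simp add: dir_quad_def)
next
  case False
  define s where "s = near_param t x"
  define u where "u = x - g t s"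
  have s: "near t x s" unfolding s_def by (rule near_param[OF t])
  have ur: "norm u \<le> r" using False norm_near[OF s] by (simp add: u_def)
  then have u2: "u \<bullet> u \<le> r\<^sup>2" by (simp add: dot_square_norm power_mono)
  have tube: "infdist x (range (g t)) < 2 * r" using False r by simp
  have lift: "lift P t x = P t x s" for P using tube by (simp add: lift_def s_def)
  note cb = profile_bounds[OF r _ u2]
  \<comment> \<open>The first group is the time derivative of X paired with \<xi>, the second is
    D(curl X) on \<xi>, both at the nearest point.\<close>
  have est: "\<bar>(- 2 * profile1 r (u \<bullet> u) * (u \<bullet> cross3 (g1 t s) (g2 t s)) * (g1 t s \<bullet> \<xi>) + profile r (u \<bullet> u) * (cross3 (g1 t s) (g3 t s) \<bullet> \<xi>)
      + profile r (u \<bullet> u) * (g2 t s \<bullet> \<xi>) * (u \<bullet> cross3 (g1 t s) (g3 t s)) / jac t x s)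
    - (4 * profile2 r (u \<bullet> u) * (u \<bullet> \<xi>) * (cross3 u (g1 t s) \<bullet> \<xi>) + 2 * profile1 r (u \<bullet> u) * ((\<xi> \<bullet> g1 t s) / jac t x s) * (cross3 u (g2 t s) \<bullet> \<xi>)
      + (2 * profile1 r (u \<bullet> u) * (u \<bullet> \<xi>) / jac t x s + profile r (u \<bullet> u) * (\<xi> \<bullet> g2 t s + (u \<bullet> g3 t s) * ((\<xi> \<bullet> g1 t s) / jac t x s)) / (jac t x s)\<^sup>2) * (cross3 (g1 t s) (g2 t s) \<bullet> \<xi>)
      + profile r (u \<bullet> u) / jac t x s * ((\<xi> \<bullet> g1 t s) / jac t x s) * (cross3 (g1 t s) (g3 t s) \<bullet> \<xi>))\<bar>
    \<le> rate * (1 - profile r (u \<bullet> u) * (g1 t s \<bullet> \<xi>))"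
  proof (rule binormal_quadratic_estimate[where \<tau>="g1 t s" and k="g2 t s" and w="g3 t s" and u=u and \<xi>=\<xi>
        and f="profile r (u \<bullet> u)" and ?f1.0="profile1 r (u \<bullet> u)" and ?f2.0="profile2 r (u \<bullet> u)" and c="jac t x s" and r=r and M=M])
    show "g1 t s \<bullet> u = 0" using near_orthogonal[OF t s] by (simp add: u_def inner_commute)
    show "jac t x s = 1 - u \<bullet> g2 t s" by (simp add: jac_def u_def)
    show "(norm u)\<^sup>2 / r\<^sup>2 \<le> 1 - profile r (u \<bullet> u)" using cb(3) by (simp add: dot_square_norm)
  qed (use unit[OF t] \<xi> g12_orthogonal[OF t] r curv[OF t] tors[OF t] ur cb in auto)
  have X: "lift fX t x \<bullet> \<xi> = profile r (u \<bullet> u) * (g1 t s \<bullet> \<xi>)"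
    by (simp add: lift fX_def u_def)
  have Xt: "lift fXt t x \<bullet> \<xi> = - 2 * profile1 r (u \<bullet> u) * (u \<bullet> cross3 (g1 t s) (g2 t s)) * (g1 t s \<bullet> \<xi>) + profile r (u \<bullet> u) * (cross3 (g1 t s) (g3 t s) \<bullet> \<xi>)
      + profile r (u \<bullet> u) * (g2 t s \<bullet> \<xi>) * (u \<bullet> cross3 (g1 t s) (g3 t s)) / jac t x s"
    by (simp add: lift fXt_def u_def[symmetric] inner_add_left algebra_simps)
  have Z: "dir_quad (\<lambda>l. lift (fZd (axis l 1)) t x) \<xi> = 4 * profile2 r (u \<bullet> u) * (u \<bullet> \<xi>) * (cross3 u (g1 t s) \<bullet> \<xi>) + 2 * profile1 r (u \<bullet> u) * ((\<xi> \<bullet> g1 t s) / jac t x s) * (cross3 u (g2 t s) \<bullet> \<xi>)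
      + (2 * profile1 r (u \<bullet> u) * (u \<bullet> \<xi>) / jac t x s + profile r (u \<bullet> u) * (\<xi> \<bullet> g2 t s + (u \<bullet> g3 t s) * ((\<xi> \<bullet> g1 t s) / jac t x s)) / (jac t x s)\<^sup>2) * (cross3 (g1 t s) (g2 t s) \<bullet> \<xi>)
      + profile r (u \<bullet> u) / jac t x s * ((\<xi> \<bullet> g1 t s) / jac t x s) * (cross3 (g1 t s) (g3 t s) \<bullet> \<xi>)"
    unfolding lift dir_quad_fZd
    by (simp add: fZd_def u_def[symmetric] inner_add_left dot_cross_self distrib_left mult.assoc)
  show ?thesis using est unfolding X Xt Z .
qed

text \<open>The derivative is computed for G and bounded by F. The time dependence of G is the
  pairing alone, whereas F also contains the mass of \<open>V t\<close>, for which no evolution law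
  is available. The two differ by \<open>m - vmass (V t)\<close>, which is nonnegative.\<close>

theorem stability_estimate:
  assumes "varifold_flow a b V m"
  defines "G \<equiv> \<lambda>t. m - (\<integral>p. lift fX t (fst p) \<bullet> snd p \<partial>V t)"
    and "F \<equiv> \<lambda>t. \<integral>p. 1 - lift fX t (fst p) \<bullet> snd p \<partial>V t"
  shows "\<And>t. t \<in> {a..b} \<Longrightarrow> 0 \<le> F t \<and> F t \<le> G t" "\<exists>C. C-lipschitz_on {a..b} G"
    "AE t in lebesgue_on {a..b}. \<exists>D. (G has_real_derivative D) (at t within {a..b}) \<and> \<bar>D\<bar> \<le> rate * F t \<and> rate * F t \<le> rate * G t"
proof -
  obtain c d :: "real^3" where box: "\<And>t x. t \<in> {a..b} \<Longrightarrow> x \<notin> cbox c d \<Longrightarrow> r \<le> infdist x (range (g t))"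
    using support_box by blast
  interpret test_family a b V m c d "lift fX" "lift fXt" "lift fZ" "\<lambda>l. lift (fXd (axis l 1))" "\<lambda>l. lift (fZd (axis l 1))"
    by (rule lift_fields_test_family[OF assms(1) box])
  have meas: "(\<lambda>p. lift fX t (fst p) \<bullet> snd p) \<in> borel_measurable borel"
    "(\<lambda>p. lift fXt t (fst p) \<bullet> snd p) \<in> borel_measurable borel"
    "(\<lambda>p. dir_quad (\<lambda>l. lift (fZd (axis l 1)) t (fst p)) (snd p)) \<in> borel_measurable borel" if "t \<in> {a..b}" for t
    by (intro measurable_pairing measurable_dir_quad slice_continuous[OF X_cont that] slice_continuous[OF Xt_cont that]
       slice_continuous[OF Zd_cont that])+
  have int: "integrable (V t) (\<lambda>p. lift fX t (fst p) \<bullet> snd p)" if "t \<in> {a..b}" for t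
    by (rule integrable_V[OF that meas(1)[OF that], of 1]) (use inner_unit_bound lift_fX_bound[OF that] in auto)
  have F_eq: "F t = vmass (V t) - pairing t (lift fX t)" if t: "t \<in> {a..b}" for t
  proof -
    interpret finite_measure "V t" by (rule finite_V[OF t])
    show ?thesis using int[OF t] by (simp add: F_def first_moment_def vmass_def)
  qed
  show FG: "0 \<le> F t \<and> F t \<le> G t" if t: "t \<in> {a..b}" for t
  proof
    have "AE p in V t. 0 \<le> 1 - lift fX t (fst p) \<bullet> snd p"
      using AE_sphere[OF t]
    proof eventually_elim
      case (elim p)
      then show ?case using inner_unit_bound[OF elim lift_fX_bound[OF t, of "fst p"]] by simp
    qed
    then show "0 \<le> F t" unfolding F_def by (rule integral_nonneg_AE)
    show "F t \<le> G t" using F_eq[OF t] vmass[OF t] by (simp add: G_def first_moment_def)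
  qed
  have G_eq: "G = (\<lambda>t. m - pairing t (lift fX t))" by (simp add: G_def first_moment_def)
  obtain C where "C-lipschitz_on {a..b} (\<lambda>t. pairing t (lift fX t))" using pairing_X_lipschitz by blast
  then have "(0 + C)-lipschitz_on {a..b} G" unfolding G_eq by (intro lipschitz_on_diff lipschitz_on_constant)
  then show "\<exists>C. C-lipschitz_on {a..b} G" by blast
  show "AE t in lebesgue_on {a..b}. \<exists>D. (G has_real_derivative D) (at t within {a..b}) \<and> \<bar>D\<bar> \<le> rate * F t \<and> rate * F t \<le> rate * G t"
  proof (cases "a < b")
    case True
    from pairing_X_derivative[OF this] show ?thesis
    proof eventually_elim
      case (elim t)
      then have t: "t \<in> {a..b}" by simp
      define D where "D = pairing t (lift fXt t) - (\<integral>p. dir_quad (\<lambda>l. lift (fZd (axis l 1)) t (fst p)) (snd p) \<partial>V t)"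
      have "(G has_real_derivative 0 - D) (at t within {a..b})"
        unfolding G_eq D_def using elim by (intro DERIV_diff DERIV_const) auto
      moreover have "\<bar>D\<bar> \<le> rate * F t"
      proof -
        interpret finite_measure "V t" by (rule finite_V[OF t])
        have "\<exists>B. \<forall>x. norm (lift fXt t x) \<le> B" 
        proof (rule Xt_bounded)
          fix B assume "\<And>t x. t \<in> {a..b} \<Longrightarrow> norm (lift fXt t x) \<le> B"
          from this[OF t] show ?thesis by (intro exI allI)
        qed
        then obtain B where B: "\<forall>x. norm (lift fXt t x) \<le> B" by (rule exE)
        have "\<exists>B. \<forall>l x. norm (lift (fZd (axis l 1)) t x) \<le> B" 
        proof (rule Zd_bounded)
          fix B assume "\<And>l t x. t \<in> {a..b} \<Longrightarrow> norm (lift (fZd (axis l 1)) t x) \<le> B"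
          from this[OF t] show ?thesis by (intro exI allI)
        qed
        then obtain B' where B': "\<forall>l x. norm (lift (fZd (axis l 1)) t x) \<le> B'" by (rule exE)
        have i1: "integrable (V t) (\<lambda>p. lift fXt t (fst p) \<bullet> snd p)"
        proof (rule integrable_V[OF t meas(2)[OF t]])
          fix x \<xi> :: "real^3" assume "norm \<xi> = 1"
          then show "\<bar>lift fXt t (fst (x, \<xi>)) \<bullet> snd (x, \<xi>)\<bar> \<le> B"
            using inner_unit_bound[of \<xi> "lift fXt t x" B] B by simp
        qed
        have i2: "integrable (V t) (\<lambda>p. dir_quad (\<lambda>l. lift (fZd (axis l 1)) t (fst p)) (snd p))"
        proof (rule integrable_V[OF t meas(3)[OF t]])
          fix x \<xi> :: "real^3" assume "norm \<xi> = 1"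
          then show "\<bar>dir_quad (\<lambda>l. lift (fZd (axis l 1)) t (fst (x, \<xi>))) (snd (x, \<xi>))\<bar> \<le> 3 * B'"
            using dir_quad_bound[of \<xi> "\<lambda>l. lift (fZd (axis l 1)) t x" B'] B' by simp
        qed
        have "D = (\<integral>p. lift fXt t (fst p) \<bullet> snd p - dir_quad (\<lambda>l. lift (fZd (axis l 1)) t (fst p)) (snd p) \<partial>V t)"
          using i1 i2 by (simp add: D_def first_moment_def)
        then have "\<bar>D\<bar> \<le> (\<integral>p. \<bar>lift fXt t (fst p) \<bullet> snd p - dir_quad (\<lambda>l. lift (fZd (axis l 1)) t (fst p)) (snd p)\<bar> \<partial>V t)"
          by (simp only:) (rule integral_abs_bound)
        also have "\<dots> \<le> (\<integral>p. rate * (1 - lift fX t (fst p) \<bullet> snd p) \<partial>V t)"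
        proof (rule integral_mono_AE)
          show "AE p in V t. \<bar>lift fXt t (fst p) \<bullet> snd p - dir_quad (\<lambda>l. lift (fZd (axis l 1)) t (fst p)) (snd p)\<bar>
              \<le> rate * (1 - lift fX t (fst p) \<bullet> snd p)"
            using AE_sphere[OF t] by eventually_elim (rule pointwise_estimate[OF t])
        qed (use i1 i2 int[OF t] in auto)
        also have "\<dots> = rate * F t" by (simp add: F_def)
        finally show ?thesis .
      qed
      moreover have "rate * F t \<le> rate * G t" using FG[OF t] rate_nonneg by (intro mult_left_mono) auto
      ultimately show ?case by (intro exI[of _ "0 - D"]) simp
    qed
  next
    case False
    \<comment> \<open>A one-point interval is a null set, so the a.e. statement holds
      vacuously.\<close>
    then have eq: "b = a" using ab by simp
    have "negligible {a}" by simp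
    then have "{a} \<in> null_sets (lebesgue_on {a..b})"
      unfolding eq by (subst null_sets_restrict_space) (simp_all add: negligible_iff_null_sets)
    then show ?thesis
      by (rule AE_I') (auto simp: eq)
  qed
qed

text \<open>The given field chooses a closest point and then some parameter of it, while
  \<open>lift\<close> chooses a nearest parameter directly. Injectivity modulo the period makes the
  tangents agree.\<close>

lemma X_field_eq_lift:
  assumes t: "t \<in> {a..b}" and \<gamma>: "\<And>s. \<gamma> (t, s) = g t s" "\<And>s. d_s I \<gamma> (t, s) = g1 t s"
  shows "X_field I \<gamma> r x t = lift fX t x"
proof -
  define C where "C = range (g t)"
  define s where "s = near_param t x"
  have s: "near t x s" unfolding s_def by (rule near_param[OF t])
  have C: "range (\<lambda>s. \<gamma> (t, s)) = C" by (simp add: C_def \<gamma>)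
  have cutoff: "cutoff r ((infdist x C)\<^sup>2) = profile r (sq t x s)"
    using norm_near[OF s] r by (auto simp: C_def cutoff_def profile_def dot_square_norm max_def field_simps)
  show ?thesis
  proof (cases "infdist x C < 2 * r")
    case True
    then have cu: "closest_unique C x" using uniq[OF t] by (simp add: C_def)
    have p: "g t s \<in> C \<and> dist x (g t s) = infdist x C" using s by (simp add: near_iff C_def)
    have "closest_point C x = g t s"
      unfolding closest_point_def using cu p unfolding closest_unique_def by (metis (mono_tags, lifting) the1_equality)
    moreover have "tangent_at I \<gamma> t (g t s) = g1 t s"
    proof -
      define s' where "s' = (SOME s'. g t s' = g t s)"
      have "g t s' = g t s" unfolding s'_def by (rule someI[of _ s]) simp
      then obtain k :: int where "s = s' + of_int k * L"
        using periodic_injective_shift[OF L per inj] t by metis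
      then have "g1 t s = g1 t s'" by (simp add: shift[OF t])
      then show ?thesis unfolding tangent_at_def \<gamma> s'_def[symmetric] by simp
    qed
    ultimately have "X_field I \<gamma> r x t = profile r (sq t x s) *\<^sub>R g1 t s"
      using cu by (simp add: X_field_def C Let_def cutoff)
    then show ?thesis using True by (simp add: lift_def C_def fX_def s_def)
  next
    case False
    \<comment> \<open>Beyond the tube the closest point may or may not be unique; the field is 0
      either way, by convention or by the cutoff.\<close>
    then have "r \<le> infdist x C" using r by simp
    then have "profile r (sq t x s) = 0"
      using profile_far norm_near[OF s] by (simp add: C_def)
    then show ?thesis using False by (simp add: X_field_def C Let_def cutoff lift_def C_def[symmetric])
  qed
qed

end

section \<open>The security radius\<close>

text \<open>The graph is cut out by the closed condition \<open>dist = infdist\<close>, and a map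
  into a compact set with closed graph is continuous.\<close>

lemma closest_point_continuous:
  fixes C :: "(real^3) set"
  assumes C: "compact C" and u: "\<And>x. closest_unique C x"
  shows "continuous_on UNIV (closest_point C)"
    "closest_point C x \<in> C" "x \<in> C \<Longrightarrow> closest_point C x = x"
proof -
  have P: "closest_point C x \<in> C \<and> dist x (closest_point C x) = infdist x C" for x
    using theI'[OF u[of x, unfolded closest_unique_def]] by (simp add: closest_point_def)
  then show "closest_point C x \<in> C" by blast
  show "x \<in> C \<Longrightarrow> closest_point C x = x" using P[of x] by simp
  have "range (\<lambda>x. (x, closest_point C x)) = (UNIV \<times> C) \<inter> {p. dist (fst p) (snd p) = infdist (fst p) C}"
  proof (intro equalityI subsetI)
    fix p assume p: "p \<in> (UNIV \<times> C) \<inter> {p. dist (fst p) (snd p) = infdist (fst p) C}"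
    then have "snd p \<in> C \<and> dist (fst p) (snd p) = infdist (fst p) C" by (simp add: mem_Times_iff)
    then have "closest_point C (fst p) = snd p"
      unfolding closest_point_def by (rule the1_equality[OF u[of "fst p", unfolded closest_unique_def]])
    then show "p \<in> range (\<lambda>x. (x, closest_point C x))" by (intro image_eqI[of _ _ "fst p"]) (auto simp: prod_eq_iff)
  qed (use P in auto)
  moreover have "closed ((UNIV \<times> C) \<inter> {p. dist (fst p) (snd p) = infdist (fst p) C})"
    by (intro closed_Int closed_Times closed_UNIV compact_imp_closed[OF C] closed_Collect_eq continuous_intros)
  ultimately show "continuous_on UNIV (closest_point C)"
    using P by (intro continuous_from_closed_graph[OF C]) auto
qed

text \<open>Otherwise the closest point map would be a retraction of the whole space onto a circle.\<close>

lemma closed_curve_has_ambiguous_point: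
  fixes c :: "real \<Rightarrow> real^3"
  assumes cont: "continuous_on UNIV c" and L: "L > 0" and per: "\<And>s. c (s + L) = c s" and inj: "inj_on c {0..<L}"
    and C: "compact (range c)" "range c = c ` {0..L}"
  shows "\<exists>x. \<not> closest_unique (range c) x"
proof (rule ccontr)
  assume "\<not> ?thesis"
  then have u: "\<And>x. closest_unique (range c) x" by blast
  have "retraction UNIV (range c) (closest_point (range c))"
    unfolding retraction_def using closest_point_continuous[OF C(1) u] by auto
  then have contr: "contractible (range c)"
    using retract_of_contractible[OF contractible_UNIV] unfolding retract_of_def by blast
  define p where "p = (\<lambda>s. c (L * s))"
  have "path p" unfolding path_def p_def by (intro continuous_on_compose2[OF cont] continuous_intros) auto
  moreover have "loop_free p"
    unfolding loop_free_def
  proof (intro ballI impI)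
    fix x y :: real assume xy: "x \<in> {0..1}" "y \<in> {0..1}" "p x = p y"
    obtain k :: int where "L * y = L * x + of_int k * L"
      using periodic_injective_shift[OF L per inj, of "L * x" "L * y"] xy(3) by (auto simp: p_def)
    then have "L * y = L * (x + of_int k)" by (simp add: algebra_simps)
    then have y: "y = x + of_int k" using L by simp
    then have "- 1 \<le> real_of_int k" "real_of_int k \<le> 1" using xy by auto
    \<comment> \<open>A shift by a full period inside the closed unit interval can only exchange its
      end points, which is the exception granted by \<open>loop_free\<close>.\<close>
    then have "k = - 1 \<or> k = 0 \<or> k = 1" by auto
    then show "x = y \<or> x = 0 \<and> y = 1 \<or> x = 1 \<and> y = 0" using y xy by auto
  qed
  ultimately have "simple_path p" by (simp add: simple_path_def)
  moreover have "pathfinish p = pathstart p" using per[of 0] by (simp add: p_def pathfinish_def pathstart_def)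
  ultimately have "path_image p homeomorphic sphere (0::complex) 1"
    by (intro homeomorphic_simple_path_image_circle) auto
  moreover have "path_image p = range c"
  proof -
    have "(\<lambda>s. L * s) ` {0..1} = {0..L}" using L by (simp add: image_mult_atLeastAtMost)
    then show ?thesis unfolding path_image_def p_def C(2) by (metis image_image)
  qed
  ultimately have "contractible (sphere (0::complex) 1)"
    using contr homeomorphic_contractible_eq by metis
  then show False by (simp add: contractible_sphere)
qed

context closed_curves
begin

text \<open>The distance of such a point to the curve bounds the set whose \<open>Sup\<close> is the
  security radius. Without a bound that \<open>Sup\<close> would be an unspecified real.\<close>

lemma ambiguous_point: "t \<in> {a..b} \<Longrightarrow> \<exists>x. \<not> closest_unique (range (g t)) x"
  using closed_curve_has_ambiguous_point[OF curve_cont L per inj compact_range] range_eq[of t 0] by simp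

text \<open>With zero curvature the curve would be a line traversed at unit speed, which is not
  periodic. The fact is needed since \<open>inverse 0 = 0\<close> would make \<open>r_gamma\<close>
  collapse.\<close>

lemma curvature_nonzero:
  assumes t: "t \<in> {a..b}"
  shows "\<exists>s. g2 t s \<noteq> 0"
proof (rule ccontr)
  assume "\<not> ?thesis"
  then have 0: "\<And>s. g2 t s = 0" by simp
  have g1: "g1 t s = g1 t 0" for s
    by (rule has_vector_derivative_zero_constant[of UNIV "g1 t"]) (use ds1[OF t] 0 in auto)
  have D: "((\<lambda>s. g t s - s *\<^sub>R g1 t 0) has_vector_derivative g1 t s - g1 t 0) (at s)" for s
    by (intro has_vector_derivative_diff ds0[OF t]) (auto intro!: derivative_eq_intros)
  have D0: "((\<lambda>s. g t s - s *\<^sub>R g1 t 0) has_vector_derivative 0) (at s)" for s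
    using D[of s] by (simp only: g1[of s] diff_self)
  obtain y where y: "\<And>s. g t s - s *\<^sub>R g1 t 0 = y"
    by (rule has_vector_derivative_zero_constant[of UNIV "\<lambda>s. g t s - s *\<^sub>R g1 t 0"]) (use D0 in auto)
  have "g t L - L *\<^sub>R g1 t 0 = g t 0 - 0 *\<^sub>R g1 t 0"
    unfolding y ..
  then have "L *\<^sub>R g1 t 0 = 0" using per[OF t, of 0] by simp
  then show False using L unit[OF t, of 0] by auto
qed

lemma curve_lipschitz:
  assumes t: "t \<in> {a..b}"
  shows "norm (g t s - g t s') \<le> \<bar>s - s'\<bar>"
proof -
  have "onorm (\<lambda>h. h *\<^sub>R g1 t x) \<le> 1" for x by (rule onorm_le) (simp add: unit[OF t])
  then show ?thesis
    using differentiable_bound[of UNIV "g t" "\<lambda>s h. h *\<^sub>R g1 t s" 1 s s'] ds0[OF t]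
    by (simp add: has_vector_derivative_def)
qed

text \<open>Injectivity modulo the period makes the chord length positive on a compact set of times,
  parameters and gaps, so it has a positive minimum there.\<close>

lemma chord_bound:
  assumes "0 < \<delta>"
  obtains c where "0 < c" "\<And>t s h. t \<in> {a..b} \<Longrightarrow> \<delta> \<le> \<bar>h\<bar> \<Longrightarrow> \<bar>h\<bar> \<le> L / 2 \<Longrightarrow> c \<le> norm (g t (s + h) - g t s)"
proof -
  define Q where "Q = {a..b} \<times> {0..L} \<times> ({- (L / 2)..- \<delta>} \<union> {\<delta>..L / 2})"
  define \<phi> where "\<phi> = (\<lambda>p. norm (g (fst p) (fst (snd p) + snd (snd p)) - g (fst p) (fst (snd p))))"
  have Q: "compact Q" unfolding Q_def by (intro compact_Times compact_Un compact_Icc)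
  have c1: "continuous_on Q (\<lambda>p. case (fst p, fst (snd p) + snd (snd p)) of (t, s) \<Rightarrow> g t s)"
    by (intro continuous_on_compose2[OF cont0] continuous_intros) (auto simp: Q_def)
  have c2: "continuous_on Q (\<lambda>p. case (fst p, fst (snd p)) of (t, s) \<Rightarrow> g t s)"
    by (intro continuous_on_compose2[OF cont0] continuous_intros) (auto simp: Q_def)
  have cont: "continuous_on Q \<phi>" using c1 c2 unfolding \<phi>_def by (auto intro!: continuous_intros)
  have pos: "\<phi> p > 0" if "p \<in> Q" for p
  proof (rule ccontr)
    assume "\<not> \<phi> p > 0"
    then have eq: "g (fst p) (fst (snd p)) = g (fst p) (fst (snd p) + snd (snd p))" by (simp add: \<phi>_def)
    have t: "fst p \<in> {a..b}" and h: "snd (snd p) \<in> {- (L / 2)..- \<delta>} \<union> {\<delta>..L / 2}" using that by (auto simp: Q_def)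
    obtain k :: int where "fst (snd p) + snd (snd p) = fst (snd p) + of_int k * L"
      using periodic_injective_shift[OF L per[OF t] inj[OF t] eq] .
    then have k: "snd (snd p) = of_int k * L" by simp
    have "\<bar>real_of_int k * L\<bar> \<le> L / 2" using h k assms by auto
    then have "\<bar>real_of_int k\<bar> * L < 1 * L" using L by (simp add: abs_mult)
    then have "\<bar>real_of_int k\<bar> < 1" using L mult_less_cancel_right_pos by blast
    then have "k = 0" by linarith
    then show False using k h assms by auto
  qed
  obtain c where c: "0 < c" "\<And>p. p \<in> Q \<Longrightarrow> c \<le> \<phi> p"
  proof (cases "Q = {}")
    case True
    \<comment> \<open>If \<delta> exceeds L/2 no gap qualifies and any positive constant
      serves.\<close>
    then show ?thesis by (intro that[of 1]) auto
  next
    case False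
    obtain q where q: "q \<in> Q" "\<And>p. p \<in> Q \<Longrightarrow> \<phi> q \<le> \<phi> p"
      using continuous_attains_inf[OF Q False cont] by blast
    show ?thesis by (rule that[of "\<phi> q"]) (use pos q in auto)
  qed
  show thesis
  proof (rule that[OF c(1)])
    fix t s h assume t: "t \<in> {a..b}" and h: "\<delta> \<le> \<bar>h\<bar>" "\<bar>h\<bar> \<le> L / 2"
    obtain k :: int where k: "0 \<le> s + of_int k * L" "s + of_int k * L < 0 + L" using period_representative[OF L] .
    have "c \<le> \<phi> (t, s + of_int k * L, h)" by (rule c(2)) (use t h k in \<open>auto simp: Q_def abs_le_iff abs_if split: if_splits\<close>)
    moreover have "g t (s + of_int k * L + h) = g t (s + h)"
      using shift0[OF t, of "s + h" k] by (simp add: algebra_simps)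
    ultimately show "c \<le> norm (g t (s + h) - g t s)" using shift0[OF t, of s k] by (simp add: \<phi>_def)
  qed
qed

text \<open>Two nearest parameters that are far apart contradict the chord bound, since both points
  lie close to \<open>x\<close>. If they are close together, Rolle's theorem for the orthogonality
  relation produces a zero of the Jacobian, contradicting the curvature bound. Both bounds are
  uniform in time, which makes the infimum over times positive.\<close>

lemma uniform_tubular_neighbourhood:
  obtains \<rho> where "\<rho> > 0" "\<And>t x. t \<in> {a..b} \<Longrightarrow> infdist x (range (g t)) < \<rho> \<Longrightarrow> closest_unique (range (g t)) x"
proof -
  obtain B where B: "B > 0" "\<And>t s. t \<in> {a..b} \<Longrightarrow> norm (g2 t s) \<le> B" using periodic_bounded[OF cont2 per2] by blast
  \<comment> \<open>Between two nearest parameters closer than \<delta>, the distance from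
    \<open>x\<close> to the curve is at most \<rho> + \<delta> \<le> 2 \<delta>; multiplied by the
    curvature bound \<open>B\<close> this is 1/2 < 1.\<close>
  define \<delta> where "\<delta> = 1 / (4 * B)"
  have \<delta>: "\<delta> > 0" using B by (simp add: \<delta>_def)
  obtain c where c: "0 < c" "\<And>t s h. t \<in> {a..b} \<Longrightarrow> \<delta> \<le> \<bar>h\<bar> \<Longrightarrow> \<bar>h\<bar> \<le> L / 2 \<Longrightarrow> c \<le> norm (g t (s + h) - g t s)"
    using chord_bound[OF \<delta>] by blast
  define \<rho> where "\<rho> = min (c / 2) \<delta>"
  have "\<rho> > 0" using c \<delta> by (simp add: \<rho>_def)
  moreover have "closest_unique (range (g t)) x" if t: "t \<in> {a..b}" and tube: "infdist x (range (g t)) < \<rho>" for t x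
  proof -
    define q where "q = (\<lambda>s. (x - g t s) \<bullet> g1 t s)"
    have Dq: "(q has_real_derivative (x - g t s) \<bullet> g2 t s - 1) (at s)" for s
    proof -
      have D: "((\<lambda>s. x - g t s) has_vector_derivative - g1 t s) (at s)"
        using ds0[OF t] by (auto intro!: derivative_eq_intros)
      show ?thesis
        using bounded_bilinear.has_vector_derivative[OF bounded_bilinear_inner D ds1[OF t]] unit[OF t, of s]
        by (simp add: q_def dot_square_norm has_real_derivative_iff_has_vector_derivative)
    qed
    have no_two: False if n: "near t x lo" "near t x hi" and lh: "lo < hi" "hi - lo < \<delta>" for lo hi
    proof -
      have q: "q lo = q hi" using near_orthogonal[OF t n(1)] near_orthogonal[OF t n(2)] by (simp add: q_def)
      have qc: "continuous_on {lo..hi} q"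
        by (rule DERIV_continuous_on[OF has_field_derivative_at_within[OF Dq]])
      have "\<exists>z. lo < z \<and> z < hi \<and> (q has_real_derivative 0) (at z)"
        by (rule Rolle[OF lh(1) q qc]) (metis Dq real_differentiable_def)
      then obtain z where z: "lo < z" "z < hi" "(q has_real_derivative 0) (at z)" by blast
      have z0: "(x - g t z) \<bullet> g2 t z - 1 = 0" by (rule DERIV_unique[OF Dq z(3)])
      have "norm (x - g t z) \<le> norm (x - g t lo) + norm (g t lo - g t z)"
        using norm_triangle_ineq[of "x - g t lo" "g t lo - g t z"] by simp
      also have "\<dots> < \<rho> + \<delta>"
        using tube n(1) curve_lipschitz[OF t, of lo z] z lh by (auto simp: near_iff dist_norm)
      also have "\<dots> \<le> 2 * \<delta>" by (simp add: \<rho>_def)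
      finally have "norm (x - g t z) \<le> 2 * \<delta>" by simp
      then have "\<bar>(x - g t z) \<bullet> g2 t z\<bar> \<le> 2 * \<delta> * B" by (rule abs_inner_le[OF _ B(2)[OF t]])
      also have "\<dots> < 1" using B by (simp add: \<delta>_def)
      finally show False using z0 by simp
    qed
    obtain s1 where s1: "near t x s1" using near_exists[OF t] by blast
    have same: "g t s2 = g t s1" if s2: "near t x s2" for s2
    proof -
      obtain k :: int where k: "s1 - L / 2 \<le> s2 + of_int k * L" "s2 + of_int k * L < s1 - L / 2 + L"
        using period_representative[OF L] .
      define s3 where "s3 = s2 + of_int k * L"
      have s3: "near t x s3" "g t s3 = g t s2" using s2 near_shift[OF t] shift0[OF t] by (simp_all add: s3_def)
      have h: "\<bar>s3 - s1\<bar> \<le> L / 2" using k unfolding s3_def by linarith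
      have "norm (g t s3 - g t s1) \<le> norm (x - g t s1) + norm (x - g t s3)"
        using norm_triangle_ineq4[of "x - g t s1" "x - g t s3"] by simp
      also have "\<dots> < 2 * \<rho>" using tube s1 s3(1) by (simp add: near_iff dist_norm)
      also have "\<dots> \<le> c" by (simp add: \<rho>_def)
      finally have "\<bar>s3 - s1\<bar> < \<delta>" using c(2)[OF t, of "s3 - s1" s1] h by force
      then have "s3 = s1" using no_two[OF s1 s3(1)] no_two[OF s3(1) s1] by (cases s1 s3 rule: linorder_cases) auto
      then show ?thesis using s3(2) by simp
    qed
    show ?thesis
      unfolding closest_unique_def
    proof (rule ex1I[of _ "g t s1"])
      show "g t s1 \<in> range (g t) \<and> dist x (g t s1) = infdist x (range (g t))"
        using s1 by (simp add: near_iff)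
      fix p assume "p \<in> range (g t) \<and> dist x p = infdist x (range (g t))"
      then obtain s2 where "p = g t s2" "near t x s2" by (auto simp: near_iff)
      then show "p = g t s1" using same by simp
    qed
  qed
  ultimately show thesis by (rule that)
qed

end

text \<open>It is used to obtain the velocity \<open>cross3 g1 g3\<close> of the tangent from the
  flow equation. The increment of \<open>F\<close> in \<open>s\<close> is an integral of
  \<open>F1\<close>; differentiating it in \<open>t\<close> under the integral and then in
  \<open>s\<close> compares \<open>W\<close> with \<open>Q\<close>. Nondegeneracy of the interval
  makes the derivative in \<open>t\<close> unique.\<close>

lemma mixed_partials_commute:
  fixes F F1 Ft W Q :: "real \<Rightarrow> real \<Rightarrow> 'a::euclidean_space"
  assumes ab: "a < b" and t: "t \<in> {a..b}"
    and F1: "\<And>t s. t \<in> {a..b} \<Longrightarrow> (F t has_vector_derivative F1 t s) (at s)"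
    and Ft: "\<And>t s. t \<in> {a..b} \<Longrightarrow> ((\<lambda>t. F t s) has_vector_derivative Ft t s) (at t within {a..b})"
    and W: "\<And>t s. t \<in> {a..b} \<Longrightarrow> ((\<lambda>t. F1 t s) has_vector_derivative W t s) (at t within {a..b})"
    and Q: "\<And>s. (Ft t has_vector_derivative Q t s) (at s)"
    and W_cont: "continuous_on ({a..b} \<times> UNIV) (\<lambda>(t, s). W t s)"
    and F1_cont: "\<And>t. t \<in> {a..b} \<Longrightarrow> continuous_on UNIV (F1 t)"
  shows "Q t s = W t s"
proof -
  define s0 where "s0 = s - 1"
  have nt: "at t within {a..b} \<noteq> bot" using ab t by (simp add: trivial_limit_within islimpt_Icc)
  have eq: "Ft t s' - Ft t s0 = integral {s0..s'} (W t)" if "s0 \<le> s'" for s'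
  proof -
    have I1: "F t' s' - F t' s0 = integral (cbox s0 s') (F1 t')" if "t' \<in> {a..b}" for t'
      unfolding cbox_interval
      by (intro integral_unique[symmetric] fundamental_theorem_of_calculus \<open>s0 \<le> s'\<close>)
        (use F1[OF that] has_vector_derivative_at_within in blast)
    have I2: "((\<lambda>t. integral (cbox s0 s') (F1 t)) has_vector_derivative integral (cbox s0 s') (W t)) (at t within {a..b})"
    proof (rule leibniz_rule_vector_derivative)
      show "continuous_on ({a..b} \<times> cbox s0 s') (\<lambda>(t, s). W t s)" by (rule continuous_on_subset[OF W_cont]) auto
      show "F1 t' integrable_on cbox s0 s'" if "t' \<in> {a..b}" for t'
        by (intro integrable_continuous continuous_on_subset[OF F1_cont[OF that]]) auto
    qed (use W t in auto)
    have I3: "((\<lambda>t. F t s' - F t s0) has_vector_derivative Ft t s' - Ft t s0) (at t within {a..b})"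
      by (intro has_vector_derivative_diff Ft t)
    have "((\<lambda>t. F t s' - F t s0) has_vector_derivative integral (cbox s0 s') (W t)) (at t within {a..b})"
      by (rule has_vector_derivative_transform[OF t I1 I2])
    then show ?thesis using vector_derivative_unique_within[OF nt I3] by simp
  qed
  have "continuous_on UNIV (W t)" by (rule slice_continuous[OF W_cont t])
  then have "((\<lambda>s'. integral {s0..s'} (W t)) has_vector_derivative W t s) (at s within {s0..s + 1})"
    by (intro integral_has_vector_derivative) (auto simp: s0_def intro: continuous_on_subset)
  then have "((\<lambda>s'. Ft t s' - Ft t s0) has_vector_derivative W t s) (at s within {s0..s + 1})"
    by (rule has_vector_derivative_transform[rotated 2]) (use eq in \<open>auto simp: s0_def\<close>)
  moreover have "((\<lambda>s'. Ft t s' - Ft t s0) has_vector_derivative Q t s - 0) (at s within {s0..s + 1})"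
    by (intro has_vector_derivative_diff has_vector_derivative_const has_vector_derivative_at_within[OF Q])
  moreover have "at s within {s0..s + 1} \<noteq> bot" by (simp add: s0_def trivial_limit_within islimpt_Icc)
  ultimately show ?thesis using vector_derivative_unique_within by fastforce
qed

section \<open>Weak binormal curvature flows\<close>

lemma smooth_d_s:
  assumes sm: "smooth_on (I \<times> UNIV) \<gamma>" and ds: "set ds \<subseteq> Basis" and t: "t \<in> I"
  shows "((\<lambda>s. iter_pdv ds \<gamma> (I \<times> UNIV) (t, s)) has_vector_derivative d_s I (iter_pdv ds \<gamma> (I \<times> UNIV)) (t, s)) (at s)"
proof -
  let ?F = "iter_pdv ds \<gamma> (I \<times> UNIV)"
  have "(0, 1) \<in> (Basis :: (real \<times> real) set)" by (simp add: Basis_prod_def)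
  then have "((\<lambda>h. ?F ((t, s) + h *\<^sub>R (0, 1))) has_vector_derivative pdv (0, 1) ?F (I \<times> UNIV) (t, s))
      (at 0 within {h. (t, s) + h *\<^sub>R (0, 1) \<in> I \<times> UNIV})"
    using sm ds t unfolding smooth_on_def by blast
  then have "((\<lambda>h. ?F (t, s + h)) has_vector_derivative d_s I ?F (t, s)) (at (s - s))"
    using t by (simp add: d_s_def)
  then have "(((\<lambda>h. ?F (t, s + h)) \<circ> (\<lambda>s'. s' - s)) has_vector_derivative 1 *\<^sub>R d_s I ?F (t, s)) (at s)"
    by (intro vector_diff_chain_at) (auto intro!: derivative_eq_intros)
  then show ?thesis by (simp add: o_def)
qed

lemma smooth_d_t:
  assumes sm: "smooth_on (I \<times> UNIV) \<gamma>" and ds: "set ds \<subseteq> Basis" and t: "t \<in> I"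
  shows "((\<lambda>t. iter_pdv ds \<gamma> (I \<times> UNIV) (t, s)) has_vector_derivative d_t I (iter_pdv ds \<gamma> (I \<times> UNIV)) (t, s)) (at t within I)"
proof -
  let ?F = "iter_pdv ds \<gamma> (I \<times> UNIV)"
  have "(1, 0) \<in> (Basis :: (real \<times> real) set)" by (simp add: Basis_prod_def)
  then have "((\<lambda>h. ?F ((t, s) + h *\<^sub>R (1, 0))) has_vector_derivative pdv (1, 0) ?F (I \<times> UNIV) (t, s))
      (at 0 within {h. (t, s) + h *\<^sub>R (1, 0) \<in> I \<times> UNIV})"
    using sm ds t unfolding smooth_on_def by blast
  moreover have "{h. (t, s) + h *\<^sub>R (1, 0) \<in> I \<times> UNIV} = (\<lambda>t'. t' - t) ` I"
    by (auto simp: image_iff) (metis add_diff_cancel_left')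
  ultimately have "((\<lambda>h. ?F (t + h, s)) has_vector_derivative d_t I ?F (t, s)) (at (t - t) within (\<lambda>t'. t' - t) ` I)"
    by (simp add: d_t_def)
  then have "(((\<lambda>h. ?F (t + h, s)) \<circ> (\<lambda>t'. t' - t)) has_vector_derivative 1 *\<^sub>R d_t I ?F (t, s)) (at t within I)"
    by (intro vector_diff_chain_within) (auto intro!: derivative_eq_intros)
  then show ?thesis by (simp add: o_def)
qed

text \<open>The statement for one curve, with the constant made explicit. Smoothness supplies the
  hypotheses on the curve; most of the remaining work shows that \<open>r_gamma\<close> is positive
  and gives the curvature bound and the uniqueness of nearest points.\<close>

lemma weighted_mass_estimate:
  fixes I :: "real set" and L :: real and \<gamma> :: "real \<times> real \<Rightarrow> real^3" and a b :: real
    and T0 :: current and T :: "real \<Rightarrow> current" and V :: "real \<Rightarrow> varifold"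
  defines "r \<equiv> r_gamma I \<gamma> {a..b}"
    and "M \<equiv> (SUP p\<in>{a..b} \<times> UNIV. norm (d_s I (d_s I (d_s I \<gamma>)) p))"
  defines "G \<equiv> \<lambda>t. mass T0 - (\<integral>p. X_field I \<gamma> r (fst p) t \<bullet> snd p \<partial>V t)"
    and "F \<equiv> \<lambda>t. \<integral>p. 1 - X_field I \<gamma> r (fst p) t \<bullet> snd p \<partial>V t"
  assumes L: "L > 0" and sm: "smooth_on (I \<times> UNIV) \<gamma>"
    and per: "\<forall>t\<in>I. \<forall>s. \<gamma> (t, s + L) = \<gamma> (t, s)"
    and flow: "\<forall>t\<in>I. \<forall>s. d_t I \<gamma> (t, s) = cross3 (d_s I \<gamma> (t, s)) (d_s I (d_s I \<gamma>) (t, s))"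
    and unit: "\<forall>t\<in>I. \<forall>s. norm (d_s I \<gamma> (t, s)) = 1"
    and inj: "\<forall>t\<in>I. inj_on (\<lambda>s. \<gamma> (t, s)) {0..<L}"
    and ab: "a \<le> b" and J: "{a..b} \<subseteq> I"
    and weak: "weak_BCF_with {a..b} T0 T V"
  shows "\<And>t. t \<in> {a..b} \<Longrightarrow> 0 \<le> F t \<and> F t \<le> G t" "\<exists>C. C-lipschitz_on {a..b} G"
    "AE t in lebesgue_on {a..b}. \<exists>D. (G has_real_derivative D) (at t within {a..b})
       \<and> \<bar>D\<bar> \<le> (77 / r\<^sup>2 + 28 * M) * F t \<and> (77 / r\<^sup>2 + 28 * M) * F t \<le> (77 / r\<^sup>2 + 28 * M) * G t"
proof -
  let ?S = "I \<times> (UNIV :: real set)"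
  have basis: "(1, 0) \<in> (Basis :: (real \<times> real) set)" "(0, 1) \<in> (Basis :: (real \<times> real) set)"
    by (simp_all add: Basis_prod_def)
  have it: "iter_pdv [] \<gamma> ?S = \<gamma>" "iter_pdv [(0, 1)] \<gamma> ?S = d_s I \<gamma>" "iter_pdv [(0, 1), (0, 1)] \<gamma> ?S = d_s I (d_s I \<gamma>)"
    "iter_pdv [(0, 1), (0, 1), (0, 1)] \<gamma> ?S = d_s I (d_s I (d_s I \<gamma>))"
    "iter_pdv [(1, 0), (0, 1)] \<gamma> ?S = d_t I (d_s I \<gamma>)"
    by (simp_all add: iter_pdv_def d_s_def d_t_def)
  define g g1 g2 g3 w where "g = (\<lambda>t s. \<gamma> (t, s))" and "g1 = (\<lambda>t s. d_s I \<gamma> (t, s))" and "g2 = (\<lambda>t s. d_s I (d_s I \<gamma>) (t, s))"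
    and "g3 = (\<lambda>t s. d_s I (d_s I (d_s I \<gamma>)) (t, s))" and "w = (\<lambda>t s. d_t I (d_s I \<gamma>) (t, s))"
  note gdefs = g_def g1_def g2_def g3_def w_def
  have cont: "continuous_on ({a..b} \<times> UNIV) (\<lambda>(t, s). iter_pdv ds \<gamma> ?S (t, s))" if "set ds \<subseteq> Basis" for ds
  proof -
    have "continuous_on ?S (iter_pdv ds \<gamma> ?S)" using sm that unfolding smooth_on_def by blast
    then show ?thesis using J by (simp add: case_prod_eta) (auto intro: continuous_on_subset)
  qed
  have c: "continuous_on ({a..b} \<times> UNIV) (\<lambda>(t, s). g t s)" "continuous_on ({a..b} \<times> UNIV) (\<lambda>(t, s). g1 t s)"
    "continuous_on ({a..b} \<times> UNIV) (\<lambda>(t, s). g2 t s)" "continuous_on ({a..b} \<times> UNIV) (\<lambda>(t, s). g3 t s)"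
    "continuous_on ({a..b} \<times> UNIV) (\<lambda>(t, s). w t s)"
    using cont[of "[]"] cont[of "[(0, 1)]"] cont[of "[(0, 1), (0, 1)]"] cont[of "[(0, 1), (0, 1), (0, 1)]"] cont[of "[(1, 0), (0, 1)]"]
    unfolding it gdefs using basis by simp_all
  have ds: "(g t has_vector_derivative g1 t s) (at s)" "(g1 t has_vector_derivative g2 t s) (at s)" "(g2 t has_vector_derivative g3 t s) (at s)"
    if "t \<in> {a..b}" for t s
    using smooth_d_s[OF sm, of "[]" t s] smooth_d_s[OF sm, of "[(0, 1)]" t s] smooth_d_s[OF sm, of "[(0, 1), (0, 1)]" t s] that J basis
    unfolding it gdefs by auto
  have dt: "((\<lambda>t. g t s) has_vector_derivative cross3 (g1 t s) (g2 t s)) (at t within {a..b})"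
    "((\<lambda>t. g1 t s) has_vector_derivative w t s) (at t within {a..b})" if "t \<in> {a..b}" for t s
  proof -
    have t: "t \<in> I" using that J by blast
    have "((\<lambda>t. g t s) has_vector_derivative cross3 (g1 t s) (g2 t s)) (at t within I)"
      using smooth_d_t[OF sm, of "[]" t s] t flow unfolding it gdefs by simp
    then show "((\<lambda>t. g t s) has_vector_derivative cross3 (g1 t s) (g2 t s)) (at t within {a..b})"
      by (rule has_vector_derivative_within_subset[OF _ J])
    have "((\<lambda>t. g1 t s) has_vector_derivative w t s) (at t within I)"
      using smooth_d_t[OF sm, of "[(0, 1)]" t s] t basis unfolding it gdefs by simp
    then show "((\<lambda>t. g1 t s) has_vector_derivative w t s) (at t within {a..b})"
      by (rule has_vector_derivative_within_subset[OF _ J])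
  qed
  interpret closed_curves a b L g g1 g2
    by unfold_locales (use ab L c ds per unit inj J in \<open>auto simp: gdefs\<close>)
  have dt1: "((\<lambda>t. g1 t s) has_vector_derivative cross3 (g1 t s) (g3 t s)) (at t within {a..b})" if t: "t \<in> {a..b}" for t s
  proof (cases "a < b")
    case True
    have "cross3 (g1 t s) (g3 t s) = w t s"
    proof (rule mixed_partials_commute[OF True t, where F=g and Ft="\<lambda>t s. cross3 (g1 t s) (g2 t s)" and Q="\<lambda>t s. cross3 (g1 t s) (g3 t s)"])
      show "((\<lambda>s. cross3 (g1 t s) (g2 t s)) has_vector_derivative cross3 (g1 t s) (g3 t s)) (at s)" for s
        using cross3_derivative[OF ds(2,3)[OF t]] by simp
      show "continuous_on UNIV (g1 t')" if "t' \<in> {a..b}" for t'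
        by (rule slice_continuous[OF c(2) that])
    qed (use ds dt c in auto)
    then show ?thesis using dt(2)[OF t, of s] by simp
  next
    case False
    then have "{a..b} = {t}" using t by auto
    \<comment> \<open>Within a single point every vector is a derivative, so the formula needs no
      commuting of partial derivatives.\<close>
    then have "at t within {a..b} = bot" by (simp add: at_within_eq_bot_iff)
    then show ?thesis by (simp add: has_vector_derivative_def has_derivative_def bounded_linear_scaleR_left)
  qed
  obtain B2 where B2: "B2 > 0" "\<And>t s. t \<in> {a..b} \<Longrightarrow> norm (g2 t s) \<le> B2"
    using periodic_bounded[OF cont2 per2] by blast
  have per3: "g3 t (s + L) = g3 t s" if "t \<in> {a..b}" for t s
    by (rule periodic_derivative[OF per2[OF that] ds(3)[OF that]])
  obtain B3 where B3: "B3 > 0" "\<And>t s. t \<in> {a..b} \<Longrightarrow> norm (g3 t s) \<le> B3"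
    using periodic_bounded[OF c(4) per3] by blast
  \<comment> \<open>Continuity and periodicity bound the third derivative on the noncompact index
    set, so the supremum \<open>M\<close> really is an upper bound.\<close>
  have tors: "norm (g3 t s) \<le> M" if "t \<in> {a..b}" for t s
    unfolding M_def g3_def by (rule cSUP_upper[of "(t, s)"]) (use that B3(2) in \<open>auto simp: g3_def intro!: bdd_aboveI[of _ B3]\<close>)
  obtain \<rho> where \<rho>: "\<rho> > 0" "\<And>t x. t \<in> {a..b} \<Longrightarrow> infdist x (range (g t)) < \<rho> \<Longrightarrow> closest_unique (range (g t)) x"
    using uniform_tubular_neighbourhood by blast
  define \<kappa> where "\<kappa> = (\<lambda>t. SUP s. norm (g2 t s))"
  define R where "R = (\<lambda>t. {\<rho>. \<rho> > 0 \<and> (\<forall>x. infdist x (range (g t)) < \<rho> \<longrightarrow> closest_unique (range (g t)) x)})"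
  have sec: "security_radius \<gamma> t = Sup (R t)" for t by (simp add: security_radius_def R_def g_def)
  have \<kappa>_upper: "norm (g2 t s) \<le> \<kappa> t" if "t \<in> {a..b}" for t s
    unfolding \<kappa>_def by (rule cSUP_upper) (use B2(2)[OF that] in \<open>auto intro!: bdd_aboveI[of _ B2]\<close>)
  have \<kappa>_pos: "0 < \<kappa> t" "\<kappa> t \<le> B2" if t: "t \<in> {a..b}" for t
  proof -
    obtain s where "g2 t s \<noteq> 0" using curvature_nonzero[OF t] by blast
    then show "0 < \<kappa> t" using \<kappa>_upper[OF t, of s] by (metis less_le_trans zero_less_norm_iff)
    show "\<kappa> t \<le> B2" unfolding \<kappa>_def by (rule cSUP_least) (use B2(2)[OF t] in auto)
  qed
  have R_mem: "\<rho> \<in> R t" if "t \<in> {a..b}" for t using \<rho> that by (simp add: R_def)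
  have R_bdd: "bdd_above (R t)" if t: "t \<in> {a..b}" for t
  proof -
    obtain x where x: "\<not> closest_unique (range (g t)) x" using ambiguous_point[OF t] by blast
    have "\<sigma> \<le> infdist x (range (g t))" if "\<sigma> \<in> R t" for \<sigma>
      using that x unfolding R_def by force
    then show ?thesis by (rule bdd_aboveI)
  qed
  define f where "f = (\<lambda>t. min (inverse (\<kappa> t)) (Sup (R t)))"
  have r_eq: "r = (1 / 2) * (INF t\<in>{a..b}. f t)"
    unfolding r_def r_gamma_def f_def \<kappa>_def sec g2_def ..
  have f_lower: "min (inverse B2) \<rho> \<le> f t" if t: "t \<in> {a..b}" for t
  proof -
    have "inverse B2 \<le> inverse (\<kappa> t)" using \<kappa>_pos[OF t] by (simp add: le_imp_inverse_le)
    moreover have "\<rho> \<le> Sup (R t)" by (rule cSup_upper[OF R_mem[OF t] R_bdd[OF t]])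
    ultimately show ?thesis by (auto simp: f_def)
  qed
  have "min (inverse B2) \<rho> \<le> (INF t\<in>{a..b}. f t)"
    by (rule cINF_greatest) (use f_lower ab in auto)
  moreover have "0 < min (inverse B2) \<rho>" using B2(1) \<rho>(1) by simp
  ultimately have r_pos: "r > 0" unfolding r_eq by linarith
  have r_le: "2 * r \<le> f t" if t: "t \<in> {a..b}" for t
  proof -
    have "(INF t\<in>{a..b}. f t) \<le> f t"
      by (rule cINF_lower[OF _ t]) (use f_lower in \<open>auto intro!: bdd_belowI[of _ "min (inverse B2) \<rho>"]\<close>)
    then show ?thesis by (simp add: r_eq)
  qed
  have curv: "norm (g2 t s) \<le> 1 / (2 * r)" if t: "t \<in> {a..b}" for t s
  proof -
    have "2 * r \<le> inverse (\<kappa> t)" using r_le[OF t] by (simp add: f_def)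
    then have "\<kappa> t \<le> 1 / (2 * r)" using \<kappa>_pos(1)[OF t] r_pos by (simp add: field_simps)
    then show ?thesis using \<kappa>_upper[OF t, of s] by linarith
  qed
  \<comment> \<open>Lying strictly below the supremum is enough: some member of \<open>R t\<close>
    exceeds the distance, and membership is exactly uniqueness.\<close>
  have uniq: "closest_unique (range (g t)) x" if t: "t \<in> {a..b}" and x: "infdist x (range (g t)) < 2 * r" for t x
  proof -
    have "infdist x (range (g t)) < Sup (R t)" using x r_le[OF t] by (simp add: f_def)
    then obtain \<sigma> where "\<sigma> \<in> R t" "infdist x (range (g t)) < \<sigma>"
      using less_cSupD[of "R t"] R_mem[OF t] by blast
    then show ?thesis by (simp add: R_def)
  qed
  interpret curve_family a b L g g1 g2 g3 r M
    by unfold_locales (use c ds dt dt1 r_pos tors curv uniq in auto)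
  have vf: "varifold_flow a b V (mass T0)"
    using weak by unfold_locales (auto simp: weak_BCF_with_def)
  have X: "X_field I \<gamma> r x t = lift fX t x" if "t \<in> {a..b}" for t x
    by (rule X_field_eq_lift[OF that]) (simp_all add: gdefs)
  \<comment> \<open>The field and its lift are known to agree at times in \<open>{a..b}\<close>
    only, so Lipschitz continuity and derivatives are carried over within that set.\<close>
  define G' where "G' = (\<lambda>t. mass T0 - (\<integral>p. lift fX t (fst p) \<bullet> snd p \<partial>V t))"
  define F' where "F' = (\<lambda>t. \<integral>p. 1 - lift fX t (fst p) \<bullet> snd p \<partial>V t)"
  have GF: "G t = G' t" "F t = F' t" if "t \<in> {a..b}" for t
    using X[OF that] by (simp_all add: G_def G'_def F_def F'_def)
  note st = stability_estimate[OF vf]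
  show "0 \<le> F t \<and> F t \<le> G t" if "t \<in> {a..b}" for t
    using st(1)[OF that] unfolding GF[OF that] G'_def F'_def .
  obtain C where "C-lipschitz_on {a..b} G'" using st(2) unfolding G'_def by blast
  then have "C-lipschitz_on {a..b} G" unfolding lipschitz_on_def using GF(1) by simp
  then show "\<exists>C. C-lipschitz_on {a..b} G" by blast
  have "AE t in lebesgue_on {a..b}. t \<in> {a..b}" by (rule AE_I2) auto
  with st(3) show "AE t in lebesgue_on {a..b}. \<exists>D. (G has_real_derivative D) (at t within {a..b})
       \<and> \<bar>D\<bar> \<le> (77 / r\<^sup>2 + 28 * M) * F t \<and> (77 / r\<^sup>2 + 28 * M) * F t \<le> (77 / r\<^sup>2 + 28 * M) * G t"
  proof eventually_elim
    case (elim t)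
    then obtain D where D: "(G' has_real_derivative D) (at t within {a..b})"
      "\<bar>D\<bar> \<le> (77 / r\<^sup>2 + 28 * M) * F' t \<and> (77 / r\<^sup>2 + 28 * M) * F' t \<le> (77 / r\<^sup>2 + 28 * M) * G' t"
      unfolding G'_def F'_def by blast
    have "(G has_real_derivative D) (at t within {a..b})"
      by (rule has_field_derivative_transform_within[OF D(1) zero_less_one elim(2)]) (simp add: GF)
    then show ?case using D(2) GF[OF elim(2)] by auto
  qed
qed

theorem theorem3:
  "\<exists>\<kappa> :: real \<Rightarrow> real \<Rightarrow> real.
   \<forall>(I::real set) (L::real) (\<gamma>::real \<times> real \<Rightarrow> real^3) (a::real) (b::real)
     (T0::current) (T::real \<Rightarrow> current) (V::real \<Rightarrow> varifold).
     is_interval I \<and> 0 \<in> I \<and> L > 0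
     \<and> smooth_on (I \<times> UNIV) \<gamma>
     \<and> (\<forall>t\<in>I. \<forall>s. \<gamma> (t, s + L) = \<gamma> (t, s))
     \<and> (\<forall>t\<in>I. \<forall>s. d_t I \<gamma> (t, s) = cross3 (d_s I \<gamma> (t, s)) (d_s I (d_s I \<gamma>) (t, s)))
     \<and> (\<forall>t\<in>I. \<forall>s. norm (d_s I \<gamma> (t, s)) = 1)
     \<and> (\<forall>t\<in>I. inj_on (\<lambda>s. \<gamma> (t, s)) {0..<L})
     \<and> a \<le> 0 \<and> 0 \<le> b \<and> {a..b} \<subseteq> I
     \<and> in_calT T0
     \<and> weak_BCF_with {a..b} T0 T V
     \<and> (\<forall>X. test_field X \<longrightarrow> T 0 X = T0 X)
     \<longrightarrow>
     (let J = {a..b};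
          r = r_gamma I \<gamma> J;
          M = (SUP p\<in>J \<times> UNIV. norm (d_s I (d_s I (d_s I \<gamma>)) p));
          K = \<kappa> r M;
          G = (\<lambda>t. mass T0 - (\<integral>p. X_field I \<gamma> r (fst p) t \<bullet> snd p \<partial>V t));
          F = (\<lambda>t. \<integral>p. 1 - X_field I \<gamma> r (fst p) t \<bullet> snd p \<partial>V t)
      in (\<forall>t\<in>J. 0 \<le> F t \<and> F t \<le> G t)
         \<and> (\<exists>C. C-lipschitz_on J G)
         \<and> (AE t in lebesgue_on J. \<exists>D. (G has_real_derivative D) (at t within J)
                 \<and> \<bar>D\<bar> \<le> K * F t \<and> K * F t \<le> K * G t))"
\<comment> \<open>The function is fixed before the interval, the curve and the flow are chosen,
  which is how the constant depends only on r and the third-derivative bound.\<close>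
proof (intro exI[of _ "\<lambda>r M. 77 / r\<^sup>2 + 28 * M"] allI impI, elim conjE, goal_cases)
  case (1 I L \<gamma> a b T0 T V)
  note estimate = weighted_mass_estimate[OF 1(3-8) order_trans[OF 1(9,10)] 1(11,13)]
  show ?case
    unfolding Let_def by (intro conjI[OF _ conjI] ballI estimate)
qed

end
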